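(* Let $f=(x_{2}-xx_{1})^{c}\in\mathbb{C}\{x,x_1,x_2\}$ for some integer $c\ge 1$. Then there exist $\varphi_{1},\varphi_{2} \in \mathcal{D}_{f} \subset \mathrm{Diff}_{up}(\mathbb{C}^{3},0)$ such that $\varphi_{1} \sim_{*} \varphi_{2}$ but not $\varphi_{1} \stackrel{t}{\sim}_{*} \varphi_{2}$.
   Context: Coordinates on $\mathbb{C}^{3}$ are $(x,x_1,x_2)$. $\mathrm{Diff}_{up}(\mathbb{C}^{3},0)$ is the group of germs at $0$ of complex analytic diffeomorphisms $\varphi$ of $\mathbb{C}^3$ fixing $0$ with $x_j\circ\varphi=x_j$ for $j=1,2$ and $(\partial(x\circ\varphi)/\partial x)(0)=1$. $\widehat{\mathrm{Diff}}_{p}(\mathbb{C}^{3},0)$ is the group of formal diffeomorphisms $\hat\sigma$ at $0$ (power series components without constant term, invertible linear part) with $x_j\circ\hat\sigma=x_j$ for $j=1,2$. $\mathcal{D}_f$ is the set of $\varphi\in\mathrm{Diff}_{up}(\mathbb{C}^{3},0)$ such that $(x\circ\varphi-x)/f$ is a unit of $\mathbb{C}\{x,x_1,x_2\}$. For a germ of analytic set $\gamma$ at $0$, $I(\gamma)$ is the ideal of holomorphic germs vanishing on $\gamma$; we use the same notation for the ideal it generates in the formal power series ring. A germ of analytic set is fibered if it is a union of orbits of $\partial/\partial x$ (here $f=0$ is irreducible as a set and not fibered). $\hat\sigma\in\widehat{\mathrm{Diff}}_{p}(\mathbb{C}^{3},0)$ is normalized (with respect to $f=0$) if $x\circ\hat\sigma-x\in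 I(\gamma)$ for every non-fibered irreducible component $\gamma$ of $f=0$. $\hat\sigma$ is transversally formal along $f=0$ if each component $g$ of $\hat\sigma$ can be written as $g=\sum_{k\ge0}c_k$ with $c_k\in\mathbb{C}\{x,x_1,x_2\}\cap I(\{f=0\})^k$ for all $k\ge 0$. For $\varphi_1,\varphi_2\in\mathcal{D}_f$: $\varphi_1\sim_*\varphi_2$ means that there is a normalized $\hat\sigma\in\widehat{\mathrm{Diff}}_{p}(\mathbb{C}^{3},0)$ with $\hat\sigma\circ\varphi_1=\varphi_2\circ\hat\sigma$; $\varphi_1\stackrel{t}{\sim}_*\varphi_2$ means that such a normalized $\hat\sigma$ can be chosen transversally formal along $f=0$. *)

theory Defs
  imports "HOL-Analysis.Analysis" "HOL-Computational_Algebra.Formal_Power_Series"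
begin

section \<open>Power series in the variables \<open>x\<close>, \<open>x1\<close>, \<open>x2\<close>\<close>

text \<open>The ring \<open>\<complex>[[x, x1, x2]]\<close> is realised as \<open>\<complex>[[x2]][[x1]][[x]]\<close>, so that the ring structure is
  the one of the library.\<close>

type_synonym ser = "complex fps fps fps"

definition coeff3 :: "ser \<Rightarrow> nat \<Rightarrow> nat \<Rightarrow> nat \<Rightarrow> complex" where
  "coeff3 F i j k = fps_nth (fps_nth (fps_nth F i) j) k"

definition X :: ser where "X = fps_X"
definition X1 :: ser where "X1 = fps_const fps_X"
definition X2 :: ser where "X2 = fps_const (fps_const fps_X)"

text \<open>Germs at \<open>0\<close> of holomorphic functions are identified with their Taylor series: \<open>\<complex>{x, x1, x2}\<close>
  is the subring of series converging absolutely on some polydisc around \<open>0\<close>.\<close>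

definition conv :: "ser set" where
  "conv = {F. \<exists>r>0. (\<lambda>(i, j, k). norm (coeff3 F i j k) * r ^ (i + j + k)) summable_on UNIV}"

definition conv_units :: "ser set" where
  "conv_units = {u \<in> conv. \<exists>v\<in>conv. u * v = 1}"

type_synonym point = "complex \<times> complex \<times> complex"

text \<open>Only meaningful for convergent \<open>F\<close> and points close to \<open>0\<close>.\<close>

definition eval3 :: "ser \<Rightarrow> point \<Rightarrow> complex" where
  "eval3 F = (\<lambda>(a, b, c). \<Sum>\<^sub>\<infinity>(i, j, k)\<in>UNIV. coeff3 F i j k * a ^ i * b ^ j * c ^ k)"


section \<open>Formal and analytic diffeomorphisms\<close>

text \<open>A formal map is the triple of its components \<open>(x \<circ> \<sigma>, x1 \<circ> \<sigma>, x2 \<circ> \<sigma>)\<close>.\<close>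

type_synonym fmap = "ser \<times> ser \<times> ser"

text \<open>\<open>F(G, G1, G2)\<close> for series \<open>G, G1, G2\<close> without constant term: then \<open>G^i * G1^j * G2^k\<close> has order
  at least \<open>i + j + k\<close>, so that only the terms with \<open>i + j + k \<le> l + m + n\<close> contribute to the
  coefficient of \<open>x^l * x1^m * x2^n\<close>.\<close>

definition subst3 :: "ser \<Rightarrow> fmap \<Rightarrow> ser" where
  "subst3 F = (\<lambda>(G, G1, G2). Abs_fps (\<lambda>l. Abs_fps (\<lambda>m. Abs_fps (\<lambda>n.
     \<Sum>(i, j, k) | i + j + k \<le> l + m + n.
       coeff3 F i j k * coeff3 (G ^ i * G1 ^ j * G2 ^ k) l m n))))"

definition fcomp :: "fmap \<Rightarrow> fmap \<Rightarrow> fmap" where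
  "fcomp \<sigma> \<tau> = (case \<sigma> of (S, S1, S2) \<Rightarrow> (subst3 S \<tau>, subst3 S1 \<tau>, subst3 S2 \<tau>))"

definition linear_form :: "ser \<Rightarrow> complex ^ 3" where
  "linear_form F = vector [coeff3 F 1 0 0, coeff3 F 0 1 0, coeff3 F 0 0 1]"

definition linear_part :: "fmap \<Rightarrow> complex ^ 3 ^ 3" where
  "linear_part = (\<lambda>(S, S1, S2). vector [linear_form S, linear_form S1, linear_form S2])"

definition formal_Diff :: "fmap set" where
  "formal_Diff = {(S, S1, S2).
     coeff3 S 0 0 0 = 0 \<and> coeff3 S1 0 0 0 = 0 \<and> coeff3 S2 0 0 0 = 0 \<and>
     invertible (linear_part (S, S1, S2))}"

text \<open>Germs of analytic diffeomorphisms fixing \<open>0\<close>, i.e. germs of holomorphic maps fixing \<open>0\<close> and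
  invertible at \<open>0\<close> in the sense of the inverse function theorem.\<close>

definition Diff :: "fmap set" where
  "Diff = formal_Diff \<inter> conv \<times> conv \<times> conv"

definition formal_Diff_p :: "fmap set" where
  "formal_Diff_p = {(S, S1, S2) \<in> formal_Diff. S1 = X1 \<and> S2 = X2}"

definition Diff_up :: "fmap set" where
  "Diff_up = {(S, S1, S2) \<in> Diff. S1 = X1 \<and> S2 = X2 \<and> coeff3 S 1 0 0 = 1}"

definition D_set :: "ser \<Rightarrow> fmap set" where
  "D_set f = {\<phi> \<in> Diff_up. \<exists>u\<in>conv_units. fst \<phi> - X = u * f}"


section \<open>Ideals\<close>

text \<open>Ideals of a commutative ring are the submodules of the ring acting on itself.\<close>

definition ideal_gen :: "'a::comm_ring_1 set \<Rightarrow> 'a set" where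
  "ideal_gen = module.span (*)"

primrec ideal_power :: "'a::comm_ring_1 set \<Rightarrow> nat \<Rightarrow> 'a set" where
  "ideal_power I 0 = UNIV"
| "ideal_power I (Suc k) = ideal_gen {a * b | a b. a \<in> I \<and> b \<in> ideal_power I k}"


section \<open>Germs of analytic sets\<close>

text \<open>Germs of sets at \<open>0\<close> are represented by sets of points; equality and inclusion of germs are
  equality and inclusion in some neighbourhood of \<open>0\<close>.\<close>

definition germ_subset :: "point set \<Rightarrow> point set \<Rightarrow> bool" where
  "germ_subset A B \<longleftrightarrow> (\<forall>\<^sub>F p in nhds 0. p \<in> A \<longrightarrow> p \<in> B)"

definition germ_eq :: "point set \<Rightarrow> point set \<Rightarrow> bool" where
  "germ_eq A B \<longleftrightarrow> (\<forall>\<^sub>F p in nhds 0. p \<in> A \<longleftrightarrow> p \<in> B)"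

definition zero_set :: "ser set \<Rightarrow> point set" where
  "zero_set E = {p. \<forall>g\<in>E. eval3 g p = 0}"

definition analytic_germ :: "point set \<Rightarrow> bool" where
  "analytic_germ A \<longleftrightarrow> (\<exists>E. finite E \<and> E \<subseteq> conv \<and> germ_eq A (zero_set E))"

definition irreducible_germ :: "point set \<Rightarrow> bool" where
  "irreducible_germ A \<longleftrightarrow> analytic_germ A \<and> \<not> germ_eq A {} \<and>
     (\<forall>B C. analytic_germ B \<and> analytic_germ C \<and> germ_eq A (B \<union> C) \<longrightarrow> germ_eq A B \<or> germ_eq A C)"

definition irreducible_component :: "point set \<Rightarrow> point set \<Rightarrow> bool" where
  "irreducible_component \<gamma> A \<longleftrightarrow> irreducible_germ \<gamma> \<and> germ_subset \<gamma> A \<and>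
     (\<forall>B. irreducible_germ B \<and> germ_subset \<gamma> B \<and> germ_subset B A \<longrightarrow> germ_eq B \<gamma>)"

text \<open>The orbits of \<open>\<partial>/\<partial>x\<close> are the lines \<open>\<complex> \<times> {(b, c)}\<close>.\<close>

definition fibered :: "point set \<Rightarrow> bool" where
  "fibered A \<longleftrightarrow> (\<exists>B :: (complex \<times> complex) set. germ_eq A (UNIV \<times> B))"

definition vanishing_ideal :: "point set \<Rightarrow> ser set" where
  "vanishing_ideal A = {g \<in> conv. \<forall>\<^sub>F p in nhds 0. p \<in> A \<longrightarrow> eval3 g p = 0}"

definition formal_vanishing_ideal :: "point set \<Rightarrow> ser set" where
  "formal_vanishing_ideal A = ideal_gen (vanishing_ideal A)"


section \<open>Normalized and transversally formal diffeomorphisms; conjugacy\<close>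

definition normalized :: "ser \<Rightarrow> fmap \<Rightarrow> bool" where
  "normalized f \<sigma> \<longleftrightarrow> (\<forall>\<gamma>. irreducible_component \<gamma> (zero_set {f}) \<and> \<not> fibered \<gamma> \<longrightarrow>
     fst \<sigma> - X \<in> formal_vanishing_ideal \<gamma>)"

text \<open>Convergence of series in the Krull topology of \<open>\<complex>[[x, x1, x2]]\<close>: every coefficient of the
  partial sums is eventually constant. (The metric of the library on iterated \<open>fps\<close> is adic with
  respect to \<open>x\<close> only.)\<close>

definition krull_sums :: "(nat \<Rightarrow> ser) \<Rightarrow> ser \<Rightarrow> bool" where
  "krull_sums c g \<longleftrightarrow>
     (\<forall>i j k. \<forall>\<^sub>F n in sequentially. coeff3 (\<Sum>m<n. c m) i j k = coeff3 g i j k)"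

definition transversally_formal_ser :: "ser \<Rightarrow> ser \<Rightarrow> bool" where
  "transversally_formal_ser f g \<longleftrightarrow> (\<exists>c. krull_sums c g \<and>
     (\<forall>k. c k \<in> conv \<inter> ideal_power (formal_vanishing_ideal (zero_set {f})) k))"

definition transversally_formal :: "ser \<Rightarrow> fmap \<Rightarrow> bool" where
  "transversally_formal f = (\<lambda>(S, S1, S2). transversally_formal_ser f S \<and>
     transversally_formal_ser f S1 \<and> transversally_formal_ser f S2)"

definition conj_formal :: "ser \<Rightarrow> fmap \<Rightarrow> fmap \<Rightarrow> bool" where
  "conj_formal f \<phi>1 \<phi>2 \<longleftrightarrow>
     (\<exists>\<sigma>\<in>formal_Diff_p. normalized f \<sigma> \<and> fcomp \<sigma> \<phi>1 = fcomp \<phi>2 \<sigma>)"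

definition conj_transversally_formal :: "ser \<Rightarrow> fmap \<Rightarrow> fmap \<Rightarrow> bool" where
  "conj_transversally_formal f \<phi>1 \<phi>2 \<longleftrightarrow>
     (\<exists>\<sigma>\<in>formal_Diff_p. normalized f \<sigma> \<and> transversally_formal f \<sigma> \<and>
        fcomp \<sigma> \<phi>1 = fcomp \<phi>2 \<sigma>)"

end

theory Submission
  imports Defs "HOL-Computational_Algebra.Polynomial" "HOL-Complex_Analysis.Cauchy_Integral_Formula"
begin

text \<open>
  Let \<open>g = x2 - x * x1\<close> and let \<open>Phi s\<close> be the flow of \<open>Y = g^c * d/dx\<close> for the time \<open>s\<close>, a power
  series. We take \<open>\<phi>2 = Phi 1\<close> and \<open>\<phi>1 = Phi (1 + t * g^c * w)\<close> with \<open>w = \<Sum>j. x^(3^j)\<close>. Since \<open>Y\<close> raises the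
  degree in \<open>(x1, x2)\<close>, all the sums over iterates of \<open>Y\<close> are locally finite. The map \<open>Phi s\<close> conjugates
  \<open>\<phi>1\<close> to \<open>\<phi>2\<close> if and only if \<open>s \<circ> \<phi>1 - s = - t * g^c * w\<close>; this equation has a formal solution, every
  formal conjugacy is \<open>Phi s\<close> for a solution \<open>s\<close>, and solutions differ by functions of \<open>x1\<close>, \<open>x2\<close>.

  A transversally formal conjugacy makes the restriction of \<open>s\<close> to \<open>g = 0\<close> converge. After the
  substitution \<open>x2 = x * x1\<close> the functions of \<open>x1\<close>, \<open>x2\<close> only involve monomials \<open>x^p * x1^q\<close> with \<open>p \<le> q\<close>, so
  the coefficients with \<open>p > q\<close> do not depend on the choice of \<open>s\<close>. They are polynomials in \<open>t\<close>. The
  linear term in \<open>t\<close> converges, but the quadratic one is a sum of Bernoulli numbers times integrals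
  \<open>\<integral> w * Y^(2 * l) (g^c * w) dx\<close>, which after integration by parts are integrals of squares and
  grow factorially. If the series converged for every \<open>t\<close>, then Baire's theorem and Cauchy's estimates
  would bound the coefficients of \<open>t^2\<close> geometrically.
\<close>

text \<open>For one fixed \<open>t\<close> all powers of \<open>t\<close> contribute to the same
  coefficient of \<open>s\<close>, and cancellation between them cannot be excluded. Hence all
  \<open>t\<close> are treated at once, which isolates \<open>t^2\<close> but names no explicit bad
  \<open>t\<close>. This costs only a geometric factor because \<open>t^(n+1)\<close> enters
  \<open>s\<close> in degree at least \<open>n\<close> in (x1, x2), so that the polynomials in
  \<open>t\<close> have controlled degree.

  The conjugacy has the form \<open>x + gg^c * (...)\<close>, so its derivative of order
  \<open>c\<close> in \<open>x2\<close> is the one that exposes the time \<open>s\<close> on the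
  surface.

  The Bernoulli numbers occur divided by factorials and decay geometrically; a lower bound on them
  is enough, and all the growth comes from the integrals. Those with odd index above 1 vanish, which
  is why even powers of \<open>Y\<close> are used. Two gradings select the terms: the degree in (x1,
  x2) fixes the exponent \<open>2 * l\<close> of \<open>Y\<close>, and the degree in (x, x2) fixes
  the sum \<open>2 * l\<close> of the exponents of the two monomials of \<open>w\<close>. When both
  exponents equal \<open>l\<close>, the integral is up to sign that of a square with a nonnegative
  weight.\<close>

definition mk3 :: "(nat \<Rightarrow> nat \<Rightarrow> nat \<Rightarrow> complex) \<Rightarrow> ser" where
  "mk3 f = Abs_fps (\<lambda>i. Abs_fps (\<lambda>j. Abs_fps (\<lambda>k. f i j k)))"

definition cst :: "complex \<Rightarrow> ser" where
  "cst a = fps_const (fps_const (fps_const a))"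

lemma coeff3_ext: "(\<And>i j k. coeff3 F i j k = coeff3 G i j k) \<Longrightarrow> F = G"
  by (simp add: fps_eq_iff coeff3_def)

lemma coeff3_mk3 [simp]: "coeff3 (mk3 f) i j k = f i j k"
  by (simp add: coeff3_def mk3_def)

lemma coeff3_add [simp]: "coeff3 (F + G) i j k = coeff3 F i j k + coeff3 G i j k"
  by (simp add: coeff3_def)

lemma coeff3_diff [simp]: "coeff3 (F - G) i j k = coeff3 F i j k - coeff3 G i j k"
  by (simp add: coeff3_def)

lemma coeff3_minus [simp]: "coeff3 (- F) i j k = - coeff3 F i j k"
  by (simp add: coeff3_def)

lemma coeff3_0 [simp]: "coeff3 0 i j k = 0"
  by (simp add: coeff3_def)

lemma coeff3_sum [simp]: "coeff3 (sum f A) i j k = (\<Sum>a\<in>A. coeff3 (f a) i j k)"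
  by (induction A rule: infinite_finite_induct) auto

lemma coeff3_mult:
  "coeff3 (F * G) i j k =
     (\<Sum>a\<le>i. \<Sum>b\<le>j. \<Sum>d\<le>k. coeff3 F a b d * coeff3 G (i - a) (j - b) (k - d))"
  by (simp add: coeff3_def fps_mult_nth fps_sum_nth atLeast0AtMost)

lemma coeff3_cst: "coeff3 (cst a) i j k = (if i = 0 \<and> j = 0 \<and> k = 0 then a else 0)"
  by (simp add: coeff3_def cst_def)

lemma coeff3_1: "coeff3 1 i j k = (if i = 0 \<and> j = 0 \<and> k = 0 then 1 else 0)"
  by (simp add: coeff3_def)

lemma coeff3_cst_mult [simp]: "coeff3 (cst a * F) i j k = a * coeff3 F i j k"
  by (simp add: coeff3_def cst_def)

lemma cst_add: "cst (a + b) = cst a + cst b"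
  by (simp add: cst_def)

lemma cst_mult: "cst (a * b) = cst a * cst b"
  by (simp add: cst_def)

lemma cst_0 [simp]: "cst 0 = 0" and cst_1 [simp]: "cst 1 = 1"
  by (simp_all add: cst_def)

lemma cst_minus: "cst (- a) = - cst a"
  by (rule coeff3_ext) (simp add: coeff3_cst)

lemma cst_power: "cst (a ^ n) = cst a ^ n"
  by (induction n) (simp_all add: cst_mult)

lemma cst_sum: "cst (sum f A) = (\<Sum>a\<in>A. cst (f a))"
  by (induction A rule: infinite_finite_induct) (auto simp: cst_add)

lemma cst_of_nat: "cst (of_nat n) = of_nat n"
  by (induction n) (auto simp: cst_add)

lemma coeff3_X_mult: "coeff3 (X * F) i j k = (if i = 0 then 0 else coeff3 F (i - 1) j k)"
  by (simp add: coeff3_def X_def)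

lemma coeff3_X1_mult: "coeff3 (X1 * F) i j k = (if j = 0 then 0 else coeff3 F i (j - 1) k)"
  by (simp add: coeff3_def X1_def)

lemma coeff3_X2_mult: "coeff3 (X2 * F) i j k = (if k = 0 then 0 else coeff3 F i j (k - 1))"
  by (simp add: coeff3_def X2_def)

lemma coeff3_X: "coeff3 X i j k = (if i = 1 \<and> j = 0 \<and> k = 0 then 1 else 0)"
  using coeff3_X_mult[of 1 i j k] by (auto simp: coeff3_1 split: if_splits)

lemma coeff3_X1: "coeff3 X1 i j k = (if i = 0 \<and> j = 1 \<and> k = 0 then 1 else 0)"
  using coeff3_X1_mult[of 1 i j k] by (auto simp: coeff3_1 split: if_splits)

lemma coeff3_X2: "coeff3 X2 i j k = (if i = 0 \<and> j = 0 \<and> k = 1 then 1 else 0)"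
  using coeff3_X2_mult[of 1 i j k] by (auto simp: coeff3_1 split: if_splits)

lemma coeff3_monom_mult:
  "coeff3 (X ^ a * X1 ^ b * X2 ^ d * F) i j k =
     (if a \<le> i \<and> b \<le> j \<and> d \<le> k then coeff3 F (i - a) (j - b) (k - d) else 0)"
proof -
  have 1: "coeff3 (X ^ a * F) i j k = (if a \<le> i then coeff3 F (i - a) j k else 0)" for F a i j k
    by (induction a arbitrary: i) (auto simp: mult.assoc coeff3_X_mult)
  have 2: "coeff3 (X1 ^ a * F) i j k = (if a \<le> j then coeff3 F i (j - a) k else 0)" for F a i j k
    by (induction a arbitrary: j) (auto simp: mult.assoc coeff3_X1_mult)
  have 3: "coeff3 (X2 ^ a * F) i j k = (if a \<le> k then coeff3 F i j (k - a) else 0)" for F a i j k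
    by (induction a arbitrary: k) (auto simp: mult.assoc coeff3_X2_mult)
  show ?thesis by (simp add: mult.assoc 1 2 3)
qed

lemma coeff3_monom:
  "coeff3 (X ^ a * X1 ^ b * X2 ^ d) i j k = (if i = a \<and> j = b \<and> k = d then 1 else 0)"
  using coeff3_monom_mult[of a b d 1 i j k] by (auto simp: coeff3_1)

subsection \<open>Weighted filtrations\<close>

text \<open>The weights of (x, x1, x2) in use are (0,1,1), for all infinite sums; (1,1,1), the usual
  order, for substitution; and (1,0,1), which measures the exponent of \<open>x\<close> on the
  surface. \<open>gg\<close> is homogeneous for the first and the last.\<close>

definition ordge :: "nat \<Rightarrow> nat \<Rightarrow> nat \<Rightarrow> nat \<Rightarrow> ser set" where
  "ordge \<alpha> \<beta> \<gamma> n = {F. \<forall>i j k. \<alpha> * i + \<beta> * j + \<gamma> * k < n \<longrightarrow> coeff3 F i j k = 0}"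

definition homog :: "nat \<Rightarrow> nat \<Rightarrow> nat \<Rightarrow> nat \<Rightarrow> ser set" where
  "homog \<alpha> \<beta> \<gamma> n = {F. \<forall>i j k. \<alpha> * i + \<beta> * j + \<gamma> * k \<noteq> n \<longrightarrow> coeff3 F i j k = 0}"

lemma ordgeI: "(\<And>i j k. \<alpha> * i + \<beta> * j + \<gamma> * k < n \<Longrightarrow> coeff3 F i j k = 0) \<Longrightarrow> F \<in> ordge \<alpha> \<beta> \<gamma> n"
  by (auto simp: ordge_def)

lemma ordgeD: "F \<in> ordge \<alpha> \<beta> \<gamma> n \<Longrightarrow> \<alpha> * i + \<beta> * j + \<gamma> * k < n \<Longrightarrow> coeff3 F i j k = 0"
  by (auto simp: ordge_def)

lemma homogD: "F \<in> homog \<alpha> \<beta> \<gamma> n \<Longrightarrow> \<alpha> * i + \<beta> * j + \<gamma> * k \<noteq> n \<Longrightarrow> coeff3 F i j k = 0"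
  by (auto simp: homog_def)

lemma homog_ordge: "F \<in> homog \<alpha> \<beta> \<gamma> n \<Longrightarrow> F \<in> ordge \<alpha> \<beta> \<gamma> n"
  by (auto simp: homog_def ordge_def)

lemma ordge_0 [simp]: "ordge \<alpha> \<beta> \<gamma> 0 = UNIV"
  by (auto simp: ordge_def)

lemma zero_ordge [simp]: "0 \<in> ordge \<alpha> \<beta> \<gamma> n"
  by (auto simp: ordge_def)

lemma ordge_mono: "F \<in> ordge \<alpha> \<beta> \<gamma> n \<Longrightarrow> m \<le> n \<Longrightarrow> F \<in> ordge \<alpha> \<beta> \<gamma> m"
  by (auto simp: ordge_def)

lemma ordge_add: "F \<in> ordge \<alpha> \<beta> \<gamma> n \<Longrightarrow> G \<in> ordge \<alpha> \<beta> \<gamma> n \<Longrightarrow> F + G \<in> ordge \<alpha> \<beta> \<gamma> n"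
  by (auto simp: ordge_def)

lemma ordge_diff: "F \<in> ordge \<alpha> \<beta> \<gamma> n \<Longrightarrow> G \<in> ordge \<alpha> \<beta> \<gamma> n \<Longrightarrow> F - G \<in> ordge \<alpha> \<beta> \<gamma> n"
  by (auto simp: ordge_def)

lemma ordge_minus: "F \<in> ordge \<alpha> \<beta> \<gamma> n \<Longrightarrow> - F \<in> ordge \<alpha> \<beta> \<gamma> n"
  by (auto simp: ordge_def)

lemma ordge_sum: "(\<And>a. a \<in> A \<Longrightarrow> f a \<in> ordge \<alpha> \<beta> \<gamma> n) \<Longrightarrow> sum f A \<in> ordge \<alpha> \<beta> \<gamma> n"
  by (auto simp: ordge_def intro!: sum.neutral)

lemma homog_diff: "F \<in> homog \<alpha> \<beta> \<gamma> n \<Longrightarrow> G \<in> homog \<alpha> \<beta> \<gamma> n \<Longrightarrow> F - G \<in> homog \<alpha> \<beta> \<gamma> n"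
  by (auto simp: homog_def)

lemma ordge_mult:
  assumes "F \<in> ordge \<alpha> \<beta> \<gamma> m" "G \<in> ordge \<alpha> \<beta> \<gamma> n"
  shows "F * G \<in> ordge \<alpha> \<beta> \<gamma> (m + n)"
proof (rule ordgeI)
  fix i j k assume le: "\<alpha> * i + \<beta> * j + \<gamma> * k < m + n"
  have "coeff3 F a b d * coeff3 G (i - a) (j - b) (k - d) = 0" if "a \<le> i" "b \<le> j" "d \<le> k" for a b d
  proof (cases "\<alpha> * a + \<beta> * b + \<gamma> * d < m")
    case True then show ?thesis using assms(1) by (simp add: ordgeD)
  next
    case False
    have "\<alpha> * i = \<alpha> * a + \<alpha> * (i - a)" "\<beta> * j = \<beta> * b + \<beta> * (j - b)" "\<gamma> * k = \<gamma> * d + \<gamma> * (k - d)"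
      using that by (simp_all flip: add_mult_distrib2)
    then have "\<alpha> * (i - a) + \<beta> * (j - b) + \<gamma> * (k - d) < n" using False le by linarith
    then show ?thesis using assms(2) by (simp add: ordgeD)
  qed
  then show "coeff3 (F * G) i j k = 0"
    unfolding coeff3_mult by (intro sum.neutral ballI) auto
qed

lemma homog_mult:
  assumes "F \<in> homog \<alpha> \<beta> \<gamma> m" "G \<in> homog \<alpha> \<beta> \<gamma> n"
  shows "F * G \<in> homog \<alpha> \<beta> \<gamma> (m + n)"
proof -
  have "coeff3 (F * G) i j k = 0" if ne: "\<alpha> * i + \<beta> * j + \<gamma> * k \<noteq> m + n" for i j k
  proof -
    have "coeff3 F a b d * coeff3 G (i - a) (j - b) (k - d) = 0" if "a \<le> i" "b \<le> j" "d \<le> k" for a b d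
    proof (cases "\<alpha> * a + \<beta> * b + \<gamma> * d \<noteq> m")
      case True then show ?thesis using assms(1) by (simp add: homogD)
    next
      case False
      have "\<alpha> * i = \<alpha> * a + \<alpha> * (i - a)" "\<beta> * j = \<beta> * b + \<beta> * (j - b)" "\<gamma> * k = \<gamma> * d + \<gamma> * (k - d)"
        using that by (simp_all flip: add_mult_distrib2)
      then have "\<alpha> * (i - a) + \<beta> * (j - b) + \<gamma> * (k - d) \<noteq> n" using False ne by linarith
      then show ?thesis using assms(2) by (simp add: homogD)
    qed
    then show ?thesis
      unfolding coeff3_mult by (intro sum.neutral ballI) auto
  qed
  then show ?thesis by (auto simp: homog_def)
qed

lemma ordge_mult_left: "G \<in> ordge \<alpha> \<beta> \<gamma> n \<Longrightarrow> F * G \<in> ordge \<alpha> \<beta> \<gamma> n"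
  using ordge_mult[of F \<alpha> \<beta> \<gamma> 0 G n] by simp

lemma ordge_mult_right: "G \<in> ordge \<alpha> \<beta> \<gamma> n \<Longrightarrow> G * F \<in> ordge \<alpha> \<beta> \<gamma> n"
  using ordge_mult[of G \<alpha> \<beta> \<gamma> n F 0] by simp

lemma ordge_power: "F \<in> ordge \<alpha> \<beta> \<gamma> m \<Longrightarrow> F ^ n \<in> ordge \<alpha> \<beta> \<gamma> (n * m)"
  by (induction n) (auto intro: ordge_mult)

lemma one_homog [simp]: "1 \<in> homog \<alpha> \<beta> \<gamma> 0"
  by (auto simp: homog_def coeff3_1)

lemma homog_power: "F \<in> homog \<alpha> \<beta> \<gamma> m \<Longrightarrow> F ^ n \<in> homog \<alpha> \<beta> \<gamma> (n * m)"
  by (induction n) (auto intro: homog_mult)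

lemma X_homog: "X \<in> homog \<alpha> \<beta> \<gamma> \<alpha>" and X1_homog: "X1 \<in> homog \<alpha> \<beta> \<gamma> \<beta>"
  and X2_homog: "X2 \<in> homog \<alpha> \<beta> \<gamma> \<gamma>" and cst_homog: "cst a \<in> homog \<alpha> \<beta> \<gamma> 0"
  by (auto simp: homog_def coeff3_X coeff3_X1 coeff3_X2 coeff3_cst)

abbreviation Fil :: "nat \<Rightarrow> ser set" where "Fil \<equiv> ordge 0 (Suc 0) (Suc 0)"

lemma Fil_eq_0: assumes "\<And>n. F \<in> Fil n" shows "F = 0"
proof (rule coeff3_ext)
  fix i j k show "coeff3 F i j k = coeff3 0 i j k"
    using ordgeD[OF assms[of "j + k + 1"], of i j k] by simp
qed

lemma Fil_eqI: "(\<And>n. F - G \<in> Fil n) \<Longrightarrow> F = G"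
  using Fil_eq_0[of "F - G"] by auto

subsection \<open>Locally finite sums\<close>

text \<open>Cutting at \<open>j + k\<close> makes the definition total. If \<open>f n\<close> lies
  in \<open>Fil n\<close> nothing is lost: later terms have no monomial of degree
  \<open>j + k\<close> in (x1, x2).\<close>

definition qsum :: "(nat \<Rightarrow> ser) \<Rightarrow> ser" where
  "qsum f = mk3 (\<lambda>i j k. \<Sum>n\<le>j + k. coeff3 (f n) i j k)"

lemma coeff3_qsum:
  assumes "\<And>n. f n \<in> Fil n" "j + k < N"
  shows "coeff3 (qsum f) i j k = (\<Sum>n<N. coeff3 (f n) i j k)"
proof -
  have "(\<Sum>n\<le>j + k. coeff3 (f n) i j k) = (\<Sum>n<N. coeff3 (f n) i j k)"
    using assms by (intro sum.mono_neutral_left) (auto intro!: ordgeD[OF assms(1)])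
  then show ?thesis by (simp add: qsum_def)
qed

lemma qsum_approx: "(\<And>n. f n \<in> Fil n) \<Longrightarrow> qsum f - (\<Sum>n<N. f n) \<in> Fil N"
  by (intro ordgeI) (simp add: coeff3_qsum[where N = N])

lemma qsum_unique:
  assumes "\<And>n. f n \<in> Fil n" "\<And>N. G - (\<Sum>n<N. f n) \<in> Fil N"
  shows "qsum f = G"
proof (rule Fil_eqI)
  fix n show "qsum f - G \<in> Fil n"
    using ordge_diff[OF qsum_approx[OF assms(1)] assms(2)] by (simp add: algebra_simps)
qed

text \<open>Preservation of every \<open>Fil n\<close> plays the part of continuity for an additive
  map.\<close>

lemma qsum_map:
  assumes f: "\<And>n. f n \<in> Fil n" and H: "\<And>F G. H (F + G) = H F + H G" "\<And>n F. F \<in> Fil n \<Longrightarrow> H F \<in> Fil n"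
  shows "H (qsum f) = qsum (\<lambda>n. H (f n))"
proof -
  have H0: "H 0 = 0" using H(1)[of 0 0] by simp
  have Hs: "H (sum f A) = (\<Sum>a\<in>A. H (f a))" if "finite A" for A :: "nat set"
    using that by (induction A) (auto simp: H0 H(1))
  have Hd: "H (F - G) = H F - H G" for F G using H(1)[of "F - G" G] by simp
  show ?thesis
  proof (rule qsum_unique[symmetric])
    show "H (f n) \<in> Fil n" for n by (simp add: H(2) f)
    show "H (qsum f) - (\<Sum>n<N. H (f n)) \<in> Fil N" for N
      using H(2)[OF qsum_approx[OF f, where N=N]] by (simp add: Hd Hs)
  qed
qed

lemma qsum_add: 
  assumes f: "\<And>n. f n \<in> Fil n" and g: "\<And>n. g n \<in> Fil n"
  shows "qsum (\<lambda>n. f n + g n) = qsum f + qsum g"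
  by (rule coeff3_ext) (simp add: qsum_def sum.distrib)

lemma qsum_mult_left: "(\<And>n. f n \<in> Fil n) \<Longrightarrow> F * qsum f = qsum (\<lambda>n. F * f n)"
  by (rule qsum_map) (auto simp: distrib_left intro: ordge_mult_left)

lemma qsum_ordge: 
  assumes "\<And>n. f n \<in> ordge \<alpha> \<beta> \<gamma> m" shows "qsum f \<in> ordge \<alpha> \<beta> \<gamma> m"
  by (intro ordgeI) (auto simp: qsum_def intro!: sum.neutral ordgeD[OF assms])

lemma qsum_cong: "(\<And>n. f n = g n) \<Longrightarrow> qsum f = qsum g"
  by (simp add: qsum_def)

text \<open>Modulo \<open>Fil N\<close> only the finite triangle \<open>k + m < N\<close> survives,
  and there rows and antidiagonals give the same sum.\<close>

lemma qsum_rearrange: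
  assumes f: "\<And>k m. f k m \<in> Fil (k + m)"
  shows "qsum (\<lambda>k. qsum (f k)) = qsum (\<lambda>n. \<Sum>k\<le>n. f k (n - k))"
proof (rule qsum_unique)
  have fm: "f k m \<in> Fil k" "f k m \<in> Fil m" for k m using f[of k m] by (auto intro: ordge_mono)
  show "qsum (f k) \<in> Fil k" for k by (rule qsum_ordge) (rule fm)
  have g: "(\<Sum>k\<le>n. f k (n - k)) \<in> Fil n" for n
    by (rule ordge_sum) (use f in \<open>metis atMost_iff le_add_diff_inverse\<close>)
  fix N
  have "(\<Sum>n<N. \<Sum>k\<le>n. f k (n - k)) = (\<Sum>(n,k)\<in>{(n,k). k + n < N}. f n k)"
    using sum.triangle_reindex[of f N] by (simp add: add.commute)
  also have "\<dots> = (\<Sum>(n,k)\<in>Sigma {..<N} (\<lambda>n. {..<N - n}). f n k)"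
    by (rule sum.cong) auto
  finally have e1: "(\<Sum>n<N. \<Sum>k\<le>n. f k (n - k)) = (\<Sum>n<N. \<Sum>k<N - n. f n k)"
    by (simp add: sum.Sigma)
  have "qsum (f k) - (\<Sum>m<N - k. f k m) \<in> Fil N" if "k < N" for k
  proof (rule ordgeI)
    fix i j l assume a: "0 * i + Suc 0 * j + Suc 0 * l < N"
    have "coeff3 (qsum (f k)) i j l = (\<Sum>m<N. coeff3 (f k m) i j l)"
      using a by (intro coeff3_qsum) (auto intro: fm)
    also have "\<dots> = (\<Sum>m<N - k. coeff3 (f k m) i j l)"
      using a that by (intro sum.mono_neutral_right) (auto intro!: ordgeD[OF f])
    finally show "coeff3 (qsum (f k) - (\<Sum>m<N - k. f k m)) i j l = 0" by simp
  qed
  then have "(\<Sum>k<N. qsum (f k) - (\<Sum>m<N - k. f k m)) \<in> Fil N"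
    by (intro ordge_sum) auto
  then have "(\<Sum>k<N. qsum (f k)) - (\<Sum>n<N. \<Sum>k\<le>n. f k (n - k)) \<in> Fil N"
    by (simp add: e1 sum_subtractf)
  from ordge_diff[OF qsum_approx[OF g] this]
  show "qsum (\<lambda>n. \<Sum>k\<le>n. f k (n - k)) - (\<Sum>k<N. qsum (f k)) \<in> Fil N" by simp
qed

lemma qsum_mult:
  assumes f: "\<And>n. f n \<in> Fil n" and g: "\<And>n. g n \<in> Fil n"
  shows "qsum f * qsum g = qsum (\<lambda>n. \<Sum>k\<le>n. f k * g (n - k))"
proof -
  have "qsum f * qsum g = qsum (\<lambda>k. f k * qsum g)"
    using qsum_mult_left[OF f, of "qsum g"] by (simp add: mult.commute)
  also have "\<dots> = qsum (\<lambda>k. qsum (\<lambda>m. f k * g m))" by (intro qsum_cong qsum_mult_left g)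
  also have "\<dots> = qsum (\<lambda>n. \<Sum>k\<le>n. f k * g (n - k))"
    by (rule qsum_rearrange) (intro ordge_mult f g)
  finally show ?thesis .
qed

lemma qsum_Suc:
  assumes f: "\<And>n. f n \<in> Fil n"
  shows "qsum f = f 0 + qsum (\<lambda>n. f (Suc n))"
proof (rule qsum_unique[OF f])
  have g: "f (Suc n) \<in> Fil n" for n using f[of "Suc n"] by (rule ordge_mono) simp
  fix N
  show "f 0 + qsum (\<lambda>n. f (Suc n)) - sum f {..<N} \<in> Fil N"
  proof (cases N)
    case (Suc M)
    have "qsum (\<lambda>n. f (Suc n)) - (\<Sum>n<N. f (Suc n)) \<in> Fil N" by (rule qsum_approx[OF g])
    moreover have "f (Suc M) \<in> Fil N" using f Suc by simp
    moreover have "f 0 + qsum (\<lambda>n. f (Suc n)) - sum f {..<N} = 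
      (qsum (\<lambda>n. f (Suc n)) - (\<Sum>n<N. f (Suc n))) + f (Suc M)"
      unfolding Suc sum.lessThan_Suc_shift[of f M] by simp
    ultimately show ?thesis by (simp only: ordge_add)
  qed simp
qed

lemma qsum_0: assumes "\<And>n. f n = 0" shows "qsum f = 0"
  by (rule coeff3_ext) (simp add: qsum_def assms)


subsection \<open>The vector field and its flow\<close>

lemma coeff3_deriv [simp]: "coeff3 (fps_deriv F) i j k = of_nat (Suc i) * coeff3 F (Suc i) j k"
proof -
  have "fps_nth (fps_nth (of_nat m * (A :: complex fps fps)) j) k = of_nat m * fps_nth (fps_nth A j) k" for m A
    by (simp flip: fps_of_nat)
  then show ?thesis by (simp add: coeff3_def del: of_nat_Suc)
qed

text \<open>The coefficients with \<open>i = 0\<close> vanish because \<open>y / 0 = 0\<close>.\<close>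

definition intX :: "ser \<Rightarrow> ser" where
  "intX F = mk3 (\<lambda>i j k. coeff3 F (i - 1) j k / of_nat i)"

lemma coeff3_intX [simp]: "coeff3 (intX F) i j k = coeff3 F (i - 1) j k / of_nat i"
  by (simp add: intX_def)

lemma deriv_intX: "fps_deriv (intX F) = F"
  by (rule coeff3_ext) (simp del: of_nat_Suc)

lemma intX_add: "intX (F + G) = intX F + intX G"
  by (rule coeff3_ext) (simp add: add_divide_distrib)

lemma intX_sum: "intX (sum f A) = (\<Sum>a\<in>A. intX (f a))"
  by (rule coeff3_ext) (simp add: sum_divide_distrib)

lemma intX_cst_mult: "intX (cst a * F) = cst a * intX F"
  by (rule coeff3_ext) simp

lemma intX_Fil: "F \<in> Fil n \<Longrightarrow> intX F \<in> Fil n"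
  by (auto simp: ordge_def)

lemma deriv_Fil: "F \<in> Fil n \<Longrightarrow> fps_deriv F \<in> Fil n"
  by (auto simp: ordge_def)

definition gg :: ser where "gg = X2 - X * X1"

lemma gg_homog: "gg \<in> homog \<alpha> \<beta> (\<alpha> + \<beta>) (\<alpha> + \<beta>)"
  unfolding gg_def by (intro homog_diff homog_mult X_homog X1_homog X2_homog)

lemma gg_homog_deg: "gg \<in> homog 0 (Suc 0) (Suc 0) (Suc 0)"
  using gg_homog[of 0 "Suc 0"] by simp

lemma gg_Fil: "gg \<in> Fil (Suc 0)"
  by (rule homog_ordge[OF gg_homog_deg])

lemma gg_power_Fil: "gg ^ n \<in> Fil n"
  using ordge_power[OF gg_Fil, of n] by simp

lemma deriv_gg: "fps_deriv gg = - X1"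
  by (simp add: gg_def X_def X1_def X2_def)

text \<open>Pascal's rule, in the form of the induction step of the Leibniz formula;
  \<open>h i j\<close> stands for the product of an \<open>i\<close>-th and a \<open>j\<close>-th
  derivative.\<close>

lemma binomial_sum_step:
  fixes h :: "nat \<Rightarrow> nat \<Rightarrow> 'a::comm_ring_1"
  shows "(\<Sum>k\<le>n. of_nat (n choose k) * (h (Suc k) (n - k) + h k (Suc (n - k)))) =
         (\<Sum>k\<le>Suc n. of_nat (Suc n choose k) * h k (Suc n - k))"
proof -
  have z: "n choose Suc n = 0" by (rule binomial_eq_0) simp
  have "(\<Sum>k\<le>n. of_nat (n choose k) * h k (Suc (n - k))) = (\<Sum>k\<le>Suc n. of_nat (n choose k) * h k (Suc n - k))"
    by (simp add: Suc_diff_le z)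
  also have "\<dots> = h 0 (Suc n) + (\<Sum>k\<le>n. of_nat (n choose Suc k) * h (Suc k) (n - k))"
    by (simp only: sum.atMost_Suc_shift[of _ n]) (simp add: z)
  finally have "(\<Sum>k\<le>n. of_nat (n choose k) * (h (Suc k) (n - k) + h k (Suc (n - k)))) =
      h 0 (Suc n) + (\<Sum>k\<le>n. of_nat (n choose k) * h (Suc k) (n - k) + of_nat (n choose Suc k) * h (Suc k) (n - k))"
    by (simp add: distrib_left sum.distrib)
  also have "\<dots> = h 0 (Suc n) + (\<Sum>k\<le>n. of_nat (Suc n choose Suc k) * h (Suc k) (n - k))"
    by (simp add: distrib_right)
  also have "\<dots> = (\<Sum>k\<le>Suc n. of_nat (Suc n choose k) * h k (Suc n - k))"
    by (simp only: sum.atMost_Suc_shift) simp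
  finally show ?thesis .
qed

text \<open>Valid for any derivation, and applied to both \<open>Y\<close> and \<open>d2\<close>. A
  derivation kills 1, hence all integers, so the binomial coefficients pass through it.\<close>

lemma leibniz_power:
  fixes D :: "'a::comm_ring_1 \<Rightarrow> 'a"
  assumes add: "\<And>F G. D (F + G) = D F + D G" and mult: "\<And>F G. D (F * G) = D F * G + F * D G"
  shows "(D ^^ n) (F * G) = (\<Sum>k\<le>n. of_nat (n choose k) * ((D ^^ k) F * (D ^^ (n - k)) G))"
proof (induction n)
  case (Suc n)
  have D0: "D 0 = 0" using add[of 0 0] by simp
  have "D 1 = 0" using mult[of 1 1] by simp
  then have D_of_nat: "D (of_nat m) = 0" for m by (induction m) (auto simp: D0 add)
  have D_sum: "D (sum f A) = (\<Sum>a\<in>A. D (f a))" for f and A :: "nat set"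
    by (induction A rule: infinite_finite_induct) (auto simp: D0 add)
  have "(D ^^ Suc n) (F * G) = (\<Sum>k\<le>n. of_nat (n choose k) *
      ((D ^^ Suc k) F * (D ^^ (n - k)) G + (D ^^ k) F * (D ^^ Suc (n - k)) G))"
    by (simp add: Suc D_sum D_of_nat mult)
  then show ?case
    by (simp only: binomial_sum_step[of n "\<lambda>i j. (D ^^ i) F * (D ^^ j) G"])
qed simp

lemma binomial_cst:
  assumes "k \<le> n"
  shows "cst (1 / fact k) * cst (1 / fact (n - k)) = cst (1 / fact n) * of_nat (n choose k)"
proof -
  have "1 / fact k * (1 / fact (n - k)) = 1 / fact n * (of_nat (n choose k) :: complex)"
    using assms by (simp add: binomial_fact)
  then show ?thesis by (metis cst_mult cst_of_nat)
qed

section \<open>The derivation \<open>Y\<close>, power series in \<open>Y\<close>, and its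
  flow\<close>

locale flow_setup =
  fixes c :: nat
  assumes c_pos: "1 \<le> c"
begin

definition Y :: "ser \<Rightarrow> ser" where "Y F = gg ^ c * fps_deriv F"

lemma Y_add: "Y (F + G) = Y F + Y G" and Y_diff: "Y (F - G) = Y F - Y G"
  by (simp_all add: Y_def algebra_simps)

lemma Y_0 [simp]: "Y 0 = 0" by (simp add: Y_def)

lemma Y_mult: "Y (F * G) = Y F * G + F * Y G"
  by (simp add: Y_def algebra_simps)

lemma Y_const [simp]: "Y (fps_const a) = 0"
  by (simp add: Y_def)

lemma Y_const_mult: "Y (fps_const a * F) = fps_const a * Y F"
  by (simp add: Y_mult)

lemma Y_cst_mult: "Y (cst a * F) = cst a * Y F"
  by (simp add: cst_def Y_const_mult)

lemma Y_sum: "Y (sum f A) = (\<Sum>a\<in>A. Y (f a))"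
  by (induction A rule: infinite_finite_induct) (auto simp: Y_add)

text \<open>The derivative in \<open>x\<close> leaves the exponents of \<open>x1\<close> and
  \<open>x2\<close> alone, and \<open>gg ^ c\<close> adds \<open>c\<close>. This gain makes power
  series in \<open>Y\<close> summable.\<close>

lemma Y_Fil: "F \<in> Fil n \<Longrightarrow> Y F \<in> Fil (n + c)"
  using ordge_mult[OF gg_power_Fil[of c] deriv_Fil[of F n]] by (simp add: Y_def add.commute)

lemma Yn_add: "(Y ^^ k) (F + G) = (Y ^^ k) F + (Y ^^ k) G"
  by (induction k) (auto simp: Y_add)

lemma Yn_cst_mult: "(Y ^^ k) (cst a * F) = cst a * (Y ^^ k) F"
  by (induction k) (auto simp: Y_cst_mult)

lemma Yn_sum: "(Y ^^ k) (sum f A) = (\<Sum>a\<in>A. (Y ^^ k) (f a))"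
  by (induction k) (auto simp: Y_sum)

lemma Yn_const: "(Y ^^ Suc k) (fps_const a) = 0"
  by (induction k) auto

lemma Yn_Fil_c: "F \<in> Fil n \<Longrightarrow> (Y ^^ k) F \<in> Fil (n + k * c)"
proof (induction k)
  case (Suc k)
  then show ?case using Y_Fil[of "(Y ^^ k) F" "n + k * c"] by (simp add: ac_simps)
qed simp

lemma le_times_c: "k \<le> k * c"
  using c_pos by simp

lemma Yn_Fil_add: "F \<in> Fil n \<Longrightarrow> (Y ^^ k) F \<in> Fil (n + k)"
  using Yn_Fil_c le_times_c by (meson add_left_mono ordge_mono)

lemma Yn_Fil: "(Y ^^ k) F \<in> Fil k"
  using Yn_Fil_add[of F 0 k] by simp

lemma Yn_Fil_same: "F \<in> Fil n \<Longrightarrow> (Y ^^ k) F \<in> Fil n"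
  using Yn_Fil_add by (meson le_add1 ordge_mono)

lemma Yn_mult:
  "(Y ^^ n) (F * G) = (\<Sum>k\<le>n. of_nat (n choose k) * ((Y ^^ k) F * (Y ^^ (n - k)) G))"
  by (rule leibniz_power) (auto simp: Y_add Y_mult)

text \<open>The operator \<open>a(Y)\<close> for an arbitrary formal series \<open>a\<close> in one
  variable.\<close>

definition Op :: "complex fps \<Rightarrow> ser \<Rightarrow> ser" where
  "Op a F = qsum (\<lambda>k. cst (fps_nth a k) * (Y ^^ k) F)"

lemma Op_term_Fil: "cst a * (Y ^^ k) F \<in> Fil k"
  by (intro ordge_mult_left Yn_Fil)

lemma Op_add: "Op a (F + G) = Op a F + Op a G"
  unfolding Op_def by (simp add: Yn_add distrib_left qsum_add Op_term_Fil)

lemma Op_add_left: "Op (a + b) F = Op a F + Op b F"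
  unfolding Op_def by (simp add: cst_add distrib_right qsum_add Op_term_Fil)

lemma Op_Fil: "F \<in> Fil n \<Longrightarrow> Op a F \<in> Fil n"
  unfolding Op_def by (intro qsum_ordge ordge_mult_left Yn_Fil_same)

lemma Yn_qsum:
  assumes "\<And>n. f n \<in> Fil n" shows "(Y ^^ k) (qsum f) = qsum (\<lambda>n. (Y ^^ k) (f n))"
  by (rule qsum_map[OF assms Yn_add Yn_Fil_same])

text \<open>Thus \<open>a\<close> acts through the ring of formal series, and one-variable
  identities such as \<open>bernoulli_fps_eq\<close> transfer to \<open>Y\<close>.\<close>

lemma Op_Op: "Op a (Op b F) = Op (a * b) F"
proof -
  have "Op a (Op b F) = qsum (\<lambda>k. qsum (\<lambda>m. cst (fps_nth a k) * (cst (fps_nth b m) * (Y ^^ (k + m)) F)))"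
    unfolding Op_def
    by (subst Yn_qsum, rule Op_term_Fil, subst qsum_mult_left)
       (auto simp: Yn_cst_mult funpow_add intro: ordge_mult_left Yn_Fil_same Yn_Fil)
  also have "\<dots> = qsum (\<lambda>n. \<Sum>k\<le>n. cst (fps_nth a k) * (cst (fps_nth b (n - k)) * (Y ^^ (k + (n - k))) F))"
    by (rule qsum_rearrange) (intro ordge_mult_left Yn_Fil)
  also have "\<dots> = qsum (\<lambda>n. cst (fps_nth (a * b) n) * (Y ^^ n) F)"
    by (rule qsum_cong) 
       (simp add: fps_mult_nth cst_sum cst_mult sum_distrib_right atLeast0AtMost mult.assoc)
  finally show ?thesis by (simp add: Op_def)
qed

lemma Op_1 [simp]: "Op 1 F = F"
  unfolding Op_def 
  by (subst qsum_Suc, rule Op_term_Fil) (simp add: qsum_0)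

lemma Op_X: "Op fps_X F = Y F"
  unfolding Op_def 
  by (subst qsum_Suc, rule Op_term_Fil, subst qsum_Suc)
     (auto simp: qsum_0 intro!: ordge_mult_left Yn_Fil_same Y_Fil ordge_mono[OF Yn_Fil[of "Suc _"], simplified])

lemma Op_minus_1: "Op (a - 1) F = Op a F - F"
  using Op_add_left[of "a - 1" 1 F] by simp

text \<open>The powers of \<open>r\<close> stay outside \<open>Y ^^ k\<close>: this is composition
  with the map that moves each point along \<open>Y\<close> for the value of \<open>r\<close> at
  that point, and not the exponential of the vector field \<open>r * Y\<close>.\<close>

definition Phi :: "ser \<Rightarrow> ser \<Rightarrow> ser" where
  "Phi r F = qsum (\<lambda>k. cst (1 / fact k) * r ^ k * (Y ^^ k) F)"

lemma Phi_term_Fil: "a * (Y ^^ k) F \<in> Fil k"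
  by (intro ordge_mult_left Yn_Fil)

lemma Phi_1: "Phi 1 F = Op (fps_exp 1) F"
  by (simp add: Phi_def Op_def)

lemma Phi_add: "Phi r (F + G) = Phi r F + Phi r G"
  unfolding Phi_def by (simp add: Yn_add distrib_left qsum_add Phi_term_Fil)

lemma Phi_0 [simp]: "Phi r 0 = 0"
  using Phi_add[of r 0 0] by simp

lemma Phi_diff: "Phi r (F - G) = Phi r F - Phi r G"
  using Phi_add[of r "F - G" G] by simp

lemma Phi_Fil: "F \<in> Fil n \<Longrightarrow> Phi r F \<in> Fil n"
  unfolding Phi_def by (intro qsum_ordge ordge_mult_left Yn_Fil_same)

lemma Phi_const [simp]: "Phi r (fps_const a) = fps_const a"
  unfolding Phi_def
  by (subst qsum_Suc, rule Phi_term_Fil) (use Yn_const in \<open>simp add: qsum_0\<close>)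

lemma Phi_cst [simp]: "Phi r (cst a) = cst a"
  by (simp add: cst_def)

lemma Phi_X1 [simp]: "Phi r X1 = X1" and Phi_X2 [simp]: "Phi r X2 = X2"
  by (simp_all add: X1_def X2_def)

text \<open>The Leibniz formula matches the Cauchy product term by term, since \<open>r ^ n\<close>
  splits freely.\<close>

lemma Phi_mult: "Phi r (F * G) = Phi r F * Phi r G"
proof -
  have "Phi r F * Phi r G = qsum (\<lambda>n. \<Sum>k\<le>n. (cst (1 / fact k) * r ^ k * (Y ^^ k) F) *
      (cst (1 / fact (n - k)) * r ^ (n - k) * (Y ^^ (n - k)) G))"
    unfolding Phi_def by (rule qsum_mult) (rule Phi_term_Fil)+
  also have "\<dots> = qsum (\<lambda>n. cst (1 / fact n) * r ^ n * (Y ^^ n) (F * G))"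
  proof (rule qsum_cong)
    fix n
    have eq: "(cst (1 / fact k) * r ^ k * (Y ^^ k) F) * (cst (1 / fact (n - k)) * r ^ (n - k) * (Y ^^ (n - k)) G) =
       cst (1 / fact n) * r ^ n * (of_nat (n choose k) * ((Y ^^ k) F * (Y ^^ (n - k)) G))" if "k \<le> n" for k
    proof -
      have "r ^ n = r ^ k * r ^ (n - k)" using that by (simp flip: power_add)
      then have "(cst (1 / fact k) * r ^ k * (Y ^^ k) F) * (cst (1 / fact (n - k)) * r ^ (n - k) * (Y ^^ (n - k)) G) =
        (cst (1 / fact k) * cst (1 / fact (n - k))) * (r ^ n * ((Y ^^ k) F * (Y ^^ (n - k)) G))"
        by (simp add: ac_simps)
      then show ?thesis unfolding binomial_cst[OF that] by (simp add: ac_simps)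
    qed
    show "(\<Sum>k\<le>n. (cst (1 / fact k) * r ^ k * (Y ^^ k) F) *
      (cst (1 / fact (n - k)) * r ^ (n - k) * (Y ^^ (n - k)) G)) = cst (1 / fact n) * r ^ n * (Y ^^ n) (F * G)"
      by (subst sum.cong[OF refl eq]) (auto simp: Yn_mult sum_distrib_left)
  qed
  finally show ?thesis by (simp add: Phi_def)
qed

lemma Phi_one [simp]: "Phi r 1 = 1"
  using Phi_cst[of r 1] by simp

lemma Phi_power: "Phi r (F ^ n) = Phi r F ^ n"
  by (induction n) (auto simp: Phi_mult)

text \<open>The terms of the exponential series from \<open>k = 2\<close> on contain at least two
  applications of \<open>Y\<close>, each worth \<open>c\<close> degrees.\<close>

lemma Phi_approx2:
  assumes "F \<in> Fil n"
  shows "Phi r F - F - r * Y F \<in> Fil (n + 2 * c)"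
proof -
  have *: "qsum (\<lambda>k. cst (1 / fact (Suc (Suc k))) * r ^ Suc (Suc k) * (Y ^^ Suc (Suc k)) F) \<in> Fil (n + 2 * c)"
    by (intro qsum_ordge ordge_mult_left ordge_mono[OF Yn_Fil_c[OF assms]]) simp
  have "Phi r F = F + (r * Y F + qsum (\<lambda>k. cst (1 / fact (Suc (Suc k))) * r ^ Suc (Suc k) * (Y ^^ Suc (Suc k)) F))"
    unfolding Phi_def
    apply (subst qsum_Suc, rule Phi_term_Fil)
    apply (subst qsum_Suc)
     apply (rule ordge_mono[OF Phi_term_Fil]; simp)
    by simp
  then show ?thesis using * by simp
qed

lemma Phi_approx1:
  assumes "F \<in> Fil n"
  shows "Phi r F - F \<in> Fil (n + c)"
  using ordge_add[OF ordge_mono[OF Phi_approx2[OF assms, of r], of "n + c"] ordge_mult_left[OF Y_Fil[OF assms], of r]]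
  by simp

text \<open>Times along one orbit add up, and \<open>Phi r s\<close> is the time \<open>s\<close>
  read at the point already moved by \<open>r\<close>. Multiplicativity brings \<open>Phi r\<close>
  inside the series; the binomial theorem then collects the powers of
  \<open>r + Phi r s\<close>.\<close>

theorem Phi_Phi: "Phi r (Phi s F) = Phi (r + Phi r s) F"
proof -
  define a where "a = Phi r s"
  have "Phi r (Phi s F) = qsum (\<lambda>k. Phi r (cst (1 / fact k) * s ^ k * (Y ^^ k) F))"
    unfolding Phi_def[of s] by (intro qsum_map Phi_term_Fil Phi_add Phi_Fil)
  also have "\<dots> = qsum (\<lambda>k. cst (1 / fact k) * a ^ k * Phi r ((Y ^^ k) F))"
    by (simp add: Phi_mult Phi_power a_def)
  also have "\<dots> = qsum (\<lambda>k. qsum (\<lambda>m. cst (1 / fact k) * a ^ k * (cst (1 / fact m) * r ^ m * (Y ^^ (m + k)) F)))"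
  proof (rule qsum_cong)
    fix k
    show "cst (1 / fact k) * a ^ k * Phi r ((Y ^^ k) F) = 
      qsum (\<lambda>m. cst (1 / fact k) * a ^ k * (cst (1 / fact m) * r ^ m * (Y ^^ (m + k)) F))"
      unfolding Phi_def by (subst qsum_mult_left, rule Phi_term_Fil) (simp add: funpow_add)
  qed
  also have "\<dots> = qsum (\<lambda>n. \<Sum>k\<le>n. cst (1 / fact k) * a ^ k * (cst (1 / fact (n - k)) * r ^ (n - k) * (Y ^^ ((n - k) + k)) F))"
    by (rule qsum_rearrange) (subst (2) add.commute, intro ordge_mult_left Yn_Fil)
  also have "\<dots> = qsum (\<lambda>n. cst (1 / fact n) * (r + a) ^ n * (Y ^^ n) F)"
  proof (rule qsum_cong)
    fix n
    have eq: "cst (1 / fact k) * a ^ k * (cst (1 / fact (n - k)) * r ^ (n - k) * (Y ^^ ((n - k) + k)) F) =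
       cst (1 / fact n) * (of_nat (n choose k) * a ^ k * r ^ (n - k)) * (Y ^^ n) F" if "k \<le> n" for k
    proof -
      have "cst (1 / fact k) * a ^ k * (cst (1 / fact (n - k)) * r ^ (n - k) * (Y ^^ n) F) =
         (cst (1 / fact k) * cst (1 / fact (n - k))) * (a ^ k * r ^ (n - k) * (Y ^^ n) F)"
        by (simp add: ac_simps)
      then show ?thesis unfolding binomial_cst[OF that] using that by (simp add: ac_simps)
    qed
    show "(\<Sum>k\<le>n. cst (1 / fact k) * a ^ k * (cst (1 / fact (n - k)) * r ^ (n - k) * (Y ^^ ((n - k) + k)) F)) =
       cst (1 / fact n) * (r + a) ^ n * (Y ^^ n) F"
      by (subst add.commute[of r], subst sum.cong[OF refl eq])
         (auto simp: binomial_ring sum_distrib_left sum_distrib_right)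
  qed
  finally show ?thesis by (simp add: Phi_def a_def)
qed

text \<open>The series \<open>z / (exp z - 1)\<close>; \<open>fps_shift 1\<close> performs the
  division by \<open>z\<close>.\<close>

definition bernoulli_fps :: "complex fps" where
  "bernoulli_fps = inverse (fps_shift 1 (fps_exp 1 - 1))"

lemma bernoulli_fps_eq: "fps_X * fps_shift 1 (fps_exp 1 - 1) = (fps_exp 1 - 1 :: complex fps)"
  "fps_shift 1 (fps_exp 1 - 1) * bernoulli_fps = 1"
proof -
  show "fps_X * fps_shift 1 (fps_exp 1 - 1) = (fps_exp 1 - 1 :: complex fps)"
    by (rule fps_ext) (simp add: fps_X_mult_nth)
  show "fps_shift 1 (fps_exp 1 - 1) * bernoulli_fps = 1"
    unfolding bernoulli_fps_def by (rule inverse_mult_eq_1') simp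
qed

text \<open>\<open>Y\<close> is inverted on multiples of \<open>gg ^ c\<close> by \<open>intX\<close>, and \<open>1 / (exp Y - 1)\<close> is \<open>1 / Y\<close> times the Bernoulli
  series in \<open>Y\<close>.\<close>

definition inv_diff :: "ser \<Rightarrow> ser" where
  "inv_diff F = intX F + Op (fps_shift 1 bernoulli_fps) (gg ^ c * F)"

lemma inv_diff_add: "inv_diff (F + G) = inv_diff F + inv_diff G"
  by (simp add: inv_diff_def intX_add distrib_left Op_add)

lemma inv_diff_Fil: "F \<in> Fil n \<Longrightarrow> inv_diff F \<in> Fil n"
  unfolding inv_diff_def by (intro ordge_add intX_Fil Op_Fil ordge_mult_left)

lemma Y_inv_diff: "Y (inv_diff F) = Op bernoulli_fps (gg ^ c * F)"
proof -
  \<comment> \<open>The constant term 1 is the part that \<open>intX\<close> inverts; the rest is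
    divisible by the variable, so one factor \<open>Y\<close> can be taken out.\<close>
  have "fps_nth bernoulli_fps 0 = 1" unfolding bernoulli_fps_def by simp
  then have "bernoulli_fps = 1 + fps_X * fps_shift 1 bernoulli_fps"
    by (intro fps_ext) (auto simp: fps_eq_iff)
  then have "Op bernoulli_fps (gg ^ c * F) = gg ^ c * F + Op fps_X (Op (fps_shift 1 bernoulli_fps) (gg ^ c * F))"
    by (metis Op_1 Op_add_left Op_Op)
  then show ?thesis by (simp add: Op_X inv_diff_def Y_add Y_def deriv_intX distrib_left)
qed

text \<open>\<open>exp Y - 1\<close> is \<open>Y\<close> followed by the series
  \<open>(exp z - 1) / z\<close> in \<open>Y\<close>, and the latter cancels the Bernoulli
  series.\<close>

lemma inv_diff_solves: "Phi 1 (inv_diff F) - inv_diff F = gg ^ c * F"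
proof -
  have "Phi 1 (inv_diff F) - inv_diff F = Op (fps_exp 1 - 1) (inv_diff F)"
    by (simp add: Phi_1 Op_minus_1)
  also have "\<dots> = Op (fps_shift 1 (fps_exp 1 - 1)) (Op fps_X (inv_diff F))"
    by (simp only: Op_Op mult.commute[of _ fps_X] bernoulli_fps_eq)
  also have "\<dots> = gg ^ c * F"
    by (simp only: Op_X Y_inv_diff Op_Op bernoulli_fps_eq Op_1)
  finally show ?thesis .
qed

end


subsection \<open>Substitution\<close>

lemma finite_simplex: "finite {(i, j, k). i + j + k \<le> (N::nat)}"
  by (rule finite_subset[of _ "{..N} \<times> {..N} \<times> {..N}"]) auto

abbreviation subst_x :: "ser \<Rightarrow> ser \<Rightarrow> ser" where "subst_x P F \<equiv> subst3 F (P, X1, X2)"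

abbreviation TotFil :: "nat \<Rightarrow> ser set" where "TotFil \<equiv> ordge (Suc 0) (Suc 0) (Suc 0)"

lemma coeff3_subst_x:
  "coeff3 (subst_x P F) l m n =
     (\<Sum>(i, j, k) | i + j + k \<le> l + m + n. coeff3 F i j k * coeff3 (P ^ i * X1 ^ j * X2 ^ k) l m n)"
  by (simp add: subst3_def coeff3_def)

lemma subst_x_add: "subst_x P (F + G) = subst_x P F + subst_x P G"
  by (rule coeff3_ext) (simp add: coeff3_subst_x distrib_right sum.distrib case_prod_beta)

lemma subst_x_cst_mult: "subst_x P (cst a * F) = cst a * subst_x P F"
  by (rule coeff3_ext) (simp add: coeff3_subst_x sum_distrib_left case_prod_beta mult.assoc)

lemma subst_x_diff: "subst_x P (F - G) = subst_x P F - subst_x P G"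
  using subst_x_add[where F = "F - G" and G = G] by simp

lemma subst_x_sum: "subst_x P (sum f A) = (\<Sum>a\<in>A. subst_x P (f a))"
proof (induction A rule: infinite_finite_induct)
  case empty then show ?case using subst_x_add[where F = 0 and G = 0] by simp
next
  case infinite then show ?case using subst_x_add[where F = 0 and G = 0] by simp
qed (simp add: subst_x_add)

lemma TotFil_1: "P \<in> TotFil (Suc 0) \<longleftrightarrow> coeff3 P 0 0 0 = 0"
  by (auto simp: ordge_def)

lemma monom_TotFil:
  assumes "P \<in> TotFil (Suc 0)" shows "P ^ i * X1 ^ j * X2 ^ k \<in> TotFil (i + j + k)"
  using ordge_mult[OF ordge_mult[OF ordge_power[OF assms, of i] 
      ordge_power[OF homog_ordge[OF X1_homog]]] ordge_power[OF homog_ordge[OF X2_homog]]]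
  by simp

lemma monom_Fil: "P ^ i * X1 ^ j * X2 ^ k \<in> Fil (j + k)"
proof -
  have "X1 ^ j \<in> Fil j" "X2 ^ k \<in> Fil k"
    using ordge_power[OF homog_ordge[OF X1_homog], of j 0 "Suc 0" "Suc 0"]
      ordge_power[OF homog_ordge[OF X2_homog], of k 0 "Suc 0" "Suc 0"] by simp_all
  then show ?thesis by (intro ordge_mult ordge_mult_left)
qed

lemma subst_x_monom:
  assumes "P \<in> TotFil (Suc 0)"
  shows "subst_x P (X ^ a * X1 ^ b * X2 ^ d) = P ^ a * X1 ^ b * X2 ^ d"
proof (rule coeff3_ext)
  fix l m n :: nat
  have "coeff3 (subst_x P (X ^ a * X1 ^ b * X2 ^ d)) l m n =
     (\<Sum>p | (case p of (i, j, k) \<Rightarrow> i + j + k \<le> l + m + n). if p = (a, b, d) then coeff3 (P ^ a * X1 ^ b * X2 ^ d) l m n else 0)"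
    unfolding coeff3_subst_x by (intro sum.cong) (auto simp: coeff3_monom split: if_splits)
  also have "\<dots> = (if a + b + d \<le> l + m + n then coeff3 (P ^ a * X1 ^ b * X2 ^ d) l m n else 0)"
    using finite_simplex by (simp add: sum.delta')
  also have "\<dots> = coeff3 (P ^ a * X1 ^ b * X2 ^ d) l m n"
    using ordgeD[OF monom_TotFil[OF assms, of a b d], of l m n] by auto
  finally show "coeff3 (subst_x P (X ^ a * X1 ^ b * X2 ^ d)) l m n = coeff3 (P ^ a * X1 ^ b * X2 ^ d) l m n" .
qed

lemma subst_x_X: "P \<in> TotFil (Suc 0) \<Longrightarrow> subst_x P X = P"
  and subst_x_X1: "P \<in> TotFil (Suc 0) \<Longrightarrow> subst_x P X1 = X1"
  and subst_x_X2: "P \<in> TotFil (Suc 0) \<Longrightarrow> subst_x P X2 = X2"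
  using subst_x_monom[of P 1 0 0] subst_x_monom[of P 0 1 0] subst_x_monom[of P 0 0 1] by simp_all

lemma subst_x_gg_power:
  assumes "P \<in> TotFil (Suc 0)"
  shows "subst_x P (gg ^ c) = (X2 - P * X1) ^ c"
proof -
  \<comment> \<open>Stated for every \<open>Q\<close>: the case \<open>Q = X\<close> expands
    \<open>gg ^ c\<close> into monomials, the case \<open>Q = P\<close> reassembles their
    images.\<close>
  have e: "(X2 - Q * X1) ^ c = (\<Sum>k\<le>c. cst (of_nat (c choose k) * (-1) ^ k) * (Q ^ k * X1 ^ k * X2 ^ (c - k)))" for Q
  proof -
    have "(X2 - Q * X1) ^ c = (- (Q * X1) + X2) ^ c" by simp
    also have "\<dots> = (\<Sum>k\<le>c. of_nat (c choose k) * (- (Q * X1)) ^ k * X2 ^ (c - k))"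
      by (rule binomial_ring)
    also have "\<dots> = (\<Sum>k\<le>c. cst (of_nat (c choose k) * (-1) ^ k) * (Q ^ k * X1 ^ k * X2 ^ (c - k)))"
    proof (rule sum.cong[OF refl])
      fix k
      have "(- (Q * X1)) ^ k = cst ((-1) ^ k) * (Q ^ k * X1 ^ k)"
        by (subst power_minus) (simp add: cst_power cst_minus power_mult_distrib)
      then show "of_nat (c choose k) * (- (Q * X1)) ^ k * X2 ^ (c - k) =
        cst (of_nat (c choose k) * (-1) ^ k) * (Q ^ k * X1 ^ k * X2 ^ (c - k))"
        by (simp add: cst_mult cst_of_nat mult.assoc)
    qed
    finally show ?thesis .
  qed
  show ?thesis unfolding gg_def e
    by (simp add: subst_x_sum subst_x_cst_mult subst_x_monom[OF assms])
qed

lemma subst_x_Fil: assumes "F \<in> Fil n" shows "subst_x P F \<in> Fil n"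
proof (rule ordgeI)
  fix l m p assume lt: "0 * l + Suc 0 * m + Suc 0 * p < n"
  have "coeff3 F i j k * coeff3 (P ^ i * X1 ^ j * X2 ^ k) l m p = 0" for i j k
  proof (cases "j + k < n")
    case True then show ?thesis using ordgeD[OF assms, of i j k] by simp
  next
    case False then show ?thesis using lt ordgeD[OF monom_Fil[of P i j k], of l m p] by simp
  qed
  then show "coeff3 (subst_x P F) l m p = 0"
    unfolding coeff3_subst_x by (intro sum.neutral) auto
qed

lemma power_diff_Fil: "S - S' \<in> Fil n \<Longrightarrow> S ^ i - S' ^ i \<in> Fil n"
proof (induction i)
  case (Suc i)
  have "S ^ Suc i - S' ^ Suc i = S * (S ^ i - S' ^ i) + (S - S') * S' ^ i" by (simp add: algebra_simps)
  then show ?case using Suc by (simp add: ordge_add ordge_mult_left ordge_mult_right)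
qed simp

text \<open>The two gains add: a monomial of \<open>F\<close> carries at least \<open>m\<close>
  factors \<open>X1\<close> or \<open>X2\<close>, which both substitutions keep, and the difference
  of the powers of \<open>S\<close> and \<open>S'\<close> lies in \<open>Fil n\<close>.\<close>

lemma subst_x_diff_Fil:
  assumes F: "F \<in> Fil m" and S: "S - S' \<in> Fil n" shows "subst_x S F - subst_x S' F \<in> Fil (m + n)"
proof (rule ordgeI)
  fix l p q assume lt: "0 * l + Suc 0 * p + Suc 0 * q < m + n"
  have *: "coeff3 F i j k * coeff3 (S ^ i * X1 ^ j * X2 ^ k) l p q = 
        coeff3 F i j k * coeff3 (S' ^ i * X1 ^ j * X2 ^ k) l p q" for i j k
  proof (cases "j + k < m")
    case True then show ?thesis using ordgeD[OF F, of i j k] by simp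
  next
    case False
    \<comment> \<open>The factor \<open>1 ^ i\<close> only puts the product into the shape of
      \<open>monom_Fil\<close>.\<close>
    have "(S ^ i - S' ^ i) * (1 ^ i * X1 ^ j * X2 ^ k) \<in> Fil (n + (j + k))"
      by (intro ordge_mult power_diff_Fil S monom_Fil)
    then have "coeff3 ((S ^ i - S' ^ i) * (1 ^ i * X1 ^ j * X2 ^ k)) l p q = 0"
      using False lt by (intro ordgeD) auto
    moreover have "(S ^ i - S' ^ i) * (1 ^ i * X1 ^ j * X2 ^ k) = S ^ i * X1 ^ j * X2 ^ k - S' ^ i * X1 ^ j * X2 ^ k"
      by (simp add: algebra_simps)
    ultimately show ?thesis by simp
  qed
  show "coeff3 (subst_x S F - subst_x S' F) l p q = 0"
    unfolding coeff3_diff coeff3_subst_x by (simp only: * diff_self)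
qed

text \<open>On polynomials a ring homomorphism is determined by its values on constants and
  variables. Replacing \<open>F\<close> by a truncation changes it only in high total order, and
  \<open>H\<close> respects that order.\<close>

lemma hom_eq_subst_x:
  assumes add: "\<And>F G. H (F + G) = H F + H G" and mult: "\<And>F G. H (F * G) = H F * H G"
    and cst: "\<And>a. H (cst a) = cst a" and x: "H X1 = X1" "H X2 = X2"
    and TotFil: "\<And>n F. F \<in> TotFil n \<Longrightarrow> H F \<in> TotFil n"
  shows "H F = subst_x (H X) F"
proof (rule coeff3_ext)
  fix l m n :: nat
  define S where "S = {(i, j, k). i + j + k \<le> l + m + n}"
  have finS: "finite S" unfolding S_def by (rule finite_simplex)
  define T where "T = (\<Sum>(i, j, k)\<in>S. cst (coeff3 F i j k) * (X ^ i * X1 ^ j * X2 ^ k))"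
  have H0: "H 0 = 0" using cst[of 0] by simp
  have Hsum: "H (sum f A) = (\<Sum>a\<in>A. H (f a))" if "finite A" for f and A :: "(nat \<times> nat \<times> nat) set"
    using that by (induction A) (auto simp: H0 add)
  have Hpow: "H (G ^ k) = H G ^ k" for G k
    using cst[of 1] by (induction k) (auto simp: mult)
  have HT: "H T = (\<Sum>(i, j, k)\<in>S. cst (coeff3 F i j k) * (H X ^ i * X1 ^ j * X2 ^ k))"
    unfolding T_def by (subst Hsum[OF finS]) (simp add: case_prod_beta mult cst Hpow x)
  have "F - T \<in> TotFil (Suc (l + m + n))"
  proof (rule ordgeI)
    fix i j k assume "Suc 0 * i + Suc 0 * j + Suc 0 * k < Suc (l + m + n)"
    then have mem: "(i, j, k) \<in> S" by (simp add: S_def)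
    have "coeff3 T i j k = (\<Sum>p\<in>S. if p = (i, j, k) then coeff3 F i j k else 0)"
      unfolding T_def coeff3_sum by (intro sum.cong) (auto simp: coeff3_monom split: if_splits)
    also have "\<dots> = coeff3 F i j k" using mem finS by simp
    finally show "coeff3 (F - T) i j k = 0" by simp
  qed
  from TotFil[OF this] have "coeff3 (H (F - T)) l m n = 0" by (rule ordgeD) simp
  moreover have "H (F - T) = H F - H T" using add[of "F - T" T] by simp
  ultimately have "coeff3 (H F) l m n = coeff3 (H T) l m n" by simp
  also have "\<dots> = coeff3 (subst_x (H X) F) l m n"
    unfolding HT coeff3_subst_x coeff3_sum by (intro sum.cong) (auto simp: S_def)
  finally show "coeff3 (H F) l m n = coeff3 (subst_x (H X) F) l m n" .
qed

context flow_setup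
begin

lemma gg_TotFil: "gg \<in> TotFil (Suc 0)"
  by (simp add: TotFil_1 gg_def coeff3_X2 coeff3_X_mult)

text \<open>The derivative loses one degree and \<open>gg ^ c\<close> regains at least one, as
  \<open>c\<close> is positive.\<close>

lemma Y_TotFil: assumes "F \<in> TotFil n" shows "Y F \<in> TotFil n"
proof -
  have "fps_deriv F \<in> TotFil (n - 1)"
    using assms by (auto simp: ordge_def)
  from ordge_mult[OF ordge_power[OF gg_TotFil, of c] this] have "Y F \<in> TotFil (c + (n - 1))"
    by (simp add: Y_def)
  then show ?thesis by (rule ordge_mono) (use c_pos in simp)
qed

lemma Yn_TotFil: "F \<in> TotFil n \<Longrightarrow> (Y ^^ k) F \<in> TotFil n"
  by (induction k) (auto intro: Y_TotFil)

lemma Phi_TotFil: "F \<in> TotFil n \<Longrightarrow> Phi r F \<in> TotFil n"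
  unfolding Phi_def by (intro qsum_ordge ordge_mult_left Yn_TotFil)

lemma X_TotFil: "X \<in> TotFil (Suc 0)"
  by (rule homog_ordge[OF X_homog])

lemma Phi_eq_subst_x: "Phi r F = subst_x (Phi r X) F"
  by (rule hom_eq_subst_x) (auto simp: Phi_add Phi_mult intro: Phi_TotFil)

text \<open>By the composition law both sides are flows of \<open>Y\<close>, with times
  \<open>r + Phi r s\<close> and \<open>s + 1\<close>, which the hypothesis makes equal.\<close>

lemma conjugacy_of_time:
  assumes "Phi r s - s = 1 - r"
  shows "fcomp (Phi s X, X1, X2) (Phi r X, X1, X2) = fcomp (Phi 1 X, X1, X2) (Phi s X, X1, X2)"
proof -
  have "subst_x (Phi r X) (Phi s X) = Phi (r + Phi r s) X"
    by (simp flip: Phi_eq_subst_x add: Phi_Phi)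
  also have "r + Phi r s = s + 1" using assms by (simp add: algebra_simps)
  also have "Phi (s + 1) X = subst_x (Phi s X) (Phi 1 X)"
    by (simp flip: Phi_eq_subst_x add: Phi_Phi)
  finally show ?thesis by (simp add: fcomp_def subst_x_X1 subst_x_X2 Phi_TotFil X_TotFil)
qed

end

subsection \<open>The formal conjugacy\<close>

locale pair_setup = flow_setup +
  fixes w :: ser
begin

definition theta :: ser where "theta = gg ^ c * w"

text \<open>The coefficient of \<open>t ^ n\<close> in the solution \<open>s\<close> of \<open>s \<circ> \<phi>1 - s = - t * theta\<close>.\<close>

function time_coeff :: "nat \<Rightarrow> ser" where
  "time_coeff 0 = 0"
| "time_coeff (Suc n) = inv_diff (- ((if n = 0 then w else 0) +
     (\<Sum>k\<in>{1..n}. cst (1 / fact k) * w * theta ^ (k - 1) * (Y ^^ k) (Phi 1 (time_coeff (Suc n - k))))))"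
  by pat_completeness auto
termination
  by (relation "Wellfounded.measure id") auto

declare time_coeff.simps [simp del]

text \<open>In the recursion, going back by \<open>k\<close> orders in \<open>t\<close> is paid for
  by \<open>Y ^^ k\<close>, which raises the degree by at least \<open>k\<close>. This makes
  \<open>conj_time\<close> a locally finite sum.\<close>

lemma time_coeff_Fil: "time_coeff (Suc n) \<in> Fil n"
proof (induction n rule: less_induct)
  case (less n)
  have "theta ^ (k - 1) * (Y ^^ k) (Phi 1 (time_coeff (Suc n - k))) \<in> Fil n" if "k \<in> {1..n}" for k
  proof -
    have "time_coeff (Suc (n - k)) \<in> Fil (n - k)" using that by (intro less) auto
    then have "(Y ^^ k) (Phi 1 (time_coeff (Suc n - k))) \<in> Fil ((n - k) + k)"
      using that by (intro Yn_Fil_add Phi_Fil) (simp add: Suc_diff_le)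
    then show ?thesis using that by (intro ordge_mult_left) simp
  qed
  then have "(\<Sum>k\<in>{1..n}. cst (1 / fact k) * w * theta ^ (k - 1) * (Y ^^ k) (Phi 1 (time_coeff (Suc n - k)))) \<in> Fil n"
    by (intro ordge_sum) (simp add: mult.assoc ordge_mult_left)
  then show ?case
    by (subst time_coeff.simps) (intro inv_diff_Fil ordge_minus ordge_add; simp)
qed

text \<open>This is the coefficient of \<open>t ^ (N + 1)\<close> in the equation for
  \<open>s\<close>. Every \<open>theta ^ k\<close> with \<open>k\<close> positive contains
  \<open>gg ^ c\<close>, so the terms of lower order form a multiple of \<open>gg ^ c\<close> and
  \<open>inv_diff\<close> solves for the new coefficient.\<close>

lemma time_coeff_eq:
  "(\<Sum>n\<le>N. cst (1 / fact (N - n)) * theta ^ (N - n) * (Y ^^ (N - n)) (Phi 1 (time_coeff (Suc n)))) - time_coeff (Suc N) =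
     - (if N = 0 then theta else 0)"
proof -
  have "(\<Sum>n\<le>N. cst (1 / fact (N - n)) * theta ^ (N - n) * (Y ^^ (N - n)) (Phi 1 (time_coeff (Suc n)))) =
        (\<Sum>k\<le>N. cst (1 / fact k) * theta ^ k * (Y ^^ k) (Phi 1 (time_coeff (Suc (N - k)))))"
    by (rule sum.reindex_bij_witness[where i = "\<lambda>k. N - k" and j = "\<lambda>k. N - k"]) auto
  also have "\<dots> = (\<Sum>k\<in>insert 0 {1..N}. cst (1 / fact k) * theta ^ k * (Y ^^ k) (Phi 1 (time_coeff (Suc (N - k)))))"
    by (rule sum.cong) auto
  also have "\<dots> =
     Phi 1 (time_coeff (Suc N)) + (\<Sum>k\<in>{1..N}. cst (1 / fact k) * theta ^ k * (Y ^^ k) (Phi 1 (time_coeff (Suc (N - k)))))"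
    by simp
  also have "(\<Sum>k\<in>{1..N}. cst (1 / fact k) * theta ^ k * (Y ^^ k) (Phi 1 (time_coeff (Suc (N - k))))) =
     gg ^ c * (\<Sum>k\<in>{1..N}. cst (1 / fact k) * w * theta ^ (k - 1) * (Y ^^ k) (Phi 1 (time_coeff (Suc N - k))))"
  proof (unfold sum_distrib_left, rule sum.cong[OF refl])
    fix k assume "k \<in> {1..N}"
    then obtain m where "k = Suc m" "m < N" by (cases k) auto
    then show "cst (1 / fact k) * theta ^ k * (Y ^^ k) (Phi 1 (time_coeff (Suc (N - k)))) =
       gg ^ c * (cst (1 / fact k) * w * theta ^ (k - 1) * (Y ^^ k) (Phi 1 (time_coeff (Suc N - k))))"
      by (simp add: Suc_diff_Suc Suc_diff_le theta_def ac_simps)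
  qed
  finally have e: "(\<Sum>n\<le>N. cst (1 / fact (N - n)) * theta ^ (N - n) * (Y ^^ (N - n)) (Phi 1 (time_coeff (Suc n)))) =
     Phi 1 (time_coeff (Suc N)) + gg ^ c * (\<Sum>k\<in>{1..N}. cst (1 / fact k) * w * theta ^ (k - 1) * (Y ^^ k) (Phi 1 (time_coeff (Suc N - k))))" .
  have "Phi 1 (time_coeff (Suc N)) - time_coeff (Suc N) = gg ^ c * (- ((if N = 0 then w else 0) +
     (\<Sum>k\<in>{1..N}. cst (1 / fact k) * w * theta ^ (k - 1) * (Y ^^ k) (Phi 1 (time_coeff (Suc N - k))))))"
    by (subst (1 2) time_coeff.simps) (rule inv_diff_solves)
  moreover have "A + g * B - S = - (g * a)" if "A - S = g * (- (a + B))" for A S g a B :: ser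
    using that by (simp add: algebra_simps)
  ultimately have "Phi 1 (time_coeff (Suc N)) + gg ^ c * (\<Sum>k\<in>{1..N}. cst (1 / fact k) * w * theta ^ (k - 1) * (Y ^^ k) (Phi 1 (time_coeff (Suc N - k))))
      - time_coeff (Suc N) = - (gg ^ c * (if N = 0 then w else 0))" by blast
  then show ?thesis unfolding e by (simp add: theta_def)
qed

definition conj_time :: "complex \<Rightarrow> ser" where
  "conj_time t = qsum (\<lambda>n. cst (t ^ Suc n) * time_coeff (Suc n))"

definition pert_time :: "complex \<Rightarrow> ser" where "pert_time t = 1 + cst t * theta"

theorem Phi_conj_time: "Phi (pert_time t) (conj_time t) - conj_time t = 1 - pert_time t"
proof -
  have tm: "cst a * time_coeff (Suc n) \<in> Fil n" for a n by (intro ordge_mult_left time_coeff_Fil)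
  \<comment> \<open>The time 1 is constant, hence unchanged by any flow, so the composition law
    splits it off from \<open>cst t * theta\<close>.\<close>
  have "Phi (pert_time t) (conj_time t) = Phi (cst t * theta) (Phi 1 (conj_time t))"
    by (simp add: Phi_Phi pert_time_def add.commute)
  also have "\<dots> = qsum (\<lambda>n. cst (t ^ Suc n) * Phi (cst t * theta) (Phi 1 (time_coeff (Suc n))))"
    unfolding conj_time_def
    by (subst qsum_map[where H = "\<lambda>F. Phi (cst t * theta) (Phi 1 F)"])
       (auto simp: Phi_mult Phi_add simp del: power_Suc intro: tm Phi_Fil)
  also have "\<dots> = qsum (\<lambda>n. qsum (\<lambda>k. cst (t ^ Suc n) * (cst (1 / fact k) * (cst t * theta) ^ k * (Y ^^ k) (Phi 1 (time_coeff (Suc n))))))"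
    unfolding Phi_def[of "cst t * theta"] by (subst qsum_mult_left) (auto intro: Phi_term_Fil)
  also have "\<dots> = qsum (\<lambda>N. \<Sum>n\<le>N. cst (t ^ Suc n) * (cst (1 / fact (N - n)) * (cst t * theta) ^ (N - n) * (Y ^^ (N - n)) (Phi 1 (time_coeff (Suc n)))))"
    by (rule qsum_rearrange) (intro ordge_mult_left Yn_Fil_add Phi_Fil time_coeff_Fil)
  also have "\<dots> = qsum (\<lambda>N. cst (t ^ Suc N) * (\<Sum>n\<le>N. cst (1 / fact (N - n)) * theta ^ (N - n) * (Y ^^ (N - n)) (Phi 1 (time_coeff (Suc n)))))"
  proof (rule qsum_cong, unfold sum_distrib_left, rule sum.cong[OF refl])
    fix N n :: nat assume "n \<in> {..N}"
    then have "t ^ Suc N = t ^ Suc n * t ^ (N - n)" by (simp flip: power_add)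
    then show "cst (t ^ Suc n) * (cst (1 / fact (N - n)) * (cst t * theta) ^ (N - n) * (Y ^^ (N - n)) (Phi 1 (time_coeff (Suc n)))) =
      cst (t ^ Suc N) * (cst (1 / fact (N - n)) * theta ^ (N - n) * (Y ^^ (N - n)) (Phi 1 (time_coeff (Suc n))))"
      by (simp only: cst_mult cst_power power_mult_distrib ac_simps)
  qed
  also have "\<dots> = qsum (\<lambda>N. cst (t ^ Suc N) * time_coeff (Suc N) + (if N = 0 then - (cst t * theta) else 0))"
  proof (rule qsum_cong)
    fix N
    have "(\<Sum>n\<le>N. cst (1 / fact (N - n)) * theta ^ (N - n) * (Y ^^ (N - n)) (Phi 1 (time_coeff (Suc n)))) =
      time_coeff (Suc N) - (if N = 0 then theta else 0)"
      using time_coeff_eq[of N] by (simp only: diff_eq_eq) simp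
    then show "cst (t ^ Suc N) * (\<Sum>n\<le>N. cst (1 / fact (N - n)) * theta ^ (N - n) * (Y ^^ (N - n)) (Phi 1 (time_coeff (Suc n)))) =
      cst (t ^ Suc N) * time_coeff (Suc N) + (if N = 0 then - (cst t * theta) else 0)"
      by (simp add: right_diff_distrib)
  qed
  also have "\<dots> = conj_time t + qsum (\<lambda>N. if N = 0 then - (cst t * theta) else 0)"
    unfolding conj_time_def by (rule qsum_add) (use tm in auto)
  also have "qsum (\<lambda>N. if N = 0 then - (cst t * theta) else 0) = - (cst t * theta)"
    by (subst qsum_Suc) (auto simp: qsum_0)
  finally show ?thesis by (simp add: pert_time_def)
qed

end


subsection \<open>Uniqueness of the conjugacy up to the centralizer\<close>

lemma coeff3_fps_const: "coeff3 (fps_const a) i j k = (if i = 0 then fps_nth (fps_nth a j) k else 0)"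
  by (simp add: coeff3_def)

lemma coeff3_gg_mult:
  "coeff3 (gg * F) i j k = (if k = 0 then 0 else coeff3 F i j (k - 1)) -
     (if i = 0 \<or> j = 0 then 0 else coeff3 F (i - 1) (j - 1) k)"
  by (auto simp: gg_def left_diff_distrib coeff3_X2_mult coeff3_X_mult coeff3_X1_mult mult.assoc)

text \<open>Comparing coefficients of \<open>gg * F\<close> expresses a coefficient of
  \<open>F\<close> with exponent \<open>i\<close> of \<open>x\<close> through one with exponent
  \<open>i - 1\<close> of the same degree in (x1, x2); hence the inner induction on
  \<open>i\<close>.\<close>

lemma gg_cancel_Fil:
  assumes "gg * F \<in> Fil (Suc m)" shows "F \<in> Fil m"
  using assms
proof (induction m)
  case (Suc m)
  note gF = Suc.prems
  have F: "F \<in> Fil m" by (rule Suc.IH[OF ordge_mono[OF gF]]) simp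
  have "coeff3 F i j k = 0" if "j + k = m" for i j k
    using that
  proof (induction i arbitrary: j k)
    case 0
    then show ?case using ordgeD[OF gF, of 0 j "Suc k"] by (simp add: coeff3_gg_mult)
  next
    case (Suc i)
    have 1: "coeff3 (gg * F) (Suc i) j (Suc k) = 0" using Suc.prems by (intro ordgeD[OF gF]) auto
    show ?case
    proof (cases j)
      case 0 then show ?thesis using 1 by (simp add: coeff3_gg_mult)
    next
      case (Suc j')
      then show ?thesis using 1 Suc.IH[of j' "Suc k"] Suc.prems by (simp add: coeff3_gg_mult)
    qed
  qed
  then show ?case using F by (auto simp: ordge_def less_Suc_eq)
qed simp

lemma gg_power_cancel_Fil: "gg ^ k * F \<in> Fil (m + k) \<Longrightarrow> F \<in> Fil m"
proof (induction k arbitrary: m)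
  case (Suc k)
  have "gg * (gg ^ k * F) \<in> Fil (Suc (m + k))" using Suc.prems by (simp add: mult.assoc)
  then show ?case using Suc.IH gg_cancel_Fil by blast
qed simp

lemma qsum_diff: 
  assumes "\<And>n. f n \<in> Fil n" "\<And>n. g n \<in> Fil n"
  shows "qsum (\<lambda>n. f n - g n) = qsum f - qsum g"
  by (rule coeff3_ext) (simp add: qsum_def sum_subtractf)

lemma power_diff_gg_Fil:
  assumes "A - gg \<in> Fil 2" shows "A ^ i - gg ^ i \<in> Fil (Suc i)"
proof (induction i)
  case (Suc i)
  have "A = (A - gg) + gg" by simp
  then have A: "A \<in> Fil (Suc 0)" using ordge_add[OF ordge_mono[OF assms, of "Suc 0"] gg_Fil] by simp
  have "A * (A ^ i - gg ^ i) \<in> Fil (Suc 0 + Suc i)" by (rule ordge_mult[OF A Suc])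
  moreover have "(A - gg) * gg ^ i \<in> Fil (2 + i)" by (rule ordge_mult[OF assms gg_power_Fil])
  ultimately have "A * (A ^ i - gg ^ i) + (A - gg) * gg ^ i \<in> Fil (Suc (Suc i))"
    by (simp add: ordge_add)
  then show ?case by (simp add: algebra_simps)
qed simp

context flow_setup
begin

text \<open>In the factorisation of \<open>A ^ c - B ^ c\<close> by \<open>A - B\<close>, each of
  the \<open>c\<close> summands of the cofactor is \<open>gg ^ (c - 1)\<close> up to higher
  degree.\<close>

lemma power_diff_leading:
  assumes A: "A - gg \<in> Fil 2" and B: "B - gg \<in> Fil 2" and D: "A - B \<in> Fil (Suc n)"
  shows "A ^ c - B ^ c - of_nat c * gg ^ (c - 1) * (A - B) \<in> Fil (n + c + 1)"
proof -
  have "B ^ (c - Suc i) * A ^ i - gg ^ (c - 1) \<in> Fil c" if "i < c" for i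
  proof -
    have BF: "B \<in> Fil (Suc 0)"
      using ordge_add[OF ordge_mono[OF B, of "Suc 0"] gg_Fil] by simp
    have 1: "B ^ (c - Suc i) * (A ^ i - gg ^ i) \<in> Fil ((c - Suc i) + Suc i)"
      using ordge_mult[OF ordge_power[OF BF, of "c - Suc i"] power_diff_gg_Fil[OF A, of i]] by simp
    have 2: "(B ^ (c - Suc i) - gg ^ (c - Suc i)) * gg ^ i \<in> Fil (Suc (c - Suc i) + i)"
      by (intro ordge_mult power_diff_gg_Fil[OF B] gg_power_Fil)
    have "gg ^ (c - 1) = gg ^ (c - Suc i) * gg ^ i" using that by (simp flip: power_add)
    then have "B ^ (c - Suc i) * A ^ i - gg ^ (c - 1) = 
       B ^ (c - Suc i) * (A ^ i - gg ^ i) + (B ^ (c - Suc i) - gg ^ (c - Suc i)) * gg ^ i"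
      by (simp add: algebra_simps)
    then show ?thesis using ordge_add[OF 1] 2 that by simp
  qed
  then have "(\<Sum>i<c. B ^ (c - Suc i) * A ^ i - gg ^ (c - 1)) \<in> Fil c"
    by (intro ordge_sum) auto
  then have "(A - B) * ((\<Sum>i<c. B ^ (c - Suc i) * A ^ i) - of_nat c * gg ^ (c - 1)) \<in> Fil (Suc n + c)"
    by (intro ordge_mult D) (simp add: sum_subtractf)
  then show ?thesis by (simp add: power_diff_sumr2[of A c B] algebra_simps)
qed

text \<open>First variation of the flow in its time: the linear term contributes
  \<open>gg ^ c\<close>, and every later one contains at least two applications of
  \<open>Y\<close>.\<close>

lemma Phi_X_diff:
  assumes "s - s' \<in> Fil m"
  shows "Phi s X - Phi s' X - (s - s') * gg ^ c \<in> Fil (m + 2 * c)"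
proof -
  define f where "f k = cst (1 / fact k) * s ^ k * (Y ^^ k) X - cst (1 / fact k) * s' ^ k * (Y ^^ k) X" for k
  have f: "f k \<in> Fil k" for k unfolding f_def by (intro ordge_diff Phi_term_Fil)
  have "qsum (\<lambda>k. f (Suc (Suc k))) \<in> Fil (m + 2 * c)"
  proof (rule qsum_ordge)
    fix k
    have "f (Suc (Suc k)) = cst (1 / fact (Suc (Suc k))) * ((s ^ Suc (Suc k) - s' ^ Suc (Suc k)) * (Y ^^ Suc (Suc k)) X)"
      by (simp add: f_def algebra_simps)
    also have "\<dots> \<in> Fil (m + (0 + Suc (Suc k) * c))"
      by (rule ordge_mult_left[OF ordge_mult[OF power_diff_Fil[OF assms] Yn_Fil_c]]) simp
    finally show "f (Suc (Suc k)) \<in> Fil (m + 2 * c)" by (rule ordge_mono) simp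
  qed
  moreover have "Phi s X - Phi s' X = f 0 + (f 1 + qsum (\<lambda>k. f (Suc (Suc k))))"
  proof -
    have "Phi s X - Phi s' X = qsum f"
      unfolding Phi_def f_def by (rule qsum_diff[symmetric]) (rule Phi_term_Fil)+
    also have "\<dots> = f 0 + qsum (\<lambda>k. f (Suc k))" by (rule qsum_Suc[OF f])
    also have "qsum (\<lambda>k. f (Suc k)) = f 1 + qsum (\<lambda>k. f (Suc (Suc k)))"
      by (subst qsum_Suc) (auto intro: ordge_mono[OF f])
    finally show ?thesis .
  qed
  moreover have "f 0 = 0" "f 1 = (s - s') * gg ^ c"
    by (simp_all add: f_def Y_def X_def algebra_simps)
  ultimately show ?thesis by simp
qed

text \<open>In leading degree the equation says that \<open>D / gg ^ c\<close> has zero derivative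
  in \<open>x\<close>. Divisibility by \<open>gg ^ c\<close> is not known beforehand, so the
  argument runs on coefficients.\<close>

lemma leading_equation:
  assumes D: "D \<in> Fil n" and eq: "gg * fps_deriv D + of_nat c * X1 * D \<in> Fil (n + 2)"
  shows "\<exists>a. fps_const a \<in> Fil (n - c) \<and> D - fps_const a * gg ^ c \<in> Fil (Suc n)"
proof -
  have rel: "(if k = 0 then 0 else of_nat (Suc i) * coeff3 F (Suc i) j (k - 1)) +
      (if j = 0 then 0 else (of_nat c - of_nat i) * coeff3 F i (j - 1) k) = 0"
    if eqF: "gg * fps_deriv F + of_nat c * X1 * F \<in> Fil (n + 2)" and jk: "j + k = Suc n" for F i j k
  proof -
    have e: "gg * fps_deriv F + of_nat c * X1 * F = gg * fps_deriv F + cst (of_nat c) * (X1 * F)"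
      by (simp add: cst_of_nat mult.assoc)
    have "coeff3 (gg * fps_deriv F + of_nat c * X1 * F) i j k = 0"
      using jk by (intro ordgeD[OF eqF]) simp
    then show ?thesis
      unfolding e coeff3_add coeff3_gg_mult coeff3_cst_mult coeff3_X1_mult coeff3_deriv
      by (cases i; cases j; cases k) (simp_all add: algebra_simps del: of_nat_Suc)
  qed
  \<comment> \<open>At \<open>i = 0\<close> this shows that the part of \<open>D\<close> of degree
    \<open>n\<close> with \<open>x = 0\<close> is divisible by \<open>x2 ^ c\<close>; the quotient
    is the \<open>a\<close> defined below.\<close>
  have van: "coeff3 D i j m = 0" if "i + m < c" "j + m = n" for i j m
    using that
  proof (induction m arbitrary: i j)
    case 0
    then show ?case using rel[OF eq, of "Suc n" 0 i] by simp
  next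
    case (Suc m)
    then show ?case using rel[OF eq, of "Suc j" "Suc m" i] Suc.IH[of "Suc i" "Suc j"] 
      by simp
  qed
  define a where "a = Abs_fps (\<lambda>j. Abs_fps (\<lambda>k. if j + k + c = n then coeff3 D 0 j (k + c) else 0))"
  have a_nth: "fps_nth (fps_nth a j) k = (if j + k + c = n then coeff3 D 0 j (k + c) else 0)" for j k
    by (simp add: a_def)
  define E where "E = D - fps_const a * gg ^ c"
  \<comment> \<open>Modulo \<open>x\<close> the power \<open>gg ^ c\<close> reduces to
    \<open>x2 ^ c\<close>.\<close>
  have c0: "coeff3 (fps_const a * gg ^ c) 0 j k = (if c \<le> k then fps_nth (fps_nth a j) (k - c) else 0)" for j k
  proof -
    obtain Z where "gg ^ c - X2 ^ c = (gg - X2) * Z" using power_diff_sumr2[of gg c X2] by blast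
    then have e: "gg ^ c = X2 ^ c - X * X1 * Z" by (simp add: gg_def algebra_simps)
    have "fps_const a * gg ^ c = X ^ 0 * X1 ^ 0 * X2 ^ c * fps_const a - X * (X1 * Z * fps_const a)"
      unfolding e by (simp add: algebra_simps)
    then show ?thesis by (simp add: coeff3_monom_mult coeff3_X_mult coeff3_fps_const del: power_0)
  qed
  have aF: "fps_const a \<in> Fil (n - c)"
    by (auto simp: ordge_def coeff3_fps_const a_def)
  obtain d where d: "c = Suc d" using c_pos by (cases c) auto
  have "gg * fps_deriv (fps_const a * gg ^ c) + of_nat c * X1 * (fps_const a * gg ^ c) = 0"
    unfolding d fps_deriv_mult fps_deriv_power' deriv_gg diff_Suc_1
    by (simp add: algebra_simps del: of_nat_Suc)
  then have eqE: "gg * fps_deriv E + of_nat c * X1 * E \<in> Fil (n + 2)"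
    using eq by (simp add: E_def algebra_simps)
  have "fps_const a * gg ^ c \<in> Fil ((n - c) + c)" by (intro ordge_mult aF gg_power_Fil)
  then have "fps_const a * gg ^ c \<in> Fil n" by (rule ordge_mono) simp
  then have EF: "E \<in> Fil n" unfolding E_def by (intro ordge_diff D)
  have "coeff3 E i j k = 0" if "j + k = n" for i j k
    using that
  proof (induction i arbitrary: j k)
    case 0
    then show ?case using van[of 0 k j] by (auto simp: E_def c0 a_nth)
  next
    case (Suc i)
    show ?case
    proof (cases j)
      case 0 then show ?thesis using rel[OF eqE, of 0 "Suc k" i] Suc.prems by (simp del: of_nat_Suc)
    next
      case (Suc j')
      then show ?thesis using rel[OF eqE, of j "Suc k" i] Suc.prems Suc.IH[of j' "Suc k"]
        by (simp del: of_nat_Suc)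
    qed
  qed
  then have "E \<in> Fil (Suc n)" using EF by (auto simp: ordge_def less_Suc_eq)
  then show ?thesis using aF by (auto simp: E_def)
qed

section \<open>Maps conjugating the flow at a time \<open>r\<close> near 1 to the flow at time
  1\<close>

context
  fixes r :: ser
  assumes r: "r - 1 \<in> Fil c"
begin

lemma Phi_r_approx:
  assumes "F \<in> Fil n"
  shows "Phi r F - F - Y F \<in> Fil (n + 2 * c)"
proof -
  have "(r - 1) * Y F \<in> Fil (c + (n + c))" by (intro ordge_mult r Y_Fil assms)
  then have "(r - 1) * Y F \<in> Fil (n + 2 * c)" by (rule ordge_mono) simp
  from ordge_add[OF Phi_approx2[OF assms, of r] this] show ?thesis by (simp add: algebra_simps)
qed

lemma Phi_1_X_approx: "Phi 1 X - X - gg ^ c \<in> Fil (2 * c)"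
  using Phi_approx2[of X 0 1] by (simp add: Y_def X_def)

text \<open>In degree \<open>c\<close> the conjugacy equation reads
  \<open>gg ^ c * S' = (x2 - S * x1) ^ c\<close>, with \<open>S'\<close> the derivative in
  \<open>x\<close>. The coefficients of \<open>x2 ^ c\<close> give \<open>S' = 1\<close> on the axis
  \<open>x1 = x2 = 0\<close>.\<close>

lemma conj_near_X:
  assumes S0: "coeff3 S 0 0 0 = 0" and conj: "Phi r S = subst_x S (Phi 1 X)"
  shows "S - X \<in> Fil 1"
proof -
  have TotFil: "S \<in> TotFil (Suc 0)" using S0 by (simp add: TotFil_1)
  have "subst_x S (Phi 1 X) - S - (X2 - S * X1) ^ c \<in> Fil (2 * c)"
    using subst_x_Fil[OF Phi_1_X_approx, of S] by (simp add: subst_x_diff subst_x_X[OF TotFil] subst_x_gg_power[OF TotFil])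
  moreover have "Phi r S - S - gg ^ c * fps_deriv S \<in> Fil (2 * c)"
    using Phi_r_approx[of S 0] by (simp add: Y_def)
  ultimately have "gg ^ c * fps_deriv S - (X2 - S * X1) ^ c \<in> Fil (2 * c)"
    using ordge_diff[of "subst_x S (Phi 1 X) - S - (X2 - S * X1) ^ c" 0 "Suc 0" "Suc 0" "2 * c" "Phi r S - S - gg ^ c * fps_deriv S"]
    by (simp add: conj)
  then have F: "gg ^ c * fps_deriv S - (X2 - S * X1) ^ c \<in> Fil (Suc c)"
    by (rule ordge_mono) (use c_pos in simp)
  obtain Z where Z: "gg ^ c - X2 ^ c = (gg - X2) * Z" using power_diff_sumr2[of gg c X2] by blast
  obtain Z' where Z': "(X2 - S * X1) ^ c - X2 ^ c = (X2 - S * X1 - X2) * Z'" 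
    using power_diff_sumr2[of "X2 - S * X1" c X2] by blast
  have eqs: "gg ^ c = X2 ^ c - X1 * (X * Z)" "(X2 - S * X1) ^ c = X2 ^ c - X1 * (S * Z')"
    using Z Z' by (simp_all add: gg_def algebra_simps)
  have e: "gg ^ c * fps_deriv S - (X2 - S * X1) ^ c = 
      X ^ 0 * X1 ^ 0 * X2 ^ c * (fps_deriv S - 1) + X1 * (S * Z' - X * Z * fps_deriv S)"
    unfolding eqs by (simp add: algebra_simps)
  have "coeff3 (fps_deriv S - 1) i 0 0 = 0" for i
  proof -
    have "coeff3 (gg ^ c * fps_deriv S - (X2 - S * X1) ^ c) i 0 c = 0"
      by (rule ordgeD[OF F]) simp
    then show ?thesis unfolding e by (simp add: coeff3_monom_mult coeff3_X1_mult del: power_0)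
  qed
  then have d: "of_nat (Suc i) * coeff3 S (Suc i) 0 0 = (if i = 0 then 1 else 0)" for i
    by (simp add: coeff3_1 del: of_nat_Suc)
  have "coeff3 S (Suc i) 0 0 = (if i = 0 then 1 else 0)" for i
    using d[of i] by (cases i) (simp, simp del: of_nat_Suc)
  then have "coeff3 (S - X) i 0 0 = 0" for i
    by (cases i) (auto simp: S0 coeff3_X)
  then show ?thesis by (auto simp: ordge_def)
qed

text \<open>Subtracting the equations of two conjugacies and keeping the leading degree gives
  \<open>Y D = - c * gg ^ (c - 1) * x1 * D\<close> for their difference \<open>D\<close>. After
  cancellation of \<open>gg ^ (c - 1)\<close> this is \<open>leading_equation\<close>.\<close>

lemma conj_step:
  assumes S: "S - X \<in> Fil 1" "Phi r S = subst_x S (Phi 1 X)" "coeff3 S 0 0 0 = 0"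
    and S': "S' - X \<in> Fil 1" "Phi r S' = subst_x S' (Phi 1 X)" "coeff3 S' 0 0 0 = 0"
    and D: "S - S' \<in> Fil n"
  shows "\<exists>a. fps_const a \<in> Fil (n - c) \<and> S - S' - fps_const a * gg ^ c \<in> Fil (Suc n)"
proof (rule leading_equation[OF D])
  have TotFil: "S \<in> TotFil (Suc 0)" "S' \<in> TotFil (Suc 0)" using S(3) S'(3) by (simp_all add: TotFil_1)
  define A where "A = X2 - S * X1"
  define B where "B = X2 - S' * X1"
  have A: "A - gg \<in> Fil 2" "B - gg \<in> Fil 2"
  proof -
    have "X1 \<in> Fil 1" using homog_ordge[OF X1_homog, of 0 "Suc 0" "Suc 0"] by simp
    then have "- ((S - X) * X1) \<in> Fil (1 + 1)" "- ((S' - X) * X1) \<in> Fil (1 + 1)" 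
      by (intro ordge_minus ordge_mult S S'; assumption)+
    then show "A - gg \<in> Fil 2" "B - gg \<in> Fil 2" by (simp_all add: A_def B_def gg_def algebra_simps numeral_2_eq_2)
  qed
  have AB: "A - B = - (X1 * (S - S'))" by (simp add: A_def B_def algebra_simps)
  have "X1 * (S - S') \<in> Fil (Suc 0 + n)"
    by (intro ordge_mult D) (use homog_ordge[OF X1_homog, of 0 "Suc 0" "Suc 0"] in simp)
  then have ABF: "A - B \<in> Fil (Suc n)" unfolding AB by (intro ordge_minus) simp
  have 1: "A ^ c - B ^ c - of_nat c * gg ^ (c - 1) * (A - B) \<in> Fil (n + c + 1)"
    by (rule power_diff_leading[OF A ABF])
  have 2: "subst_x S (Phi 1 X) - subst_x S' (Phi 1 X) - (S - S') - (A ^ c - B ^ c) \<in> Fil (n + c + 1)"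
  proof -
    have F: "subst_x S (Phi 1 X - X - gg ^ c) - subst_x S' (Phi 1 X - X - gg ^ c) \<in> Fil (2 * c + n)"
      by (rule subst_x_diff_Fil[OF Phi_1_X_approx D])
    have e: "subst_x Q (Phi 1 X - X - gg ^ c) = subst_x Q (Phi 1 X) - Q - (X2 - Q * X1) ^ c" if "Q \<in> TotFil (Suc 0)" for Q
      by (simp only: subst_x_diff subst_x_X[OF that] subst_x_gg_power[OF that])
    have "subst_x S (Phi 1 X) - subst_x S' (Phi 1 X) - (S - S') - (A ^ c - B ^ c) \<in> Fil (2 * c + n)"
      using F unfolding e[OF TotFil(1)] e[OF TotFil(2)] A_def[symmetric] B_def[symmetric]
      by (simp add: algebra_simps)
    then show ?thesis by (rule ordge_mono) (use c_pos in simp)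
  qed
  have 3: "Phi r (S - S') - (S - S') - Y (S - S') \<in> Fil (n + c + 1)"
    by (rule ordge_mono[OF Phi_r_approx[OF D]]) (use c_pos in simp)
  have "Y (S - S') + of_nat c * gg ^ (c - 1) * (X1 * (S - S')) \<in> Fil (n + c + 1)"
    using ordge_diff[OF ordge_add[OF 1 2] 3] unfolding AB
    by (simp add: Phi_diff S(2) S'(2) algebra_simps)
  moreover have "gg ^ c = gg ^ (c - 1) * gg" using c_pos by (simp flip: power_Suc2)
  ultimately have "gg ^ (c - 1) * (gg * fps_deriv (S - S') + of_nat c * X1 * (S - S')) \<in> Fil (n + 2 + (c - 1))"
    using c_pos by (simp add: Y_def algebra_simps)
  then show "gg * fps_deriv (S - S') + of_nat c * X1 * (S - S') \<in> Fil (n + 2)"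
    by (rule gg_power_cancel_Fil)
qed

text \<open>Adding a function \<open>a\<close> of (x1, x2) to the time preserves the time equation
  and changes the map by about \<open>a * gg ^ c\<close>. This is exactly the freedom left by
  \<open>conj_step\<close>, so \<open>a\<close> can be built by successive corrections.\<close>

theorem conj_unique:
  assumes s: "Phi r s - s = 1 - r"
    and S: "coeff3 S 0 0 0 = 0" "Phi r S = subst_x S (Phi 1 X)"
  shows "\<exists>a. S = Phi (s + fps_const a) X"
proof -
  have sol: "Phi (s + fps_const a) X - X \<in> Fil 1" 
    "Phi r (Phi (s + fps_const a) X) = subst_x (Phi (s + fps_const a) X) (Phi 1 X)"
    "coeff3 (Phi (s + fps_const a) X) 0 0 0 = 0" for a
  proof -
    have "Phi (s + fps_const a) X - X \<in> Fil c" using Phi_approx1[of X 0] by simp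
    then show "Phi (s + fps_const a) X - X \<in> Fil 1" by (rule ordge_mono) (rule c_pos)
    have "r + Phi r (s + fps_const a) = (s + fps_const a) + 1"
      using s by (simp add: Phi_add algebra_simps)
    then show "Phi r (Phi (s + fps_const a) X) = subst_x (Phi (s + fps_const a) X) (Phi 1 X)"
      by (simp flip: Phi_eq_subst_x add: Phi_Phi)
    show "coeff3 (Phi (s + fps_const a) X) 0 0 0 = 0"
      using Phi_TotFil[OF X_TotFil] by (simp add: TotFil_1)
  qed
  have SX: "S - X \<in> Fil 1" by (rule conj_near_X[OF S])
  define P where "P n a \<longleftrightarrow> S - Phi (s + fps_const a) X \<in> Fil (Suc n)" for n a
  have "\<exists>f. \<forall>n. P n (f n) \<and> fps_const (f (Suc n)) - fps_const (f n) \<in> Fil (Suc n - c)"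
  proof (rule dependent_nat_choice)
    show "\<exists>a. P 0 a"
      unfolding P_def using ordge_diff[OF SX sol(1)[of 0]] by (auto simp: algebra_simps intro!: exI[of _ 0])
    fix a n assume "P n a"
    then have D: "S - Phi (s + fps_const a) X \<in> Fil (Suc n)" by (simp add: P_def)
    from conj_step[OF SX S(2,1) sol[of a] this] obtain b where
      b: "fps_const b \<in> Fil (Suc n - c)" 
         "S - Phi (s + fps_const a) X - fps_const b * gg ^ c \<in> Fil (Suc (Suc n))" by blast
    have "Phi (s + fps_const (a + b)) X - Phi (s + fps_const a) X - fps_const b * gg ^ c \<in> Fil (Suc n - c + 2 * c)"
      using Phi_X_diff[of "s + fps_const (a + b)" "s + fps_const a" "Suc n - c"] b(1)
      by (simp add: algebra_simps flip: fps_const_add)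
    then have "Phi (s + fps_const (a + b)) X - Phi (s + fps_const a) X - fps_const b * gg ^ c \<in> Fil (Suc (Suc n))"
      by (rule ordge_mono) (use c_pos in simp)
    from ordge_diff[OF b(2) this] have "P (Suc n) (a + b)" by (simp add: P_def)
    moreover have "fps_const (a + b) - fps_const a \<in> Fil (Suc n - c)" using b(1) by simp
    ultimately show "\<exists>b. P (Suc n) b \<and> fps_const b - fps_const a \<in> Fil (Suc n - c)" by blast
  qed
  then obtain f where f: "\<And>n. S - Phi (s + fps_const (f n)) X \<in> Fil (Suc n)"
    "\<And>n. fps_const (f (Suc n)) - fps_const (f n) \<in> Fil (Suc n - c)"
    unfolding P_def by blast
  \<comment> \<open>The corrections from index \<open>j + k + c\<close> on have degree greater than
    \<open>j + k\<close>, so this coefficient has stabilised there.\<close>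
  define a where "a = Abs_fps (\<lambda>j. Abs_fps (\<lambda>k. coeff3 (fps_const (f (j + k + c))) 0 j k))"
  have lim: "fps_const a - fps_const (f n) \<in> Fil (Suc n - c)" for n
  proof -
    have "coeff3 (fps_const (f (j + k + c + d))) 0 j k = coeff3 (fps_const (f (j + k + c))) 0 j k" for j k d
    proof (induction d)
      case (Suc d)
      have "coeff3 (fps_const (f (Suc (j + k + c + d))) - fps_const (f (j + k + c + d))) 0 j k = 0"
        by (rule ordgeD[OF f(2)]) simp
      then show ?case using Suc by (simp add: coeff3_fps_const)
    qed simp
    note shift = this
    have *: "coeff3 (fps_const (f n)) 0 j k = coeff3 (fps_const (f (j + k + c))) 0 j k" if "j + k + c \<le> n" for j k
      using that shift[where j = j and k = k and d = "n - (j + k + c)"] by simp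
    show ?thesis
    proof (rule ordgeI)
      fix i j k assume "0 * i + Suc 0 * j + Suc 0 * k < Suc n - c"
      then show "coeff3 (fps_const a - fps_const (f n)) i j k = 0"
        using *[of j k] by (simp add: a_def coeff3_fps_const)
    qed
  qed
  have "S - Phi (s + fps_const a) X \<in> Fil n" for n
  proof -
    have "Phi (s + fps_const a) X - Phi (s + fps_const (f n)) X - (fps_const a - fps_const (f n)) * gg ^ c
        \<in> Fil (Suc n - c + 2 * c)"
      using Phi_X_diff[of "s + fps_const a" "s + fps_const (f n)" "Suc n - c"] lim[of n] by simp
    then have 1: "Phi (s + fps_const a) X - Phi (s + fps_const (f n)) X - (fps_const a - fps_const (f n)) * gg ^ c \<in> Fil n"
      by (rule ordge_mono) simp
    have "(fps_const a - fps_const (f n)) * gg ^ c \<in> Fil (Suc n - c + c)"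
      by (intro ordge_mult lim gg_power_Fil)
    then have 2: "(fps_const a - fps_const (f n)) * gg ^ c \<in> Fil n" by (rule ordge_mono) simp
    have 3: "S - Phi (s + fps_const (f n)) X \<in> Fil n" by (rule ordge_mono[OF f(1)]) simp
    from ordge_diff[OF 3 ordge_add[OF 1 2]] show ?thesis by simp
  qed
  then have "S = Phi (s + fps_const a) X" by (rule Fil_eqI)
  then show ?thesis by blast
qed

end

end


subsection \<open>Convergent series\<close>

lemma box_sum_geometric:
  "(\<Sum>a\<le>i. \<Sum>b\<le>j. \<Sum>d\<le>k. (1/2::real) ^ (a + b + d)) \<le> 8"
proof -
  have g: "(\<Sum>a\<le>n. (1/2::real) ^ a) \<le> 2" for n
    by (subst atMost_atLeast0, subst sum_gp) (auto simp: field_simps)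
  have g0: "0 \<le> (\<Sum>a\<le>n. (1/2::real) ^ a)" for n by (intro sum_nonneg) auto
  have "(\<Sum>a\<le>i. \<Sum>b\<le>j. \<Sum>d\<le>k. (1/2::real) ^ (a + b + d)) =
     (\<Sum>a\<le>i. (1/2) ^ a) * ((\<Sum>b\<le>j. (1/2) ^ b) * (\<Sum>d\<le>k. (1/2) ^ d))"
    unfolding sum_product by (simp add: power_add sum_distrib_left mult.assoc)
  also have "\<dots> \<le> 2 * (2 * 2)"
    by (intro mult_mono g mult_nonneg_nonneg g0) auto
  finally show ?thesis by simp
qed

text \<open>One number serves as prefactor and as rate (hence the \<open>+ 1\<close> in the
  exponent), so bounds for several series can be brought to a common \<open>R\<close> by
  \<open>geo_mono\<close>.\<close>

definition geo :: "real \<Rightarrow> ser \<Rightarrow> bool" where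
  "geo R F \<longleftrightarrow> 1 \<le> R \<and> (\<forall>i j k. norm (coeff3 F i j k) \<le> R ^ (i + j + k + 1))"

lemma geo_mono: "geo R F \<Longrightarrow> R \<le> R' \<Longrightarrow> geo R' F"
  unfolding geo_def by (meson order_trans power_mono zero_le_one)

lemma geoI:
  assumes "0 \<le> C" "0 \<le> R" "\<And>i j k. norm (coeff3 F i j k) \<le> C * R ^ (i + j + k)"
  shows "\<exists>R. geo R F"
proof -
  define M where "M = max 1 (max C R)"
  have "C * R ^ n \<le> M * M ^ n" for n
    by (intro mult_mono power_mono) (use assms in \<open>auto simp: M_def\<close>)
  then have "norm (coeff3 F i j k) \<le> M ^ (i + j + k + 1)" for i j k
    using order_trans[OF assms(3)] by simp
  then have "geo M F" by (simp add: geo_def M_def)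
  then show ?thesis by blast
qed

lemma conv_iff_geo: "F \<in> conv \<longleftrightarrow> (\<exists>R. geo R F)"
proof
  assume "F \<in> conv"
  then obtain r where r: "r > 0" 
    and s: "(\<lambda>(i, j, k). norm (coeff3 F i j k) * r ^ (i + j + k)) summable_on UNIV"
    by (auto simp: conv_def)
  define M where "M = infsum (\<lambda>(i, j, k). norm (coeff3 F i j k) * r ^ (i + j + k)) UNIV"
  have le: "norm (coeff3 F i j k) * r ^ (i + j + k) \<le> M" for i j k
    using finite_sum_le_infsum[OF s, of "{(i, j, k)}"] r by (auto simp: M_def)
  have "0 \<le> M" using le[of 0 0 0] r by (metis norm_ge_zero mult_nonneg_nonneg order_trans zero_le_power less_imp_le)
  then show "\<exists>R. geo R F"
  proof (rule geoI)
    fix i j k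
    show "norm (coeff3 F i j k) \<le> M * (1 / r) ^ (i + j + k)"
      using le[of i j k] r by (simp add: power_divide field_simps)
  qed (use r in auto)
next
  assume "\<exists>R. geo R F"
  then obtain R where R: "1 \<le> R" "\<And>i j k. norm (coeff3 F i j k) \<le> R ^ (i + j + k + 1)"
    by (auto simp: geo_def)
  \<comment> \<open>Half the radius guaranteed by \<open>R\<close>, so that the terms decay like
    powers of 1/2.\<close>
  define r where "r = 1 / (2 * R)"
  have r: "r > 0" using R by (simp add: r_def)
  have bd: "norm (coeff3 F i j k) * r ^ (i + j + k) \<le> R * (1/2) ^ (i + j + k)" for i j k
  proof -
    have "norm (coeff3 F i j k) * r ^ (i + j + k) \<le> R ^ (i + j + k + 1) * r ^ (i + j + k)"
      using R r by (intro mult_right_mono) auto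
    also have "\<dots> = R * (R * r) ^ (i + j + k)" by (simp add: power_mult_distrib)
    also have "R * r = 1/2" using R by (simp add: r_def)
    finally show ?thesis .
  qed
  have "(\<lambda>(i, j, k). norm (coeff3 F i j k) * r ^ (i + j + k)) summable_on UNIV"
  proof (rule nonneg_bdd_above_summable_on)
    show "bdd_above (sum (\<lambda>(i, j, k). norm (coeff3 F i j k) * r ^ (i + j + k)) ` {F. F \<subseteq> UNIV \<and> finite F})"
    proof (rule bdd_aboveI, safe)
      fix A :: "(nat \<times> nat \<times> nat) set" assume A: "finite A"
      define N where "N = Max (insert 0 (fst ` A \<union> (fst \<circ> snd) ` A \<union> (snd \<circ> snd) ` A))"
      have sub: "A \<subseteq> {..N} \<times> {..N} \<times> {..N}"
        using A unfolding N_def by (force intro!: Max_ge)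
      have "sum (\<lambda>(i, j, k). norm (coeff3 F i j k) * r ^ (i + j + k)) A
          \<le> sum (\<lambda>(i, j, k). norm (coeff3 F i j k) * r ^ (i + j + k)) ({..N} \<times> {..N} \<times> {..N})"
        using r by (intro sum_mono2 sub) auto
      also have "\<dots> \<le> sum (\<lambda>(i, j, k). R * (1/2) ^ (i + j + k)) ({..N} \<times> {..N} \<times> {..N})"
        by (intro sum_mono) (auto simp: bd)
      also have "\<dots> = R * (\<Sum>a\<le>N. \<Sum>b\<le>N. \<Sum>d\<le>N. (1/2) ^ (a + b + d))"
        by (simp add: sum.cartesian_product[symmetric] sum_distrib_left)
      also have "\<dots> \<le> R * 8" using R by (intro mult_left_mono box_sum_geometric) auto
      finally show "sum (\<lambda>(i, j, k). norm (coeff3 F i j k) * r ^ (i + j + k)) A \<le> R * 8" .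
    qed
  qed (use r in auto)
  then show "F \<in> conv" using r by (auto simp: conv_def)
qed

lemma conv_geo2: 
  assumes "F \<in> conv" "G \<in> conv" obtains R where "geo R F" "geo R G"
proof -
  obtain R1 R2 where "geo R1 F" "geo R2 G" using assms by (auto simp: conv_iff_geo)
  then have "geo (max R1 R2) F" "geo (max R1 R2) G" by (auto elim: geo_mono)
  then show ?thesis by (rule that)
qed

lemma conv_add: assumes "F \<in> conv" "G \<in> conv" shows "F + G \<in> conv"
proof -
  obtain R where R: "geo R F" "geo R G" using assms by (rule conv_geo2)
  have "\<exists>R. geo R (F + G)"
  proof (rule geoI[of "2 * R" R])
    fix i j k
    have "norm (coeff3 (F + G) i j k) \<le> norm (coeff3 F i j k) + norm (coeff3 G i j k)"
      by (simp add: norm_triangle_ineq)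
    also have "\<dots> \<le> R ^ (i + j + k + 1) + R ^ (i + j + k + 1)"
      using R by (intro add_mono) (auto simp: geo_def)
    finally show "norm (coeff3 (F + G) i j k) \<le> 2 * R * R ^ (i + j + k)" by simp
  qed (use R in \<open>auto simp: geo_def\<close>)
  then show ?thesis by (simp add: conv_iff_geo)
qed

lemma Suc_le_two_power: "real (Suc n) \<le> 2 ^ n"
  using Suc_leI[OF less_exp[of n]] by (metis of_nat_le_iff of_nat_numeral of_nat_power)

lemma conv_mult: assumes "F \<in> conv" "G \<in> conv" shows "F * G \<in> conv"
proof -
  obtain R where R: "geo R F" "geo R G" using assms by (rule conv_geo2)
  then have R1: "1 \<le> R" by (simp add: geo_def)
  have "\<exists>R. geo R (F * G)"
  proof (rule geoI[of "R * R" "2 * R"])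
    fix i j k
    have "norm (coeff3 (F * G) i j k) \<le> (\<Sum>a\<le>i. \<Sum>b\<le>j. \<Sum>d\<le>k. R ^ (i + j + k + 2))"
      unfolding coeff3_mult
    proof (intro sum_norm_le)
      fix a b d assume *: "a \<in> {..i}" "b \<in> {..j}" "d \<in> {..k}"
      have "norm (coeff3 F a b d * coeff3 G (i - a) (j - b) (k - d)) \<le> 
         R ^ (a + b + d + 1) * R ^ ((i - a) + (j - b) + (k - d) + 1)"
        unfolding norm_mult using R R1 by (intro mult_mono) (auto simp: geo_def)
      also have "\<dots> = R ^ (i + j + k + 2)" using * by (simp flip: power_add add: numeral_2_eq_2)
      finally show "norm (coeff3 F a b d * coeff3 G (i - a) (j - b) (k - d)) \<le> R ^ (i + j + k + 2)" .
    qed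
    also have "\<dots> = real (Suc i) * real (Suc j) * real (Suc k) * R ^ (i + j + k + 2)"
      by (simp add: mult.assoc)
    also have "\<dots> \<le> 2 ^ i * 2 ^ j * 2 ^ k * R ^ (i + j + k + 2)"
      using R1 by (intro mult_right_mono mult_mono Suc_le_two_power) auto
    finally show "norm (coeff3 (F * G) i j k) \<le> R * R * (2 * R) ^ (i + j + k)"
      by (simp add: power_mult_distrib power_add power2_eq_square ac_simps)
  qed (use R1 in auto)
  then show ?thesis by (simp add: conv_iff_geo)
qed

lemma conv_finite_support:
  assumes "\<And>i j k. norm (coeff3 F i j k) \<le> 1" shows "F \<in> conv"
  unfolding conv_iff_geo by (rule geoI[of 1 1]) (use assms in auto)

lemma conv_cst: "cst a \<in> conv"
  unfolding conv_iff_geo by (rule geoI[of "norm a" 1]) (auto simp: coeff3_cst)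

lemma conv_X: "X \<in> conv" and conv_X1: "X1 \<in> conv" and conv_X2: "X2 \<in> conv" 
  and conv_0: "0 \<in> conv" and conv_1: "1 \<in> conv"
  by (auto intro!: conv_finite_support simp: coeff3_X coeff3_X1 coeff3_X2 coeff3_1)

lemma conv_minus: "F \<in> conv \<Longrightarrow> - F \<in> conv"
  by (auto simp: conv_iff_geo geo_def)

lemma conv_diff: "F \<in> conv \<Longrightarrow> G \<in> conv \<Longrightarrow> F - G \<in> conv"
  using conv_add[of F "- G"] conv_minus[of G] by simp

lemma conv_power: "F \<in> conv \<Longrightarrow> F ^ n \<in> conv"
  by (induction n) (auto intro: conv_1 conv_mult)

lemma conv_sum: "(\<And>a. a \<in> A \<Longrightarrow> f a \<in> conv) \<Longrightarrow> sum f A \<in> conv"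
  by (induction A rule: infinite_finite_induct) (auto intro: conv_0 conv_add)

lemma conv_gg: "gg \<in> conv"
  unfolding gg_def by (intro conv_diff conv_mult conv_X conv_X1 conv_X2)

lemma conv_deriv: assumes "F \<in> conv" shows "fps_deriv F \<in> conv"
proof -
  obtain R where R: "geo R F" using assms by (auto simp: conv_iff_geo)
  have "\<exists>R. geo R (fps_deriv F)"
  proof (rule geoI[of "R * R" "2 * R"])
    fix i j k
    have R1: "1 \<le> R" using R by (simp add: geo_def)
    have F: "norm (coeff3 F (Suc i) j k) \<le> R ^ (Suc i + j + k + 1)" using R unfolding geo_def by blast
    have "norm (coeff3 (fps_deriv F) i j k) = real (Suc i) * norm (coeff3 F (Suc i) j k)"
      by (simp add: norm_mult del: of_nat_Suc)
    also have "\<dots> \<le> 2 ^ (i + j + k) * R ^ (Suc i + j + k + 1)"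
    proof (intro mult_mono)
      have "(2::real) ^ i \<le> 2 ^ (i + j + k)" by (intro power_increasing) auto
      then show "real (Suc i) \<le> 2 ^ (i + j + k)" using Suc_le_two_power[of i] by linarith
    qed (use R1 F in auto)
    finally show "norm (coeff3 (fps_deriv F) i j k) \<le> R * R * (2 * R) ^ (i + j + k)"
      by (simp add: power_mult_distrib ac_simps)
  qed (use R in \<open>auto simp: geo_def\<close>)
  then show ?thesis by (simp add: conv_iff_geo)
qed

text \<open>The scale \<open>A\<close> is chosen so large that multiplication by \<open>h\<close> contracts by the factor \<open>\<epsilon>\<close>.\<close>

lemma mult_contracts:
  assumes h: "geo R h" "coeff3 h 0 0 0 = 0" and eps: "0 < \<epsilon>" "\<epsilon> \<le> 1" and A: "16 * R\<^sup>2 / \<epsilon> \<le> A"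
    and B: "0 \<le> B"
    and v: "\<And>a b d. a + b + d < i + j + k \<Longrightarrow> norm (coeff3 v a b d) \<le> B * A ^ (a + b + d + 1)"
  shows "norm (coeff3 (h * v) i j k) \<le> \<epsilon> * (B * A ^ (i + j + k + 1))"
proof -
  have R1: "1 \<le> R" using h by (simp add: geo_def)
  have "0 < 16 * R\<^sup>2 / \<epsilon>" using R1 eps by simp
  then have A0: "0 < A" using A by linarith
  define T where "T = B * A ^ (i + j + k + 1)"
  have T0: "0 \<le> T" using B A0 by (simp add: T_def)
  \<comment> \<open>A term with \<open>a + b + d = s + 1\<close> then gets at most
    \<open>\<epsilon> / 16 * (1/2) ^ s\<close>, that is
    \<open>\<epsilon> / 8 * (1/2) ^ (a + b + d)\<close>; the sum over the box costs at most
    8.\<close>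
  have RA: "R * (R / A) \<le> \<epsilon> / 16"
    using A A0 eps by (simp add: field_simps power2_eq_square)
  have RA2: "R / A \<le> 1 / 16"
  proof -
    have "R / A \<le> R * (R / A)" using R1 A0 by (simp add: field_simps)
    then show ?thesis using RA eps by linarith
  qed
  have "norm (coeff3 h a b d * coeff3 v (i - a) (j - b) (k - d)) \<le> \<epsilon> * T / 8 * (1/2) ^ (a + b + d)"
    if le: "a \<le> i" "b \<le> j" "d \<le> k" for a b d
  proof (cases "a + b + d = 0")
    case True then show ?thesis using h T0 eps by simp
  next
    case False
    then obtain s where s: "a + b + d = Suc s" by (cases "a + b + d") auto
    have m: "(i - a) + (j - b) + (k - d) + Suc s = i + j + k" using le s by simp
    have "norm (coeff3 h a b d * coeff3 v (i - a) (j - b) (k - d)) 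
        \<le> R ^ (a + b + d + 1) * (B * A ^ ((i - a) + (j - b) + (k - d) + 1))"
      unfolding norm_mult
      by (intro mult_mono v) (use h B A0 R1 m in \<open>auto simp: geo_def\<close>)
    also have "\<dots> = T * (R * (R / A)) * (R / A) ^ s"
    proof -
      have "A ^ (i + j + k + 1) = A ^ ((i - a) + (j - b) + (k - d) + 1) * A ^ Suc s"
        by (subst power_add[symmetric]) (simp flip: m)
      moreover have "a + b + d + 1 = Suc (Suc s)" using s by simp
      ultimately show ?thesis using A0 by (simp only: T_def) (simp add: power_divide field_simps)
    qed
    also have "\<dots> \<le> T * (\<epsilon> / 16) * (1 / 16) ^ s"
      using RA RA2 T0 R1 A0 eps by (intro mult_mono power_mono) auto
    also have "\<dots> \<le> T * (\<epsilon> / 16) * (1 / 2) ^ s"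
      using T0 eps by (intro mult_left_mono power_mono) auto
    finally show ?thesis unfolding s by (simp add: mult.commute[of T])
  qed
  then have "norm (coeff3 (h * v) i j k) \<le> (\<Sum>a\<le>i. \<Sum>b\<le>j. \<Sum>d\<le>k. \<epsilon> * T / 8 * (1/2) ^ (a + b + d))"
    unfolding coeff3_mult by (intro sum_norm_le) auto
  also have "\<dots> = \<epsilon> * T / 8 * (\<Sum>a\<le>i. \<Sum>b\<le>j. \<Sum>d\<le>k. (1/2) ^ (a + b + d))"
    by (simp add: sum_distrib_left)
  also have "\<dots> \<le> \<epsilon> * T / 8 * 8"
    using T0 eps by (intro mult_left_mono box_sum_geometric) auto
  finally show ?thesis by (simp add: T_def)
qed

text \<open>As \<open>h\<close> has no constant term, a coefficient of \<open>h * v\<close> involves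
  only coefficients of \<open>v\<close> of smaller total degree, and a geometric bound propagates by
  induction.\<close>

lemma conv_fixpoint:
  assumes e: "e \<in> conv" and h: "h \<in> conv" "coeff3 h 0 0 0 = 0" and v: "v = e + h * v"
  shows "v \<in> conv"
proof -
  obtain R where R: "geo R e" "geo R h" using e h(1) by (rule conv_geo2)
  then have R1: "1 \<le> R" by (simp add: geo_def)
  \<comment> \<open>The scale of \<open>mult_contracts\<close> for the factor 1/2; the other half of
    the bound is left to \<open>e\<close>.\<close>
  define A where "A = 32 * R\<^sup>2"
  have "1 * R \<le> R * R" using R1 by (intro mult_right_mono) auto
  then have "2 * R \<le> A" using R1 by (simp add: A_def power2_eq_square) 
  have "norm (coeff3 v i j k) \<le> 1 * A ^ (i + j + k + 1)" for i j k
  proof (induction "i + j + k" arbitrary: i j k rule: less_induct)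
    case less
    have "norm (coeff3 (h * v) i j k) \<le> 1/2 * (1 * A ^ (i + j + k + 1))"
      by (rule mult_contracts[OF R(2) h(2)]) (use less in \<open>auto simp: A_def\<close>)
    moreover have "norm (coeff3 e i j k) \<le> 1/2 * A ^ (i + j + k + 1)"
    proof -
      have "norm (coeff3 e i j k) \<le> R ^ (i + j + k + 1)" using R by (simp add: geo_def)
      also have "\<dots> \<le> 1/2 * (2 * R) ^ (i + j + k + 1)"
        using R1 by (simp add: power_mult_distrib) 
      also have "\<dots> \<le> 1/2 * A ^ (i + j + k + 1)" 
        using \<open>2 * R \<le> A\<close> R1 by (intro mult_left_mono power_mono) auto
      finally show ?thesis .
    qed
    moreover have "norm (coeff3 v i j k) \<le> norm (coeff3 e i j k) + norm (coeff3 (h * v) i j k)"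
      by (subst v) (simp add: norm_triangle_ineq)
    ultimately show ?case by linarith
  qed
  then show ?thesis unfolding conv_iff_geo
    using R1 by (intro geoI[of A A]) (auto simp: A_def)
qed

lemma conv_qsum_power:
  assumes h: "h \<in> conv" "h \<in> Fil 1" and K: "0 \<le> K" "\<And>n. norm (\<alpha> n) \<le> K ^ n"
  shows "qsum (\<lambda>n. cst (\<alpha> n) * h ^ n) \<in> conv"
proof -
  obtain R where R: "geo R h" using h by (auto simp: conv_iff_geo)
  have R1: "1 \<le> R" using R by (simp add: geo_def)
  \<comment> \<open>Small enough that \<open>K * \<epsilon>\<close> is at most 1/2, which makes the
    sum over \<open>n\<close> geometric.\<close>
  define \<epsilon> where "\<epsilon> = 1 / (2 * (K + 1))"
  have eps: "0 < \<epsilon>" "\<epsilon> \<le> 1" "K * \<epsilon> \<le> 1/2" using K by (simp_all add: \<epsilon>_def field_simps)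
  define A where "A = 16 * R\<^sup>2 / \<epsilon>"
  have h0: "coeff3 h 0 0 0 = 0" using h(2) by (rule ordgeD) simp
  have A1: "1 \<le> A"
  proof -
    have "1 \<le> R\<^sup>2" using R1 by (simp add: power2_eq_square) (metis mult_mono' mult_1 zero_le_one)
    then show ?thesis using eps by (simp add: A_def field_simps)
  qed
  have pow: "norm (coeff3 (h ^ n) i j k) \<le> \<epsilon> ^ n * A ^ (i + j + k + 1)" for n i j k
  proof (induction n arbitrary: i j k)
    case 0
    have "1 \<le> A ^ (i + j + k + 1)" by (rule one_le_power[OF A1])
    then show ?case using A1 by (auto simp: coeff3_1)
  next
    case (Suc n)
    then show ?case
      using mult_contracts[OF R h0 eps(1,2), of A "\<epsilon> ^ n" i j k "h ^ n"] eps A_def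
      by (simp add: mult.assoc)
  qed
  have F: "cst (\<alpha> n) * h ^ n \<in> Fil n" for n
    using ordge_power[OF h(2), of n] by (intro ordge_mult_left) simp
  have "norm (coeff3 (qsum (\<lambda>n. cst (\<alpha> n) * h ^ n)) i j k) \<le> (2 * A) * A ^ (i + j + k)" for i j k
  proof -
    have "norm (coeff3 (qsum (\<lambda>n. cst (\<alpha> n) * h ^ n)) i j k) \<le> (\<Sum>n\<le>j + k. A ^ (i + j + k + 1) * (1/2) ^ n)"
      unfolding qsum_def coeff3_mk3
    proof (intro sum_norm_le)
      fix n
      have "norm (coeff3 (cst (\<alpha> n) * h ^ n) i j k) \<le> K ^ n * (\<epsilon> ^ n * A ^ (i + j + k + 1))"
        unfolding coeff3_cst_mult norm_mult using K pow by (intro mult_mono) auto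
      also have "\<dots> = A ^ (i + j + k + 1) * (K * \<epsilon>) ^ n" by (simp add: power_mult_distrib)
      also have "\<dots> \<le> A ^ (i + j + k + 1) * (1/2) ^ n"
        using A1 K eps by (intro mult_left_mono power_mono) auto
      finally show "norm (coeff3 (cst (\<alpha> n) * h ^ n) i j k) \<le> A ^ (i + j + k + 1) * (1/2) ^ n" .
    qed
    also have "\<dots> = A ^ (i + j + k + 1) * (\<Sum>n\<le>j + k. (1/2) ^ n)" by (simp add: sum_distrib_left)
    also have "\<dots> \<le> A ^ (i + j + k + 1) * 2"
    proof (intro mult_left_mono)
      show "(\<Sum>n\<le>j + k. (1/2::real) ^ n) \<le> 2"
        by (subst atMost_atLeast0, subst sum_gp) (auto simp: field_simps)
    qed (use A1 in auto)
    finally show ?thesis by simp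
  qed
  then show ?thesis unfolding conv_iff_geo using A1 by (intro geoI[of "2 * A" A]) auto
qed

text \<open>The inverse is the Neumann series in \<open>1 - u\<close>.\<close>

lemma conv_unitI:
  assumes u: "u \<in> conv" "u - 1 \<in> Fil 1" shows "u \<in> conv_units"
proof -
  define h where "h = 1 - u"
  have hF: "h \<in> Fil 1" using ordge_minus[OF u(2)] by (simp add: h_def)
  have hc: "h \<in> conv" using u by (simp add: h_def conv_diff conv_1)
  define v where "v = qsum (\<lambda>n. cst 1 * h ^ n)"
  have "v \<in> conv" unfolding v_def by (rule conv_qsum_power[OF hc hF, of 1]) auto
  have F: "h ^ n \<in> Fil n" for n using ordge_power[OF hF, of n] by simp
  have "v = 1 + h * v"
    unfolding v_def cst_1 mult_1 
    by (subst qsum_Suc[OF F]) (simp add: qsum_mult_left[OF F])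
  then have "u * v = 1" by (simp add: h_def algebra_simps)
  then show ?thesis using \<open>v \<in> conv\<close> u by (auto simp: conv_units_def)
qed


subsection \<open>Restriction to the surface\<close>

text \<open>The coefficient of \<open>x^p * x1^q\<close> after the substitution
  \<open>x2 = x * x1\<close>, under which \<open>x^(p-k) * x1^(q-k) * x2^k\<close> becomes
  \<open>x^p * x1^q\<close>.\<close>

definition surf_coeff :: "nat \<Rightarrow> nat \<Rightarrow> ser \<Rightarrow> complex" where
  "surf_coeff p q F = (\<Sum>k\<le>min p q. coeff3 F (p - k) (q - k) k)"

text \<open>\<open>rho F = F(x, x1, x * x1)\<close>\<close>

definition rho :: "ser \<Rightarrow> ser" where
  "rho F = mk3 (\<lambda>p q k. if k = 0 then surf_coeff p q F else 0)"

lemma coeff3_rho: "coeff3 (rho F) p q k = (if k = 0 then surf_coeff p q F else 0)"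
  by (simp add: rho_def)

lemma surf_coeff_add: "surf_coeff p q (F + G) = surf_coeff p q F + surf_coeff p q G"
  and surf_coeff_diff: "surf_coeff p q (F - G) = surf_coeff p q F - surf_coeff p q G"
  and surf_coeff_cst_mult: "surf_coeff p q (cst a * F) = a * surf_coeff p q F"
  by (simp_all add: surf_coeff_def sum.distrib sum_subtractf sum_distrib_left)

lemma surf_coeff_sum: "surf_coeff p q (sum f A) = (\<Sum>a\<in>A. surf_coeff p q (f a))"
  unfolding surf_coeff_def coeff3_sum by (rule sum.swap)

lemma surf_coeff_Fil: "F \<in> Fil (Suc q) \<Longrightarrow> surf_coeff p q F = 0"
  unfolding surf_coeff_def by (intro sum.neutral ballI ordgeD) auto

lemma rho_add: "rho (F + G) = rho F + rho G"
  and rho_diff: "rho (F - G) = rho F - rho G"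
  by (rule coeff3_ext; simp add: coeff3_rho surf_coeff_add surf_coeff_diff)+

lemma rho_0 [simp]: "rho 0 = 0"
  using rho_add[of 0 0] by simp

lemma rho_sum: "rho (sum f A) = (\<Sum>a\<in>A. rho (f a))"
  by (induction A rule: infinite_finite_induct) (auto simp: rho_add)

lemma surf_coeff_mult: "surf_coeff p q (F * G) = (\<Sum>a\<le>p. \<Sum>b\<le>q. surf_coeff a b F * surf_coeff (p - a) (q - b) G)"
proof -
  let ?t = "\<lambda>a b d a' b' d'. coeff3 F a b d * coeff3 G a' b' d'"
  have "surf_coeff p q (F * G) = (\<Sum>(k, a, b, d)\<in>(SIGMA k:{..min p q}. SIGMA a:{..p - k}. SIGMA b:{..q - k}. {..k}).
      ?t a b d (p - k - a) (q - k - b) (k - d))"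
    by (simp add: surf_coeff_def coeff3_mult sum.Sigma)
  also have "\<dots> = (\<Sum>(a, b, d, e)\<in>(SIGMA a:{..p}. SIGMA b:{..q}. SIGMA d:{..min a b}. {..min (p - a) (q - b)}).
      ?t (a - d) (b - d) d (p - a - e) (q - b - e) e)"
    \<comment> \<open>On the right \<open>a\<close> and \<open>b\<close> are the exponents of the
      first factor on the surface, and \<open>d\<close>, \<open>e\<close> the exponents of
      \<open>x2\<close> in the two factors.\<close>
    by (rule sum.reindex_bij_witness[where j = "\<lambda>(k, a, b, d). (a + d, b + d, d, k - d)"
          and i = "\<lambda>(a, b, d, e). (d + e, a - d, b - d, d)"]) 
       (auto simp: add.commute)
  also have "\<dots> = (\<Sum>a\<le>p. \<Sum>b\<le>q. surf_coeff a b F * surf_coeff (p - a) (q - b) G)"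
    by (simp add: surf_coeff_def sum_product sum.Sigma)
  finally show ?thesis .
qed

lemma rho_mult: "rho (F * G) = rho F * rho G"
  by (rule coeff3_ext) (auto simp: coeff3_mult coeff3_rho surf_coeff_mult intro!: sum.neutral)

lemma surf_coeff_single: "(\<And>k. 0 < k \<Longrightarrow> k \<le> min p q \<Longrightarrow> coeff3 F (p - k) (q - k) k = 0) \<Longrightarrow> surf_coeff p q F = coeff3 F p q 0"
proof -
  assume "\<And>k. 0 < k \<Longrightarrow> k \<le> min p q \<Longrightarrow> coeff3 F (p - k) (q - k) k = 0"
  then have "surf_coeff p q F = (\<Sum>k\<in>{0}. coeff3 F (p - k) (q - k) k)"
    unfolding surf_coeff_def by (intro sum.mono_neutral_right) auto
  then show ?thesis by simp
qed

lemma rho_const: "rho (cst a) = cst a"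
  by (rule coeff3_ext; subst coeff3_rho, subst surf_coeff_single; auto simp: coeff3_cst)

lemma rho_1 [simp]: "rho 1 = 1"
  using rho_const[of 1] by simp

lemma rho_power: "rho (F ^ n) = rho F ^ n"
  by (induction n) (auto simp: rho_mult)

lemma rho_X1: "rho X1 = X1" and rho_X: "rho X = X"
  by (rule coeff3_ext; subst coeff3_rho, subst surf_coeff_single; auto simp: coeff3_X1 coeff3_X)+

lemma rho_X2: "rho X2 = X * X1"
proof (rule coeff3_ext)
  fix i j k
  have "surf_coeff i j X2 = (\<Sum>n\<le>min i j. if n = 1 then coeff3 X2 (i - 1) (j - 1) 1 else 0)"
    unfolding surf_coeff_def by (intro sum.cong) (auto simp: coeff3_X2)
  then show "coeff3 (rho X2) i j k = coeff3 (X * X1) i j k"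
    by (auto simp: coeff3_rho coeff3_X_mult coeff3_X1 coeff3_X2)
qed

lemma rho_gg [simp]: "rho gg = 0"
  by (simp add: gg_def rho_diff rho_mult rho_X rho_X1 rho_X2)

lemma rho_Fil: "F \<in> Fil n \<Longrightarrow> rho F \<in> Fil n"
proof (rule ordgeI)
  fix i j k assume F: "F \<in> Fil n" and lt: "0 * i + Suc 0 * j + Suc 0 * k < n"
  then show "coeff3 (rho F) i j k = 0"
    using surf_coeff_Fil[of F j i] ordge_mono[OF F, of "Suc j"] by (auto simp: coeff3_rho)
qed

lemma rho_qsum: "(\<And>n. f n \<in> Fil n) \<Longrightarrow> rho (qsum f) = qsum (\<lambda>n. rho (f n))"
  by (rule qsum_map) (auto simp: rho_add rho_Fil)

lemma conv_rho: assumes "F \<in> conv" shows "rho F \<in> conv"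
proof -
  obtain R where R: "geo R F" using assms by (auto simp: conv_iff_geo)
  then have R1: "1 \<le> R" by (simp add: geo_def)
  have "\<exists>R. geo R (rho F)"
  proof (rule geoI[of R "2 * R"])
    fix i j k
    have "norm (surf_coeff i j F) \<le> (\<Sum>m\<le>min i j. R ^ (i + j + 1))"
      unfolding surf_coeff_def
    proof (intro sum_norm_le)
      fix m assume "m \<in> {..min i j}"
      have "norm (coeff3 F (i - m) (j - m) m) \<le> R ^ ((i - m) + (j - m) + m + 1)"
        using R by (simp add: geo_def)
      also have "\<dots> \<le> R ^ (i + j + 1)" using R1 \<open>m \<in> _\<close> by (intro power_increasing) auto
      finally show "norm (coeff3 F (i - m) (j - m) m) \<le> R ^ (i + j + 1)" .
    qed
    also have "\<dots> = real (Suc (min i j)) * R ^ (i + j + 1)" by simp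
    also have "\<dots> \<le> 2 ^ (i + j) * R ^ (i + j + 1)"
    proof (intro mult_right_mono)
      have "(2::real) ^ min i j \<le> 2 ^ (i + j)" by (intro power_increasing) auto
      then show "real (Suc (min i j)) \<le> 2 ^ (i + j)" using Suc_le_two_power[of "min i j"] by linarith
    qed (use R1 in auto)
    finally show "norm (coeff3 (rho F) i j k) \<le> R * (2 * R) ^ (i + j + k)"
      using R1 by (auto simp: coeff3_rho power_mult_distrib ac_simps)
  qed (use R1 in auto)
  then show ?thesis by (simp add: conv_iff_geo)
qed

subsection \<open>Vanishing order along the surface\<close>

text \<open>The derivative in \<open>x2\<close>. It is transversal to the surface everywhere, as
  \<open>d2 gg = 1\<close>, whereas the derivative of \<open>gg\<close> in \<open>x\<close> is
  \<open>- X1\<close>.\<close>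

definition d2 :: "ser \<Rightarrow> ser" where
  "d2 F = Abs_fps (\<lambda>i. Abs_fps (\<lambda>j. fps_deriv (fps_nth (fps_nth F i) j)))"

lemma coeff3_d2: "coeff3 (d2 F) i j k = of_nat (Suc k) * coeff3 F i j (Suc k)"
  by (simp add: coeff3_def d2_def)

lemma d2_add: "d2 (F + G) = d2 F + d2 G"
  by (rule coeff3_ext) (simp add: coeff3_d2 algebra_simps)

lemma d2_mult: "d2 (F * G) = d2 F * G + F * d2 G"
  by (rule fps_ext, rule fps_ext) 
     (simp add: d2_def fps_mult_nth fps_sum_nth fps_deriv_sum sum.distrib)

lemma d2n_add: "(d2 ^^ n) (F + G) = (d2 ^^ n) F + (d2 ^^ n) G"
  by (induction n) (auto simp: d2_add)

lemma coeff3_d2n: "coeff3 ((d2 ^^ n) F) i j k = fact (k + n) / fact k * coeff3 F i j (k + n)"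
proof (induction n arbitrary: k)
  case (Suc n)
  have "(of_nat (Suc k) :: complex) \<noteq> 0" by (simp only: of_nat_eq_0_iff)
  then show ?case using Suc[of "Suc k"] by (simp add: coeff3_d2 fact_Suc del: of_nat_Suc)
qed simp

lemma d2_gg: "d2 gg = 1"
  by (rule coeff3_ext) (simp add: coeff3_d2 gg_def coeff3_X2 coeff3_X_mult coeff3_X1 coeff3_1)

lemma d2_X: "(d2 ^^ Suc n) X = 0"
  by (rule coeff3_ext) (simp add: coeff3_d2n coeff3_X del: funpow.simps)

text \<open>Series vanishing to order \<open>m\<close> on \<open>gg = 0\<close>.\<close>

definition Kord :: "nat \<Rightarrow> ser set" where
  "Kord m = {F. \<forall>i<m. rho ((d2 ^^ i) F) = 0}"

lemma Kord_mono: "F \<in> Kord n \<Longrightarrow> m \<le> n \<Longrightarrow> F \<in> Kord m"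
  by (auto simp: Kord_def)

lemma Kord_add: "F \<in> Kord n \<Longrightarrow> G \<in> Kord n \<Longrightarrow> F + G \<in> Kord n"
  by (auto simp: Kord_def d2n_add rho_add)

text \<open>In each Leibniz term of order below \<open>m + n\<close>, one factor is differentiated
  less often than its own vanishing order.\<close>

lemma Kord_mult: assumes "F \<in> Kord m" "G \<in> Kord n" shows "F * G \<in> Kord (m + n)"
proof -
  have "rho ((d2 ^^ i) (F * G)) = 0" if "i < m + n" for i
  proof -
    have "rho (of_nat (i choose k) * ((d2 ^^ k) F * (d2 ^^ (i - k)) G)) = 0" if "k \<le> i" for k
      using that \<open>i < m + n\<close> assms by (cases "k < m") (auto simp: rho_mult Kord_def)
    then show ?thesis
      by (subst leibniz_power[OF d2_add d2_mult]) (simp add: rho_sum)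
  qed
  then show ?thesis by (simp add: Kord_def)
qed

lemma Kord_0 [simp]: "Kord 0 = UNIV"
  by (simp add: Kord_def)

lemma zero_Kord: "0 \<in> Kord n"
proof -
  have "(d2 ^^ i) 0 = 0" for i by (rule coeff3_ext) (simp add: coeff3_d2n)
  then show ?thesis by (simp add: Kord_def)
qed

lemma Kord_sum: "(\<And>a. a \<in> A \<Longrightarrow> f a \<in> Kord n) \<Longrightarrow> sum f A \<in> Kord n"
  by (induction A rule: infinite_finite_induct) (auto intro: zero_Kord Kord_add)

text \<open>A derivative that misses one of the \<open>n\<close> factors \<open>gg\<close> dies on
  the surface; the remaining terms are counted by \<open>fact n\<close>.\<close>

lemma rho_d2n_gg_power: "rho ((d2 ^^ n) (gg ^ n * b)) = cst (fact n) * rho b"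
proof (induction n arbitrary: b)
  case (Suc n)
  have d2_of_nat: "d2 (gg ^ Suc n) = of_nat (Suc n) * gg ^ n" for n
    by (induction n) (simp_all add: d2_mult d2_gg algebra_simps)
  have "d2 (gg ^ Suc n * b) = gg ^ n * (of_nat (Suc n) * b + gg * d2 b)"
    unfolding d2_mult d2_of_nat by (simp add: algebra_simps)
  then have "(d2 ^^ Suc n) (gg ^ Suc n * b) = (d2 ^^ n) (gg ^ n * (of_nat (Suc n) * b + gg * d2 b))"
    by (simp only: funpow_Suc_right o_def)
  then have "rho ((d2 ^^ Suc n) (gg ^ Suc n * b)) = cst (fact n) * rho (cst (of_nat (Suc n)) * b + gg * d2 b)"
    unfolding cst_of_nat by (simp only: Suc.IH)
  also have "\<dots> = cst (fact n * of_nat (Suc n)) * rho b"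
    by (simp add: rho_add rho_mult rho_const cst_mult mult.assoc del: of_nat_Suc)
  finally show ?case by (simp add: mult.commute)
qed simp

lemma module_times: "module ((*) :: ser \<Rightarrow> ser \<Rightarrow> ser)"
  by unfold_locales (simp_all add: algebra_simps)

lemma Kord_subspace: "module.subspace ((*) :: ser \<Rightarrow> ser \<Rightarrow> ser) (Kord n)"
  unfolding module.subspace_def[OF module_times]
  using zero_Kord Kord_add Kord_mult[of _ 0 _ n] by auto

lemma ideal_gen_Kord: "A \<subseteq> Kord n \<Longrightarrow> ideal_gen A \<subseteq> Kord n"
  unfolding ideal_gen_def by (rule module.span_minimal[OF module_times _ Kord_subspace])

lemma ideal_power_Kord: "I \<subseteq> Kord 1 \<Longrightarrow> ideal_power I k \<subseteq> Kord k"
proof (induction k)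
  case (Suc k)
  have "{a * b | a b. a \<in> I \<and> b \<in> ideal_power I k} \<subseteq> Kord (Suc k)"
    using Kord_mult[of _ 1 _ k] Suc by auto
  then show ?case by (simp add: ideal_gen_Kord)
qed simp

lemma conv_d2: assumes "F \<in> conv" shows "d2 F \<in> conv"
proof -
  obtain R where R: "geo R F" using assms by (auto simp: conv_iff_geo)
  have "\<exists>R. geo R (d2 F)"
  proof (rule geoI[of "R * R" "2 * R"])
    fix i j k
    have R1: "1 \<le> R" using R by (simp add: geo_def)
    have F: "norm (coeff3 F i j (Suc k)) \<le> R ^ (i + j + Suc k + 1)" using R unfolding geo_def by blast
    have "norm (coeff3 (d2 F) i j k) = real (Suc k) * norm (coeff3 F i j (Suc k))"
      by (simp add: coeff3_d2 norm_mult del: of_nat_Suc)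
    also have "\<dots> \<le> 2 ^ (i + j + k) * R ^ (i + j + Suc k + 1)"
    proof (intro mult_mono)
      have "(2::real) ^ k \<le> 2 ^ (i + j + k)" by (intro power_increasing) auto
      then show "real (Suc k) \<le> 2 ^ (i + j + k)" using Suc_le_two_power[of k] by linarith
    qed (use R1 F in auto)
    finally show "norm (coeff3 (d2 F) i j k) \<le> R * R * (2 * R) ^ (i + j + k)"
      by (simp add: power_mult_distrib ac_simps)
  qed (use R in \<open>auto simp: geo_def\<close>)
  then show ?thesis by (simp add: conv_iff_geo)
qed

lemma conv_d2n: "F \<in> conv \<Longrightarrow> (d2 ^^ n) F \<in> conv"
  by (induction n) (auto intro: conv_d2)

text \<open>The terms beyond index \<open>n\<close> vanish to order \<open>n + 1\<close> on the
  surface, so the \<open>n\<close>-th transversal derivative is that of a finite sum of convergent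
  germs. Krull convergence suffices because each surface coefficient involves finitely many
  coefficients.\<close>

lemma transversally_formal_jet:
  assumes I: "formal_vanishing_ideal (zero_set {f}) \<subseteq> Kord 1" and S: "transversally_formal_ser f S"
  shows "rho ((d2 ^^ n) S) \<in> conv"
proof -
  obtain s where s: "krull_sums s S" 
    and sk: "\<And>k. s k \<in> conv" "\<And>k. s k \<in> ideal_power (formal_vanishing_ideal (zero_set {f})) k"
    using S by (auto simp: transversally_formal_ser_def)
  have sK: "s k \<in> Kord k" for k using sk(2) ideal_power_Kord[OF I] by blast
  define Q where "Q = (\<Sum>m\<le>n. s m)"
  have Qc: "Q \<in> conv" unfolding Q_def by (intro conv_sum sk)
  have "surf_coeff p q ((d2 ^^ n) S) = surf_coeff p q ((d2 ^^ n) Q)" for p q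
  proof -
    have "\<forall>\<^sub>F N in sequentially. \<forall>k\<in>{..min p q}. coeff3 (\<Sum>m<N. s m) (p - k) (q - k) (k + n) = coeff3 S (p - k) (q - k) (k + n)"
      using s by (intro eventually_ball_finite finite_atMost ballI) (simp only: krull_sums_def)
    then have "\<forall>\<^sub>F N in sequentially. N \<ge> Suc n \<and> (\<forall>k\<in>{..min p q}. coeff3 (\<Sum>m<N. s m) (p - k) (q - k) (k + n) = coeff3 S (p - k) (q - k) (k + n))"
      by (intro eventually_conj eventually_ge_at_top)
    then obtain N where N: "N \<ge> Suc n" "\<And>k. k \<le> min p q \<Longrightarrow> coeff3 (\<Sum>m<N. s m) (p - k) (q - k) (k + n) = coeff3 S (p - k) (q - k) (k + n)"
      using eventually_happens'[OF sequentially_bot] by (metis (mono_tags, lifting) atMost_iff)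
    have "(\<Sum>m\<in>{Suc n..<N}. s m) \<in> Kord (Suc n)"
      by (intro Kord_sum) (auto intro: Kord_mono[OF sK])
    then have r0: "rho ((d2 ^^ n) (\<Sum>m\<in>{Suc n..<N}. s m)) = 0" by (simp add: Kord_def)
    have "{..<N} = {..n} \<union> {Suc n..<N}" using N(1) by auto
    moreover have "sum s ({..n} \<union> {Suc n..<N}) = sum s {..n} + sum s {Suc n..<N}"
      by (rule sum.union_disjoint) auto
    ultimately have "(\<Sum>m<N. s m) = Q + (\<Sum>m\<in>{Suc n..<N}. s m)"
      unfolding Q_def by simp
    then have "rho ((d2 ^^ n) (\<Sum>m<N. s m)) = rho ((d2 ^^ n) Q)"
      using r0 by (simp add: d2n_add rho_add)
    then have "surf_coeff p q ((d2 ^^ n) (\<Sum>m<N. s m)) = surf_coeff p q ((d2 ^^ n) Q)"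
      by (metis coeff3_rho)
    moreover have "surf_coeff p q ((d2 ^^ n) (\<Sum>m<N. s m)) = surf_coeff p q ((d2 ^^ n) S)"
      unfolding surf_coeff_def by (intro sum.cong) (auto simp: coeff3_d2n N(2) simp del: coeff3_sum)
    ultimately show ?thesis by simp
  qed
  then have "rho ((d2 ^^ n) S) = rho ((d2 ^^ n) Q)"
    by (intro coeff3_ext) (simp add: coeff3_rho)
  then show ?thesis using conv_rho[OF conv_d2n[OF Qc]] by simp
qed


subsection \<open>Vanishing on the surface\<close>

lemma power_series_zero:
  fixes d :: "nat \<Rightarrow> complex"
  assumes "0 < \<epsilon>" and s: "\<And>z. norm z \<le> \<epsilon> \<Longrightarrow> (\<lambda>n. d n * z ^ n) summable_on UNIV"
    and z: "\<And>z. norm z \<le> \<epsilon> \<Longrightarrow> infsum (\<lambda>n. d n * z ^ n) UNIV = 0"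
  shows "d n = 0"
proof -
  have "summable (\<lambda>n. d n * of_real \<epsilon> ^ n)"
    by (intro summable_on_imp_summable s) (use assms(1) in simp)
  then have "ereal (norm (of_real \<epsilon> :: complex)) \<le> conv_radius d" by (rule conv_radius_geI)
  moreover have "(0::ereal) < ereal (norm (of_real \<epsilon> :: complex))" using assms(1) by simp
  ultimately have "0 < conv_radius d" by (rule less_le_trans[rotated])
  moreover have "fps_nth (Abs_fps d) = d" by (simp add: fun_eq_iff)
  ultimately have r: "0 < fps_conv_radius (Abs_fps d)" by (simp add: fps_conv_radius_def)
  have "Abs_fps d = 0"
  proof (rule eval_fps_eqD[OF r])
    have "eval_fps (Abs_fps d) z = eval_fps 0 z" if "norm z \<le> \<epsilon>" for z
    proof -
      have "(\<lambda>n. d n * z ^ n) sums infsum (\<lambda>n. d n * z ^ n) UNIV"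
        by (rule has_sum_imp_sums[OF has_sum_infsum[OF s[OF that]]])
      then show ?thesis using z[OF that] by (simp add: eval_fps_def sums_iff)
    qed
    then show "\<forall>\<^sub>F z in nhds 0. eval_fps (Abs_fps d) z = eval_fps 0 z"
      unfolding eventually_nhds_metric using assms(1) by (intro exI[of _ \<epsilon>]) auto
  qed simp
  then have "fps_nth (Abs_fps d) n = fps_nth 0 n" by simp
  then show ?thesis by simp
qed

lemma eval3_surface:
  assumes "F \<in> conv"
  obtains \<epsilon> where "0 < \<epsilon>" 
    "\<And>a b. norm a \<le> \<epsilon> \<Longrightarrow> norm b \<le> \<epsilon> \<Longrightarrow> (\<lambda>(p, q). surf_coeff p q F * a ^ p * b ^ q) summable_on UNIV"
    "\<And>a b. norm a \<le> \<epsilon> \<Longrightarrow> norm b \<le> \<epsilon> \<Longrightarrow> 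
        eval3 F (a, b, a * b) = infsum (\<lambda>(p, q). surf_coeff p q F * a ^ p * b ^ q) UNIV"
proof -
  obtain r where r: "r > 0" 
    and s: "(\<lambda>(i, j, k). norm (coeff3 F i j k) * r ^ (i + j + k)) summable_on UNIV"
    using assms by (auto simp: conv_def)
  \<comment> \<open>The bound 1 keeps the third coordinate \<open>a * b\<close> in the disc of
    radius \<open>r\<close>.\<close>
  define \<epsilon> where "\<epsilon> = min r 1"
  have main: "(\<lambda>(p, q). surf_coeff p q F * a ^ p * b ^ q) summable_on UNIV \<and>
        eval3 F (a, b, a * b) = infsum (\<lambda>(p, q). surf_coeff p q F * a ^ p * b ^ q) UNIV" 
    if ab: "norm a \<le> \<epsilon>" "norm b \<le> \<epsilon>" for a b
  proof -
    define f where "f = (\<lambda>(i, j, k). coeff3 F i j k * a ^ i * b ^ j * (a * b) ^ k)"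
    have abr: "norm (a * b) \<le> r"
    proof -
      have "norm a * norm b \<le> r * 1" using ab r by (intro mult_mono) (auto simp: \<epsilon>_def)
      then show ?thesis by (simp add: norm_mult)
    qed
    have le: "norm (f x) \<le> (case x of (i, j, k) \<Rightarrow> norm (coeff3 F i j k) * r ^ (i + j + k))" for x
    proof -
      obtain i j k where x: "x = (i, j, k)" by (cases x) auto
      have "norm (f x) = norm (coeff3 F i j k) * (norm a ^ i * norm b ^ j * norm (a * b) ^ k)"
        by (simp add: f_def x norm_mult norm_power)
      also have "\<dots> \<le> norm (coeff3 F i j k) * (r ^ i * r ^ j * r ^ k)"
        using ab abr r by (intro mult_left_mono mult_mono power_mono) (auto simp: \<epsilon>_def)
      finally show ?thesis by (simp add: x power_add)
    qed
    have fs: "f summable_on UNIV"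
      by (rule abs_summable_summable, rule Infinite_Sum.abs_summable_on_comparison_test'[OF s], rule le)
    define A where "A = (SIGMA pq:(UNIV :: (nat \<times> nat) set). {..min (fst pq) (snd pq)})"
    define g where "g = (\<lambda>(pq :: nat \<times> nat, k :: nat). (fst pq - k, snd pq - k, k))"
    have bij: "bij_betw g A UNIV"
      by (rule bij_betw_byWitness[where f' = "\<lambda>(i, j, k). ((i + k, j + k), k)"]) (auto simp: A_def g_def)
    define h where "h pq k = f (g (pq, k))" for pq k
    have hf: "(\<lambda>(pq, k). h pq k) = (\<lambda>x. f (g x))" by (auto simp: h_def)
    have gs: "(\<lambda>(pq, k). h pq k) summable_on A"
      unfolding hf using summable_on_reindex_bij_betw[OF bij, of f] fs by simp
    have inner: "infsum (h pq) {..min (fst pq) (snd pq)} = 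
        (case pq of (p, q) \<Rightarrow> surf_coeff p q F * a ^ p * b ^ q)" for pq
    proof -
      obtain p q where pq: "pq = (p, q)" by (cases pq)
      have "f (g (pq, k)) = coeff3 F (p - k) (q - k) k * (a ^ p * b ^ q)" if "k \<le> min p q" for k
      proof -
        have "a ^ p = a ^ (p - k) * a ^ k" "b ^ q = b ^ (q - k) * b ^ k"
          using that by (simp_all flip: power_add)
        then show ?thesis by (simp add: f_def g_def pq power_mult_distrib ac_simps)
      qed
      then have "(\<Sum>k\<le>min p q. f (g (pq, k))) = (\<Sum>k\<le>min p q. coeff3 F (p - k) (q - k) k * (a ^ p * b ^ q))"
        by (intro sum.cong) auto
      then show ?thesis by (simp add: pq h_def surf_coeff_def sum_distrib_right mult.assoc)
    qed
    have "(\<lambda>pq. infsum (h pq) {..min (fst pq) (snd pq)}) summable_on UNIV"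
      using gs unfolding A_def by (rule summable_on_Sigma_banach)
    then have 1: "(\<lambda>(p, q). surf_coeff p q F * a ^ p * b ^ q) summable_on UNIV"
      unfolding inner .
    have "eval3 F (a, b, a * b) = infsum f UNIV"
      by (simp add: eval3_def f_def)
    also have "\<dots> = infsum (\<lambda>(pq, k). h pq k) A"
      unfolding hf by (rule infsum_reindex_bij_betw[OF bij, symmetric])
    also have "\<dots> = infsum (\<lambda>pq. infsum (h pq) {..min (fst pq) (snd pq)}) UNIV"
      using gs unfolding A_def by (rule infsum_Sigma'_banach[symmetric])
    finally show ?thesis using 1 unfolding inner by simp
  qed
  show ?thesis
  proof (rule that[of \<epsilon>])
    show "0 < \<epsilon>" using r by (simp add: \<epsilon>_def)
  qed (use main in blast)+
qed

lemma rho_zero_eval3: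
  assumes "F \<in> conv" "rho F = 0"
  obtains \<epsilon> where "0 < \<epsilon>" "\<And>a b. norm a \<le> \<epsilon> \<Longrightarrow> norm b \<le> \<epsilon> \<Longrightarrow> eval3 F (a, b, a * b) = 0"
proof -
  obtain \<epsilon> where e: "0 < \<epsilon>" "\<And>a b. norm a \<le> \<epsilon> \<Longrightarrow> norm b \<le> \<epsilon> \<Longrightarrow> 
        eval3 F (a, b, a * b) = infsum (\<lambda>(p, q). surf_coeff p q F * a ^ p * b ^ q) UNIV"
    by (rule eval3_surface[OF assms(1)]) (rule that)
  have "surf_coeff p q F = 0" for p q using coeff3_rho[of F p q 0] assms(2) by simp
  then have "(\<lambda>(p, q). surf_coeff p q F * a ^ p * b ^ q) = (\<lambda>_. 0)" for a b by auto
  then show ?thesis using that[OF e(1)] e(2) by simp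
qed

text \<open>The identity theorem in two variables, by two uses of the one-variable one: first in
  \<open>a\<close> for fixed \<open>b\<close>, then in \<open>b\<close>.\<close>

lemma eval3_zero_rho:
  assumes F: "F \<in> conv" and "0 < \<delta>" 
    and z: "\<And>a b. norm a < \<delta> \<Longrightarrow> norm b < \<delta> \<Longrightarrow> eval3 F (a, b, a * b) = 0"
  shows "rho F = 0"
proof -
  obtain \<epsilon>0 where e0: "0 < \<epsilon>0" 
    "\<And>a b. norm a \<le> \<epsilon>0 \<Longrightarrow> norm b \<le> \<epsilon>0 \<Longrightarrow> (\<lambda>(p, q). surf_coeff p q F * a ^ p * b ^ q) summable_on UNIV"
    "\<And>a b. norm a \<le> \<epsilon>0 \<Longrightarrow> norm b \<le> \<epsilon>0 \<Longrightarrow> 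
        eval3 F (a, b, a * b) = infsum (\<lambda>(p, q). surf_coeff p q F * a ^ p * b ^ q) UNIV"
    by (rule eval3_surface[OF F]) (rule that)
  define \<epsilon> where "\<epsilon> = min \<epsilon>0 (\<delta> / 2)"
  have e: "0 < \<epsilon>" "\<epsilon> \<le> \<epsilon>0" "\<epsilon> < \<delta>" using e0(1) \<open>0 < \<delta>\<close> by (auto simp: \<epsilon>_def)
  have s: "(\<lambda>(p, q). surf_coeff p q F * a ^ p * b ^ q) summable_on (UNIV \<times> UNIV)" 
    if "norm a \<le> \<epsilon>" "norm b \<le> \<epsilon>" for a b
    using e0(2)[of a b] that e by simp
  have sumq: "(\<lambda>q. surf_coeff p q F * b ^ q) summable_on UNIV" if "norm b \<le> \<epsilon>" for p b
  proof -
    have "(\<lambda>q. surf_coeff p q F * of_real \<epsilon> ^ p * b ^ q) summable_on UNIV"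
      using summable_on_SigmaD1[OF s[of "of_real \<epsilon>" b], of p] e that by simp
    then have "(\<lambda>q. of_real (1 / \<epsilon> ^ p) * (surf_coeff p q F * of_real \<epsilon> ^ p * b ^ q)) summable_on UNIV"
      by (rule summable_on_cmult_right)
    moreover have "of_real (1 / \<epsilon> ^ p) * (surf_coeff p q F * of_real \<epsilon> ^ p * b ^ q) = surf_coeff p q F * b ^ q" for q
      using e by simp
    ultimately show ?thesis by simp
  qed
  define C where "C p b = infsum (\<lambda>q. surf_coeff p q F * b ^ q) UNIV" for p b
  have inner: "infsum (\<lambda>q. surf_coeff p q F * a ^ p * b ^ q) UNIV = C p b * a ^ p" for p a b
  proof -
    have "infsum (\<lambda>q. surf_coeff p q F * a ^ p * b ^ q) UNIV = infsum (\<lambda>q. a ^ p * (surf_coeff p q F * b ^ q)) UNIV"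
      by (simp add: ac_simps)
    also have "\<dots> = a ^ p * C p b"
      unfolding C_def by (rule infsum_cmult_right')
    finally show ?thesis by (simp add: mult.commute)
  qed
  have C0: "C p b = 0" if b: "norm b \<le> \<epsilon>" for p b
  proof (rule power_series_zero[OF e(1)])
    fix a :: complex assume a: "norm a \<le> \<epsilon>"
    have "(\<lambda>p. infsum (\<lambda>q. surf_coeff p q F * a ^ p * b ^ q) UNIV) summable_on UNIV"
      using summable_on_Sigma_banach[OF s[OF a b]] .
    then show "(\<lambda>p. C p b * a ^ p) summable_on UNIV" by (simp add: inner)
    have "infsum (\<lambda>p. infsum (\<lambda>q. surf_coeff p q F * a ^ p * b ^ q) UNIV) UNIV = infsum (\<lambda>(p, q). surf_coeff p q F * a ^ p * b ^ q) (UNIV \<times> UNIV)"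
      using infsum_Sigma'_banach[OF s[OF a b]] .
    also have "\<dots> = 0" using e0(3)[of a b] z[of a b] a b e by simp
    finally show "infsum (\<lambda>p. C p b * a ^ p) UNIV = 0" by (simp add: inner)
  qed
  have "surf_coeff p q F = 0" for p q
  proof (rule power_series_zero[OF e(1), where d = "\<lambda>q. surf_coeff p q F"])
    fix b :: complex assume "norm b \<le> \<epsilon>"
    then show "(\<lambda>q. surf_coeff p q F * b ^ q) summable_on UNIV" "infsum (\<lambda>q. surf_coeff p q F * b ^ q) UNIV = 0"
      using sumq C0[unfolded C_def] by auto
  qed
  then show ?thesis by (intro coeff3_ext) (simp add: coeff3_rho)
qed

text \<open>The condition \<open>rho f = 0\<close> places the surface inside the zero set of
  \<open>f\<close>, so whatever vanishes on the zero set restricts to 0 on the surface.\<close>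

lemma vanishing_ideal_Kord:
  assumes f: "f \<in> conv" "rho f = 0"
  shows "formal_vanishing_ideal (zero_set {f}) \<subseteq> Kord 1"
  unfolding formal_vanishing_ideal_def
proof (rule ideal_gen_Kord, rule subsetI)
  fix h assume "h \<in> vanishing_ideal (zero_set {f})"
  then have h: "h \<in> conv" "\<forall>\<^sub>F p in nhds 0. p \<in> zero_set {f} \<longrightarrow> eval3 h p = 0"
    by (auto simp: vanishing_ideal_def)
  obtain d where d: "d > 0" "\<And>p. dist p 0 < d \<Longrightarrow> p \<in> zero_set {f} \<Longrightarrow> eval3 h p = 0"
    using h(2) unfolding eventually_nhds_metric by blast
  obtain \<epsilon> where e: "0 < \<epsilon>" "\<And>a b. norm a \<le> \<epsilon> \<Longrightarrow> norm b \<le> \<epsilon> \<Longrightarrow> eval3 f (a, b, a * b) = 0"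
    by (rule rho_zero_eval3[OF f]) (rule that)
  \<comment> \<open>Since \<open>a\<close> has norm below 1, the norm of
    \<open>(a, b, a * b)\<close> is at most that of \<open>a\<close> plus twice that of
    \<open>b\<close>; hence \<open>d / 3\<close>.\<close>
  define \<delta> where "\<delta> = min \<epsilon> (min 1 (d / 3))"
  have "rho h = 0"
  proof (rule eval3_zero_rho[OF h(1), of \<delta>])
    show "0 < \<delta>" using d e by (simp add: \<delta>_def)
    fix a b :: complex assume ab: "norm a < \<delta>" "norm b < \<delta>"
    have "norm (a, b, a * b) \<le> norm a + norm (b, a * b)" by (rule norm_Pair_le)
    also have "norm (b, a * b) \<le> norm b + norm (a * b)" by (rule norm_Pair_le)
    also have "norm (a * b) \<le> 1 * norm b"
      unfolding norm_mult using ab by (intro mult_right_mono) (auto simp: \<delta>_def)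
    finally have "norm (a, b, a * b) < d" using ab by (simp add: \<delta>_def)
    then have "dist (a, b, a * b) 0 < d" by simp
    moreover have "(a, b, a * b) \<in> zero_set {f}"
      using e(2)[of a b] ab by (simp add: zero_set_def \<delta>_def)
    ultimately show "eval3 h (a, b, a * b) = 0" by (rule d(2))
  qed
  then show "h \<in> Kord 1" by (simp add: Kord_def)
qed


subsection \<open>A family of integrals\<close>

definition int01 :: "real poly \<Rightarrow> real" where "int01 f = integral {0..1} (poly f)"

lemma poly_integrable: "poly (f :: real poly) integrable_on {0..1}"
  by (intro integrable_continuous_real continuous_intros)

lemma int01_add: "int01 (f + g) = int01 f + int01 g"
proof -
  have "poly (f + g) = (\<lambda>x. poly f x + poly g x)" by (simp add: fun_eq_iff)
  then have "int01 (f + g) = integral {0..1} (\<lambda>x. poly f x + poly g x)" by (simp add: int01_def)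
  also have "\<dots> = int01 f + int01 g" unfolding int01_def by (rule integral_add[OF poly_integrable poly_integrable])
  finally show ?thesis .
qed

lemma int01_smult: "int01 (smult a f) = a * int01 f"
proof -
  have "poly (smult a f) = (\<lambda>x. a * poly f x)" by (simp add: fun_eq_iff)
  then show ?thesis by (simp add: int01_def)
qed

lemma int01_minus: "int01 (- f) = - int01 f"
  using int01_smult[of "-1" f] by simp

lemma int01_diff: "int01 (f - g) = int01 f - int01 g"
  using int01_add[of "f - g" g] by simp

lemma int01_pderiv: "int01 (pderiv f) = poly f 1 - poly f 0"
proof -
  have "(poly (pderiv f) has_integral (poly f 1 - poly f 0)) {0..1}"
    by (rule fundamental_theorem_of_calculus)
       (auto intro!: DERIV_subset[OF poly_DERIV] simp flip: has_real_derivative_iff_has_vector_derivative)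
  then show ?thesis unfolding int01_def by (rule integral_unique)
qed

lemma int01_nonneg: "(\<And>x. 0 \<le> x \<Longrightarrow> x \<le> 1 \<Longrightarrow> 0 \<le> poly f x) \<Longrightarrow> 0 \<le> int01 f"
  unfolding int01_def by (intro integral_nonneg poly_integrable) auto

lemma int01_monom: "int01 (monom a n) = a / real (Suc n)"
proof -
  have "pderiv (monom (a / real (Suc n)) (Suc n)) = monom a n"
    by (simp add: pderiv_monom del: of_nat_Suc)
  then show ?thesis using int01_pderiv[of "monom (a / real (Suc n)) (Suc n)"]
    by (simp add: poly_monom del: of_nat_Suc)
qed

lemma int01_sum: "int01 (sum f A) = (\<Sum>a\<in>A. int01 (f a))"
proof (induction A rule: infinite_finite_induct)
qed (auto simp: int01_add int01_smult[of 0 0, simplified])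

lemma int01_coeffs: "degree f \<le> n \<Longrightarrow> int01 f = (\<Sum>i\<le>n. coeff f i / real (Suc i))"
proof -
  assume "degree f \<le> n"
  then have "f = (\<Sum>i\<le>n. monom (coeff f i) i)" by (simp add: poly_as_sum_of_monoms')
  then have "int01 f = int01 (\<Sum>i\<le>n. monom (coeff f i) i)" by simp
  then show ?thesis by (simp only: int01_sum int01_monom)
qed

text \<open>This is \<open>gg\<close> at \<open>x1 = x2 = 1\<close>.\<close>

definition pc :: "real poly" where "pc = [:1, -1:]"

definition px :: "real poly" where "px = [:0, 1:]"

lemma poly_pc [simp]: "poly pc x = 1 - x" and poly_px [simp]: "poly px x = x"
  by (simp_all add: pc_def px_def)

lemma pderiv_px_power: "pderiv (px ^ Suc n) = smult (real (Suc n)) (px ^ n)"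
  by (simp add: pderiv_power_Suc px_def pderiv_pCons del: power_Suc of_nat_Suc) 

lemma pderiv_pc_power: "pderiv (pc ^ Suc n) = - smult (real (Suc n)) (pc ^ n)"
  by (simp add: pderiv_power_Suc pc_def pderiv_pCons del: power_Suc of_nat_Suc) 

lemma int01_parts: "int01 (f * pderiv g) = poly f 1 * poly g 1 - poly f 0 * poly g 0 - int01 (pderiv f * g)"
  using int01_pderiv[of "f * g"] by (simp add: pderiv_mult int01_add mult.commute)

lemma int01_beta: "int01 (px ^ a * pc ^ b) = fact a * fact b / fact (a + b + 1)"
proof (induction a arbitrary: b)
  case 0
  have "int01 (pderiv (pc ^ Suc b)) = - 1" by (subst int01_pderiv) (simp add: pc_def)
  then have "real (Suc b) * int01 (pc ^ b) = 1" unfolding pderiv_pc_power by (simp add: int01_minus int01_smult del: of_nat_Suc)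
  then have "int01 (pc ^ b) = 1 / real (Suc b)" by (simp add: field_simps del: of_nat_Suc)
  then show ?case by (simp add: fact_Suc del: of_nat_Suc)
next
  case (Suc a)
  have "int01 (px ^ Suc a * pderiv (pc ^ Suc b)) = - (real (Suc a) * int01 (px ^ a * pc ^ Suc b))"
    by (subst int01_parts, subst pderiv_px_power) (simp add: int01_smult del: of_nat_Suc)
  then have "real (Suc b) * int01 (px ^ Suc a * pc ^ b) = real (Suc a) * int01 (px ^ a * pc ^ Suc b)"
    unfolding pderiv_pc_power by (simp add: int01_minus int01_smult del: of_nat_Suc power_Suc)
  then have "int01 (px ^ Suc a * pc ^ b) = real (Suc a) * (fact a * fact (Suc b) / fact (a + Suc b + 1)) / real (Suc b)"
    unfolding Suc.IH[symmetric] by (simp add: field_simps del: of_nat_Suc power_Suc)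
  also have "\<dots> = fact (Suc a) * fact b / fact (Suc a + b + 1)"
    by (simp add: fact_Suc del: of_nat_Suc)
  finally show ?case .
qed

text \<open>The beta integral is the reciprocal of \<open>a + b + 1\<close> times a binomial
  coefficient, and each of these is at most \<open>2 ^ (a + b)\<close>.\<close>

lemma int01_beta_ge: "(1/4) ^ (a + b) \<le> int01 (px ^ a * pc ^ b)"
proof -
  have c: "real ((a + b) choose a) = fact (a + b) / (fact a * fact b)"
    by (subst binomial_fact) auto
  have "fact (a + b + 1) = real (Suc (a + b)) * (fact a * fact b * real ((a + b) choose a))"
    unfolding c by simp
  also have "\<dots> \<le> 2 ^ (a + b) * (fact a * fact b * 2 ^ (a + b))"
  proof (intro mult_mono)
    show "real (a + b choose a) \<le> 2 ^ (a + b)"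
      using binomial_le_pow2[of "a + b" a] by (metis of_nat_le_iff of_nat_numeral of_nat_power)
    show "real (Suc (a + b)) \<le> 2 ^ (a + b)" by (rule Suc_le_two_power)
  qed auto
  also have "\<dots> = 4 ^ (a + b) * (fact a * fact b)"
    by (simp flip: power_mult_distrib)
  finally have "fact (a + b + 1) \<le> 4 ^ (a + b) * (fact a * fact b :: real)" .
  then have "(1/4) ^ (a + b) * fact (a + b + 1) \<le> (1/4) ^ (a + b) * (4 ^ (a + b) * (fact a * fact b :: real))"
    by (intro mult_left_mono) auto
  also have "\<dots> = fact a * fact b" by (simp flip: mult.assoc power_mult_distrib)
  finally show ?thesis unfolding int01_beta by (subst pos_le_divide_eq) auto
qed

section \<open>Iterates of the vector field on polynomials in one variable\<close>

context flow_setup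
begin

text \<open>The derivation \<open>Y\<close> at \<open>x1 = x2 = 1\<close>.\<close>

definition poly_field :: "real poly \<Rightarrow> real poly" where "poly_field f = pc ^ c * pderiv f"

lemma poly_field_at_1: "poly (poly_field f) 1 = 0"
  using c_pos by (simp add: poly_field_def)

text \<open>The field is antisymmetric for the pairing of \<open>f\<close> with the derivative of
  \<open>g\<close>. The boundary term at 1 is killed by \<open>pc ^ c\<close>, the one at 0 by the
  hypothesis.\<close>

lemma poly_field_parts:
  assumes "poly f 0 * poly (poly_field g) 0 = 0"
  shows "int01 (f * pderiv (poly_field g)) = - int01 (poly_field f * pderiv g)"
proof -
  have "int01 (f * pderiv (poly_field g)) = - int01 (pderiv f * poly_field g)"
    unfolding int01_parts[of f] using assms by (simp add: poly_field_at_1)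
  then show ?thesis by (simp add: poly_field_def ac_simps)
qed

lemma poly_fieldn_parts:
  assumes "\<And>i. i < m \<Longrightarrow> poly ((poly_field ^^ i) f) 0 * poly ((poly_field ^^ (m - i)) g) 0 = 0"
  shows "j \<le> m \<Longrightarrow> int01 (f * pderiv ((poly_field ^^ m) g)) = (-1) ^ j * int01 ((poly_field ^^ j) f * pderiv ((poly_field ^^ (m - j)) g))"
proof (induction j)
  case (Suc j)
  then have "m - j = Suc (m - Suc j)" by simp
  then have "int01 ((poly_field ^^ j) f * pderiv ((poly_field ^^ (m - j)) g)) = - int01 ((poly_field ^^ Suc j) f * pderiv ((poly_field ^^ (m - Suc j)) g))"
    using poly_field_parts[of "(poly_field ^^ j) f" "(poly_field ^^ (m - Suc j)) g"] assms[of j] Suc.prems by simp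
  then show ?case using Suc by simp
qed simp

text \<open>Each application of the field lowers the order of vanishing at 0 by at most one.\<close>

lemma poly_fieldn_vanish: "px ^ (n + k) dvd f \<Longrightarrow> px ^ n dvd (poly_field ^^ k) f"
proof (induction k arbitrary: n)
  case (Suc k)
  then have "px ^ Suc n dvd (poly_field ^^ k) f" using Suc.IH[of "Suc n"] by simp
  then obtain h where "(poly_field ^^ k) f = px ^ Suc n * h" by (auto elim: dvdE)
  then have "(poly_field ^^ Suc k) f = px ^ n * (pc ^ c * (smult (real (Suc n)) h + px * pderiv h))"
    by (simp add: poly_field_def pderiv_mult pderiv_px_power algebra_simps del: of_nat_Suc power_Suc)
       (simp add: algebra_simps)
  then show ?case by (metis dvd_triv_left)
qed simp

lemma poly_fieldn_vanish_0: "px ^ l dvd f \<Longrightarrow> k < l \<Longrightarrow> poly ((poly_field ^^ k) f) 0 = 0"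
proof -
  assume "px ^ l dvd f" "k < l"
  then have "px ^ ((l - k) + k) dvd f" by simp
  then have "px ^ (l - k) dvd (poly_field ^^ k) f" by (rule poly_fieldn_vanish)
  then have "px dvd (poly_field ^^ k) f" using \<open>k < l\<close> by (metis dvd_power dvd_trans zero_less_diff)
  then show ?thesis by (auto elim!: dvdE)
qed

definition f0 :: "nat \<Rightarrow> real poly" where "f0 l = pc ^ c * px ^ l"

text \<open>The weight \<open>pc ^ c\<close> of the outermost field turns \<open>px ^ l\<close> into
  \<open>f0 l\<close>, leaving \<open>2 * l - 1\<close> fields. Moving \<open>l\<close> of them
  across gives a square. The boundary terms vanish because one of the two factors always carries
  fewer than \<open>l\<close> fields.\<close>

lemma int01_square:
  assumes "1 \<le> l"
  shows "int01 (px ^ l * (poly_field ^^ (2 * l)) (f0 l)) = (-1) ^ l * int01 (pc ^ c * (pderiv ((poly_field ^^ (l - 1)) (f0 l)))\<^sup>2)"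
proof -
  have dv: "px ^ l dvd f0 l" by (simp add: f0_def)
  obtain k where k: "l = Suc k" using assms by (cases l) auto
  have "px ^ l * (poly_field ^^ (2 * l)) (f0 l) = f0 l * pderiv ((poly_field ^^ (2 * l - 1)) (f0 l))"
    by (simp add: k poly_field_def f0_def ac_simps)
  also have "int01 \<dots> = (-1) ^ l * int01 ((poly_field ^^ l) (f0 l) * pderiv ((poly_field ^^ (2 * l - 1 - l)) (f0 l)))"
  proof (rule poly_fieldn_parts)
    fix i assume "i < 2 * l - 1"
    then have "i < l \<or> 2 * l - 1 - i < l" by linarith
    then show "poly ((poly_field ^^ i) (f0 l)) 0 * poly ((poly_field ^^ (2 * l - 1 - i)) (f0 l)) 0 = 0"
      using poly_fieldn_vanish_0[OF dv] by auto
  qed (use assms in simp)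
  also have "2 * l - 1 - l = l - 1" by simp
  also have "(poly_field ^^ l) (f0 l) = pc ^ c * pderiv ((poly_field ^^ (l - 1)) (f0 l))"
    by (simp add: k poly_field_def)
  finally show ?thesis by (simp add: power2_eq_square ac_simps)
qed

text \<open>The field maps a power of \<open>pc\<close> to a multiple of another one, with minus the
  exponent as scalar; the exponent grows by \<open>c - 1\<close> each time.\<close>

lemma poly_fieldn_pc: "(poly_field ^^ n) (pc ^ Suc a) = smult ((-1) ^ n * (\<Prod>i<n. real (Suc a + i * (c - 1)))) (pc ^ (Suc a + n * (c - 1)))"
proof (induction n)
  case (Suc n)
  have "poly_field (pc ^ Suc m) = smult (- real (Suc m)) (pc ^ (Suc m + (c - 1)))" for m
  proof -
    have "pc ^ c * pc ^ m = pc ^ (Suc m + (c - 1))" using c_pos by (simp add: add.commute flip: power_add)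
    then show ?thesis unfolding poly_field_def pderiv_pc_power by (simp del: of_nat_Suc power_Suc)
  qed
  note poly_field_pc = this
  have poly_field_smult: "poly_field (smult x f) = smult x (poly_field f)" for x f by (simp add: poly_field_def pderiv_smult)
  obtain d where d: "c - 1 = d" by blast
  have "(poly_field ^^ Suc n) (pc ^ Suc a) = smult ((-1) ^ n * (\<Prod>i<n. real (Suc a + i * d))) (poly_field (pc ^ Suc (a + n * d)))"
    using Suc unfolding d by (simp add: poly_field_smult del: of_nat_Suc power_Suc)
  then show ?case unfolding poly_field_pc d by (simp add: algebra_simps flip: smult_minus_left)
qed simp

text \<open>Cauchy-Schwarz against \<open>pc ^ l\<close>; moving the derivatives to the other factor produces \<open>fact l\<close>.\<close>

lemma int01_square_ge:
  assumes "1 \<le> l"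
  shows "(fact l * (1/4) ^ (l + c + l * c))\<^sup>2 \<le> int01 (pc ^ c * (pderiv ((poly_field ^^ (l - 1)) (f0 l)))\<^sup>2)"
proof -
  define F where "F = pderiv ((poly_field ^^ (l - 1)) (f0 l))"
  define T where "T = int01 (pc ^ c * F * pc ^ l)"
  have dv: "px ^ l dvd f0 l" by (simp add: f0_def)
  define a where "a = c - 1 + l"
  have a: "Suc a = c + l" using c_pos by (simp add: a_def)
  have T1: "T = (-1) ^ l * int01 ((poly_field ^^ l) (pc ^ Suc a) * px ^ l)"
  proof -
    have "T = int01 (pc ^ Suc a * pderiv ((poly_field ^^ (l - 1)) (f0 l)))"
      unfolding T_def F_def a by (simp add: power_add ac_simps)
    also have "\<dots> = (-1) ^ (l - 1) * int01 ((poly_field ^^ (l - 1)) (pc ^ Suc a) * pderiv ((poly_field ^^ (l - 1 - (l - 1))) (f0 l)))"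
      by (rule poly_fieldn_parts) (use poly_fieldn_vanish_0[OF dv] assms in auto)
    also have "int01 ((poly_field ^^ (l - 1)) (pc ^ Suc a) * pderiv ((poly_field ^^ (l - 1 - (l - 1))) (f0 l))) =
       - int01 (pderiv ((poly_field ^^ (l - 1)) (pc ^ Suc a)) * f0 l)"
    proof -
      have "poly (f0 l) 1 = 0" "poly (f0 l) 0 = 0" using c_pos assms by (auto simp: f0_def)
      then show ?thesis by (simp add: int01_parts)
    qed
    also have "pderiv ((poly_field ^^ (l - 1)) (pc ^ Suc a)) * f0 l = (poly_field ^^ l) (pc ^ Suc a) * px ^ l"
      using assms by (cases l) (simp_all add: poly_field_def f0_def ac_simps)
    finally show ?thesis using assms by (cases l) simp_all
  qed
  \<comment> \<open>The scalar produced by \<open>l\<close> fields, up to sign; its factors dominate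
    1, ..., l, which is where \<open>fact l\<close> comes from.\<close>
  define P where "P = (\<Prod>i<l. real (Suc a + i * (c - 1)))"
  have "int01 ((poly_field ^^ l) (pc ^ Suc a) * px ^ l) = (-1) ^ l * P * int01 (px ^ l * pc ^ (Suc a + l * (c - 1)))"
    unfolding poly_fieldn_pc P_def by (simp add: int01_smult ac_simps del: power_Suc)
  then have T2: "T = P * int01 (px ^ l * pc ^ (Suc a + l * (c - 1)))"
    unfolding T1 by (simp flip: mult.assoc power_mult_distrib)
  have P: "fact l \<le> P"
  proof -
    have "(\<Prod>i<l. real (Suc i)) \<le> P"
      unfolding P_def
    proof (intro prod_mono conjI)
      fix i assume "i \<in> {..<l}"
      then have "Suc i \<le> Suc a + i * (c - 1)" unfolding a by simp
      then show "real (Suc i) \<le> real (Suc a + i * (c - 1))" by (simp only: of_nat_le_iff)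
    qed simp
    then show ?thesis by (simp add: fact_prod_Suc atLeast0LessThan)
  qed
  have e: "l + (Suc a + l * (c - 1)) = l + c + l * c"
    using c_pos by (cases c) (simp_all add: a)
  have "fact l * (1/4) ^ (l + c + l * c) \<le> T"
    unfolding T2 e[symmetric] using P order_trans[OF fact_ge_zero P] by (intro mult_mono int01_beta_ge) auto
  then have "(fact l * (1/4) ^ (l + c + l * c))\<^sup>2 \<le> T\<^sup>2" by (intro power_mono) auto
  also have "T\<^sup>2 \<le> int01 (pc ^ c * F\<^sup>2)"
  proof -
    define U where "U = int01 (pc ^ c * pc ^ l * pc ^ l)"
    have "pc ^ c * pc ^ l * pc ^ l = px ^ 0 * pc ^ (c + 2 * l)"
      by (simp flip: power_add add: mult_2 add.assoc)
    then have "U = fact (c + 2 * l) / fact (c + 2 * l + 1)" unfolding U_def by (simp only: int01_beta) simp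
    also have "\<dots> \<le> 1" by (simp add: fact_mono)
    finally have U: "U \<le> 1" .
    \<comment> \<open>Cauchy-Schwarz with the multiplier \<open>T\<close> instead of the optimal
      \<open>T / U\<close>; the bound \<open>U \<le> 1\<close> makes this good enough.\<close>
    have "0 \<le> int01 (pc ^ c * (F - smult T (pc ^ l))\<^sup>2)"
      by (rule int01_nonneg) (simp add: pc_def)
    also have "pc ^ c * (F - smult T (pc ^ l))\<^sup>2 = 
       pc ^ c * F\<^sup>2 - smult (2 * T) (pc ^ c * F * pc ^ l) + smult (T\<^sup>2) (pc ^ c * pc ^ l * pc ^ l)"
      by (rule poly_eq_poly_eq_iff[THEN iffD1], rule ext) (simp add: power2_eq_square algebra_simps)
    also have "int01 \<dots> = int01 (pc ^ c * F\<^sup>2) - 2 * T * T + T\<^sup>2 * U"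
      by (simp only: int01_add int01_diff int01_smult T_def[symmetric] U_def[symmetric])
    finally have "2 * T\<^sup>2 - T\<^sup>2 * U \<le> int01 (pc ^ c * F\<^sup>2)" by (simp add: power2_eq_square)
    moreover have "T\<^sup>2 * U \<le> T\<^sup>2 * 1" using U by (intro mult_left_mono) auto
    ultimately show ?thesis by linarith
  qed
  finally show ?thesis by (simp add: F_def)
qed

lemma int01_lower_bound:
  "1 \<le> l \<Longrightarrow> (fact l * (1/4) ^ (l + c + l * c))\<^sup>2 \<le> \<bar>int01 (px ^ l * (poly_field ^^ (2 * l)) (f0 l))\<bar>"
  using int01_square_ge[of l] by (simp add: int01_square abs_mult)

end


subsection \<open>Bihomogeneous series as polynomials\<close>

text \<open>\<open>F\<close> has degree \<open>n\<close> in \<open>(x, x2)\<close> and degree \<open>q\<close> in \<open>(x1, x2)\<close>, and \<open>f\<close> is obtained from it by setting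
  \<open>x1 = x2 = 1\<close>.\<close>

definition Rep :: "nat \<Rightarrow> nat \<Rightarrow> ser \<Rightarrow> real poly \<Rightarrow> bool" where
  "Rep n q F f \<longleftrightarrow>
     (\<forall>i j k. coeff3 F i j k = (if i + k = n \<and> j + k = q then of_real (coeff f i) else 0)) \<and>
     (\<forall>i. coeff f i \<noteq> 0 \<longrightarrow> i \<le> n \<and> n \<le> i + q)"

lemma RepD:
  assumes "Rep n q F f"
  shows "coeff3 F i j k = (if i + k = n \<and> j + k = q then of_real (coeff f i) else 0)"
    "coeff f i \<noteq> 0 \<Longrightarrow> i \<le> n" "coeff f i \<noteq> 0 \<Longrightarrow> n \<le> i + q"
  using assms by (auto simp: Rep_def)

lemma Rep_1: "Rep 0 0 1 1"
  by (auto simp: Rep_def coeff3_1)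

lemma coeff_px_mult: "coeff (px * f) i = (if i = 0 then 0 else coeff f (i - 1))"
  by (cases i) (auto simp: px_def)

lemma coeff_pc_mult: "coeff (pc * f) i = coeff f i - (if i = 0 then 0 else coeff f (i - 1))"
  by (cases i) (auto simp: pc_def)

lemma Rep_X: "Rep n q F f \<Longrightarrow> Rep (Suc n) q (X * F) (px * f)"
  unfolding Rep_def coeff3_X_mult coeff_px_mult by (auto split: if_splits)

lemma Rep_gg: assumes "Rep n q F f" shows "Rep (Suc n) (Suc q) (gg * F) (pc * f)"
proof -
  have z: "n < i \<Longrightarrow> coeff f i = 0" "i + q < n \<Longrightarrow> coeff f i = 0" for i
    using RepD(2,3)[OF assms, of i] by fastforce+
  have "coeff3 (gg * F) i j k = (if i + k = Suc n \<and> j + k = Suc q then of_real (coeff (pc * f) i) else 0)" for i j k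
    unfolding coeff3_gg_mult coeff_pc_mult RepD(1)[OF assms]
    by (cases i; cases j; cases k) (auto simp: z split: if_splits)
  moreover have "i \<le> Suc n \<and> Suc n \<le> i + Suc q" if "coeff (pc * f) i \<noteq> 0" for i
  proof -
    have "coeff f i \<noteq> 0 \<or> (0 < i \<and> coeff f (i - 1) \<noteq> 0)"
      using that by (auto simp: coeff_pc_mult split: if_splits)
    then show ?thesis using RepD(2,3)[OF assms, of i] RepD(2,3)[OF assms, of "i - 1"] by auto
  qed
  ultimately show ?thesis unfolding Rep_def by blast
qed

lemma Rep_deriv: assumes "Rep (Suc n) q F f" shows "Rep n q (fps_deriv F) (pderiv f)"
proof -
  have "coeff3 (fps_deriv F) i j k = (if i + k = n \<and> j + k = q then of_real (coeff (pderiv f) i) else 0)" for i j k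
    unfolding coeff3_deriv RepD(1)[OF assms] coeff_pderiv by (auto simp del: of_nat_Suc)
  moreover have "i \<le> n \<and> n \<le> i + q" if "coeff (pderiv f) i \<noteq> 0" for i
    using that RepD(2,3)[OF assms, of "Suc i"] unfolding coeff_pderiv by auto
  ultimately show ?thesis unfolding Rep_def by blast
qed

lemma Rep_X_power: "Rep n q F f \<Longrightarrow> Rep (m + n) q (X ^ m * F) (px ^ m * f)"
  by (induction m) (auto simp: mult.assoc intro: Rep_X)

lemma Rep_gg_power: "Rep n q F f \<Longrightarrow> Rep (m + n) (m + q) (gg ^ m * F) (pc ^ m * f)"
  by (induction m) (auto simp: mult.assoc intro: Rep_gg)

text \<open>On the surface all monomials of the bihomogeneous series \<open>intX F\<close> coincide
  with \<open>x^(n+1) * x1^q\<close>, so their coefficients \<open>coeff f i / (i + 1)\<close> add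
  up to the integral of \<open>f\<close>.\<close>

lemma Rep_surf_coeff_int:
  assumes "Rep n q F f"
  shows "surf_coeff p q (intX F) = (if p = Suc n then of_real (int01 f) else 0)"
proof (cases "p = Suc n")
  case False
  then show ?thesis using RepD(1)[OF assms] unfolding surf_coeff_def
    by (auto intro!: sum.neutral)
next
  case True
  have "surf_coeff p q (intX F) = (\<Sum>k\<le>min (Suc n) q. of_real (coeff f (n - k) / real (Suc n - k)))"
    unfolding surf_coeff_def True
  proof (rule sum.cong[OF refl])
    fix k assume "k \<in> {..min (Suc n) q}"
    then show "coeff3 (intX F) (Suc n - k) (q - k) k = of_real (coeff f (n - k) / real (Suc n - k))"
      using RepD(1)[OF assms, of "n - k" "q - k" k] by (cases "k = Suc n") (auto simp: Suc_diff_le)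
  qed
  also have "\<dots> = of_real (\<Sum>k\<le>min (Suc n) q. coeff f (n - k) / real (Suc n - k))" by simp
  also have "(\<Sum>k\<le>min (Suc n) q. coeff f (n - k) / real (Suc n - k)) = (\<Sum>k\<in>{k. k \<le> n \<and> k \<le> q}. coeff f (n - k) / real (Suc n - k))"
    by (rule sum.mono_neutral_right) (auto simp: le_Suc_eq)
  also have "\<dots> = (\<Sum>k\<le>n. coeff f (n - k) / real (Suc n - k))"
  proof (rule sum.mono_neutral_left)
    show "\<forall>i\<in>{..n} - {k. k \<le> n \<and> k \<le> q}. coeff f (n - i) / real (Suc n - i) = 0"
      using RepD(3)[OF assms] by (force simp: not_le)
  qed auto
  also have "\<dots> = (\<Sum>i\<le>n. coeff f i / real (Suc i))"
    by (rule sum.reindex_bij_witness[where i = "\<lambda>i. n - i" and j = "\<lambda>i. n - i"]) (auto simp: Suc_diff_le)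
  also have "\<dots> = int01 f"
    by (rule int01_coeffs[symmetric], rule degree_le) (use RepD(2)[OF assms] in force)
  finally show ?thesis using True by simp
qed

context flow_setup
begin

lemma Rep_Y: "Rep (Suc n) q F f \<Longrightarrow> Rep (c + n) (c + q) (Y F) (poly_field f)"
  unfolding Y_def poly_field_def by (intro Rep_gg_power Rep_deriv)

lemma Rep_Yn: "Rep (c + m + k * (c - 1)) (c + k * c) ((Y ^^ k) (gg ^ c * X ^ m)) ((poly_field ^^ k) (f0 m))"
proof (induction k)
  case 0
  show ?case using Rep_gg_power[OF Rep_X_power[OF Rep_1, of m], of c] by (simp add: f0_def)
next
  case (Suc k)
  obtain d where d: "c = Suc d" using c_pos by (cases c) auto
  from Suc have "Rep (Suc (d + m + k * d)) (c + k * c) ((Y ^^ k) (gg ^ c * X ^ m)) ((poly_field ^^ k) (f0 m))"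
    by (simp add: d)
  from Rep_Y[OF this] show ?case by (simp add: d ac_simps)
qed

text \<open>Here \<open>c * (2 * l + 1)\<close> is the degree of \<open>Y ^^ (2 * l)\<close> of
  \<open>gg ^ c * X ^ m\<close> in (x1, x2). Its degree in (x, x2) is
  \<open>c + m + 2 * l * (c - 1)\<close>, which yields the condition on
  \<open>m + m'\<close>.\<close>

lemma surf_coeff_monomials:
  "surf_coeff (Suc (c * (2 * l + 1))) (c * (2 * l + 1)) (intX (X ^ m' * (Y ^^ (2 * l)) (gg ^ c * X ^ m))) =
     (if m + m' = 2 * l then of_real (int01 (px ^ m' * (poly_field ^^ (2 * l)) (f0 m))) else 0)"
proof -
  have q: "c * (2 * l + 1) = c + 2 * l * c" by (simp add: algebra_simps)
  obtain d where d: "c = Suc d" using c_pos by (cases c) auto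
  have "(c + 2 * l * c = m' + (c + m + 2 * l * (c - 1))) \<longleftrightarrow> m + m' = 2 * l"
    unfolding d by (auto simp: algebra_simps)
  then show ?thesis unfolding q
    using Rep_surf_coeff_int[OF Rep_X_power[OF Rep_Yn[of m "2 * l"], of m'], of "Suc (c + 2 * l * c)"] by simp
qed

text \<open>The Todd series \<open>z / (1 - exp (- z))\<close>, whose coefficients are Bernoulli
  numbers divided by factorials.\<close>

definition todd :: "complex fps" where "todd = fps_exp 1 * bernoulli_fps"

text \<open>Every \<open>Y ^^ k\<close> of a multiple of \<open>gg ^ c\<close> is again such a
  multiple, so on the surface only the \<open>intX\<close> part of \<open>inv_diff\<close> is
  visible.\<close>

lemma rho_Op_gg: "rho (Op a (gg ^ c * F)) = 0"
proof -
  have z: "rho ((Y ^^ k) (gg ^ c * F)) = 0" for k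
    using c_pos by (cases k) (simp_all add: Y_def rho_mult rho_power)
  show ?thesis unfolding Op_def
    by (subst rho_qsum, rule Op_term_Fil) (simp add: rho_mult qsum_0 z)
qed

lemma inv_diff_minus: "inv_diff (- F) = - inv_diff F"
  using inv_diff_add[of F "- F"] inv_diff_add[of 0 0] by (simp add: eq_neg_iff_add_eq_0 add.commute)

lemma Y_homog: "F \<in> homog 0 (Suc 0) (Suc 0) n \<Longrightarrow> Y F \<in> homog 0 (Suc 0) (Suc 0) (c + n)"
  unfolding Y_def using homog_mult[OF homog_power[OF gg_homog_deg, of c], of "fps_deriv F" n]
  by (auto simp: homog_def)

lemma Yn_homog: "F \<in> homog 0 (Suc 0) (Suc 0) n \<Longrightarrow> (Y ^^ k) F \<in> homog 0 (Suc 0) (Suc 0) (k * c + n)"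
  by (induction k) (auto dest: Y_homog simp: add.assoc)

end

section \<open>The coefficient of \<open>t^2\<close> on the surface\<close>

context pair_setup
begin

text \<open>The linear coefficient is \<open>- inv_diff w\<close>, and it enters the quadratic one
  through \<open>Y\<close> and \<open>Phi 1\<close>. There \<open>Y (inv_diff w)\<close> is the
  Bernoulli series in \<open>Y\<close> at \<open>theta\<close>, and \<open>Phi 1\<close> multiplies
  this series by the exponential.\<close>

lemma surf_coeff_sq2: "surf_coeff p q (time_coeff (Suc (Suc 0))) = surf_coeff p q (intX (w * Op todd theta))"
proof -
  have 1: "time_coeff (Suc 0) = - inv_diff w" by (simp add: time_coeff.simps inv_diff_minus)
  have "time_coeff (Suc (Suc 0)) = inv_diff (- (w * Y (Phi 1 (- inv_diff w))))"
    by (subst time_coeff.simps) (simp add: 1)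
  also have "- (w * Y (Phi 1 (- inv_diff w))) = w * Y (Phi 1 (inv_diff w))"
    using Phi_diff[of 1 0 "inv_diff w"] Y_diff[of 0 "Phi 1 (inv_diff w)"] by simp
  also have "Y (Phi 1 (inv_diff w)) = Op (fps_exp 1) (Y (inv_diff w))"
    by (simp add: Phi_1 Op_X[symmetric] Op_Op mult.commute)
  also have "\<dots> = Op todd theta"
    by (simp add: Y_inv_diff Op_Op todd_def theta_def)
  finally have "time_coeff (Suc (Suc 0)) = intX (w * Op todd theta) + Op (fps_shift 1 bernoulli_fps) (gg ^ c * (w * Op todd theta))"
    by (simp add: inv_diff_def)
  then have "rho (time_coeff (Suc (Suc 0))) = rho (intX (w * Op todd theta))"
    by (simp add: rho_add rho_Op_gg)
  then show ?thesis by (metis coeff3_rho)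
qed

text \<open>If \<open>w\<close> depends on \<open>x\<close> only, \<open>(Y ^^ n) theta\<close> is
  homogeneous of degree \<open>c * (n + 1)\<close> in (x1, x2), so the exponent of \<open>x1\<close>
  singles out one power of \<open>Y\<close>.\<close>

lemma surf_coeff_Op_theta:
  assumes w: "w \<in> homog 0 (Suc 0) (Suc 0) 0"
  shows "surf_coeff p (c * Suc k) (intX (w * Op a theta)) = fps_nth a k * surf_coeff p (c * Suc k) (intX (w * (Y ^^ k) theta))"
proof -
  define f where "f n = intX (w * (Y ^^ n) theta)" for n
  have fF: "f n \<in> Fil n" for n unfolding f_def by (intro intX_Fil ordge_mult_left Yn_Fil)
  have cF: "cst (fps_nth a n) * f n \<in> Fil n" for n by (rule ordge_mult_left[OF fF])
  have "intX (w * Op a theta) = qsum (\<lambda>n. intX (w * (cst (fps_nth a n) * (Y ^^ n) theta)))"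
    unfolding Op_def
    by (rule qsum_map[where H = "\<lambda>F. intX (w * F)"]) 
       (auto simp: distrib_left intX_add intro: Op_term_Fil intX_Fil ordge_mult_left)
  also have "\<dots> = qsum (\<lambda>n. cst (fps_nth a n) * f n)"
    by (simp add: f_def mult.left_commute[of w] intX_cst_mult)
  finally have e: "intX (w * Op a theta) = qsum (\<lambda>n. cst (fps_nth a n) * f n)" .
  have "theta \<in> homog 0 (Suc 0) (Suc 0) (c + 0)"
    unfolding theta_def using homog_mult[OF homog_power[OF gg_homog_deg, of c] w] by simp
  then have "w * (Y ^^ n) theta \<in> homog 0 (Suc 0) (Suc 0) (0 + (n * c + (c + 0)))" for n
    by (intro homog_mult w Yn_homog)
  then have fh: "f n \<in> homog 0 (Suc 0) (Suc 0) (c * Suc n)" for n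
    unfolding f_def by (auto simp: homog_def algebra_simps)
  have Lf: "surf_coeff p (c * Suc k) (f n) = 0" if "n \<noteq> k" for n
    unfolding surf_coeff_def using that c_pos by (intro sum.neutral ballI homogD[OF fh]) auto
  let ?N = "Suc (c * Suc k)"
  have "surf_coeff p (c * Suc k) (qsum (\<lambda>n. cst (fps_nth a n) * f n)) = surf_coeff p (c * Suc k) (\<Sum>n<?N. cst (fps_nth a n) * f n)"
    using surf_coeff_Fil[OF qsum_approx[OF cF, of ?N]] by (simp only: surf_coeff_diff) simp
  also have "\<dots> = (\<Sum>n<?N. if n = k then fps_nth a k * surf_coeff p (c * Suc k) (f k) else 0)"
    unfolding surf_coeff_sum surf_coeff_cst_mult by (intro sum.cong) (auto simp: Lf simp del: mult_Suc_right)
  also have "\<dots> = fps_nth a k * surf_coeff p (c * Suc k) (f k)"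
  proof -
    have "1 * k \<le> c * k" by (rule mult_right_mono[OF c_pos]) simp
    then have "k \<le> c * k" by (simp only: mult_1)
    then have "k < ?N" unfolding mult_Suc_right by linarith
    then show ?thesis by (subst sum.delta) auto
  qed
  finally show ?thesis by (simp add: e f_def)
qed

end

subsection \<open>The lacunary perturbation\<close>

text \<open>As \<open>3 ^ a + 3 ^ b = 2 * 3 ^ d\<close> only for \<open>a = b = d\<close>, a single pair of monomials contributes to the
  coefficients considered below.\<close>

definition lacunary :: ser where
  "lacunary = mk3 (\<lambda>i j k. if j = 0 \<and> k = 0 \<and> (\<exists>m. i = 3 ^ m) then 1 else 0)"

lemma lacunary_homog: "lacunary \<in> homog 0 (Suc 0) (Suc 0) 0"
  by (auto simp: homog_def lacunary_def)

lemma conv_lacunary: "lacunary \<in> conv"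
  by (rule conv_finite_support) (auto simp: lacunary_def)

text \<open>On the surface \<open>i + k\<close> becomes the exponent of \<open>x\<close>;
  \<open>Y\<close> does not lower it, so high powers of \<open>x\<close> in the perturbation do not
  reach a given surface coefficient.\<close>

abbreviation XF :: "nat \<Rightarrow> ser set" where "XF \<equiv> ordge (Suc 0) 0 (Suc 0)"

lemma surf_coeff_XF: "F \<in> XF (Suc p) \<Longrightarrow> surf_coeff p q F = 0"
  unfolding surf_coeff_def by (intro sum.neutral ballI ordgeD) auto

lemma intX_XF: "F \<in> XF n \<Longrightarrow> intX F \<in> XF n"
  by (auto simp: ordge_def)

lemma lacunary_trunc: "lacunary - (\<Sum>m | m \<le> p \<and> (\<exists>a. m = 3 ^ a). X ^ m) \<in> XF (Suc p)"
proof (rule ordgeI)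
  fix i j k assume lt: "Suc 0 * i + 0 * j + Suc 0 * k < Suc p"
  have "coeff3 (X ^ m) i j k = (if m = i then if j = 0 \<and> k = 0 then 1 else 0 else 0)" for m
    using coeff3_monom[of m 0 0 i j k] by auto
  then have "(\<Sum>m | m \<le> p \<and> (\<exists>a. m = 3 ^ a). coeff3 (X ^ m) i j k) = coeff3 lacunary i j k"
    using lt by (simp add: lacunary_def sum.delta)
  then show "coeff3 (lacunary - (\<Sum>m | m \<le> p \<and> (\<exists>a. m = 3 ^ a). X ^ m)) i j k = 0" by simp
qed

text \<open>An exponent above \<open>d\<close> already makes the sum too large; if one is below
  \<open>d\<close>, the other power lies strictly between \<open>3 ^ d\<close> and
  \<open>3 ^ (d + 1)\<close>.\<close>

lemma three_powers_sum:
  assumes "(3::nat) ^ a + 3 ^ b = 2 * 3 ^ d" shows "a = d \<and> b = d"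
proof -
  have *: "x = d" if "(3::nat) ^ x + 3 ^ y = 2 * 3 ^ d" for x y
  proof (rule ccontr)
    assume "x \<noteq> d"
    then consider "x < d" | "d < x" by linarith
    then show False
    proof cases
      case 1
      then have "(3::nat) ^ Suc x \<le> 3 ^ d" by (intro power_increasing) auto
      then have "3 * (3::nat) ^ x \<le> 3 ^ d" by simp
      moreover have "(0::nat) < 3 ^ d" by simp
      ultimately have "(3::nat) ^ d < 3 ^ y" "(3::nat) ^ y < 3 * 3 ^ d" using that by linarith+
      then have y: "(3::nat) ^ d < 3 ^ y" "(3::nat) ^ y < 3 ^ Suc d" by (simp_all only: power_Suc)
      from power_less_imp_less_exp[OF _ y(1)] power_less_imp_less_exp[OF _ y(2)] show False by simp
    next
      case 2
      then have "(3::nat) ^ Suc d \<le> 3 ^ x" by (intro power_increasing) auto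
      then have "3 * 3 ^ d \<le> (3::nat) ^ x" by simp
      moreover have "(0::nat) < 3 ^ d" by simp
      ultimately show False using that by linarith
    qed
  qed
  show ?thesis using *[of a b] *[of b a] assms by (simp add: add.commute)
qed

context flow_setup
begin

lemma Y_XF: assumes "F \<in> XF n" shows "Y F \<in> XF n"
proof -
  have "fps_deriv F \<in> XF (n - 1)" using assms by (auto simp: ordge_def)
  moreover have "gg ^ c \<in> XF (c * Suc 0)"
    using ordge_power[OF homog_ordge[OF gg_homog[of "Suc 0" 0]], of c] by simp
  ultimately have "Y F \<in> XF (c * Suc 0 + (n - 1))" unfolding Y_def by (rule ordge_mult[rotated])
  then show ?thesis by (rule ordge_mono) (use c_pos in simp)
qed

lemma Yn_XF: "F \<in> XF n \<Longrightarrow> (Y ^^ k) F \<in> XF n"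
  by (induction k) (auto intro: Y_XF)

lemma surf_coeff_lacunary:
  fixes a :: nat
  defines "l \<equiv> 3 ^ a" and "q \<equiv> c * (2 * 3 ^ a + 1)"
  shows "surf_coeff (Suc q) q (intX (lacunary * (Y ^^ (2 * l)) (gg ^ c * lacunary))) = of_real (int01 (px ^ l * (poly_field ^^ (2 * l)) (f0 l)))"
proof -
  define B where "B u v = surf_coeff (Suc q) q (intX (u * (Y ^^ (2 * l)) (gg ^ c * v)))" for u v
  define M where "M = {m. m \<le> Suc q \<and> (\<exists>a::nat. m = 3 ^ a)}"
  define u where "u = (\<Sum>m\<in>M. X ^ m)"
  have finM: "finite M" unfolding M_def by auto
  \<comment> \<open>The remainder is of too high order to reach \<open>x ^ (q + 1)\<close>, so both
    arguments of the bilinear form \<open>B\<close> may be truncated.\<close>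
  have ur: "lacunary - u \<in> XF (Suc (Suc q))" unfolding u_def M_def by (rule lacunary_trunc)
  have B1: "B (x - y) v = B x v - B y v" for x y v
    unfolding B_def using intX_add[of "(x - y) * (Y ^^ (2 * l)) (gg ^ c * v)" "y * (Y ^^ (2 * l)) (gg ^ c * v)"]
    by (simp add: surf_coeff_add[symmetric] eq_diff_eq flip: distrib_right)
  have B2: "B v (x - y) = B v x - B v y" for x y v
    unfolding B_def using intX_add[of "v * (Y ^^ (2 * l)) (gg ^ c * (x - y))" "v * (Y ^^ (2 * l)) (gg ^ c * y)"]
    by (simp add: surf_coeff_add[symmetric] eq_diff_eq flip: distrib_left Yn_add)
  have z1: "B (lacunary - u) v = 0" for v
    unfolding B_def by (intro surf_coeff_XF intX_XF ordge_mult_right ur)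
  have z2: "B v (lacunary - u) = 0" for v
    unfolding B_def by (intro surf_coeff_XF intX_XF ordge_mult_left Yn_XF ur)
  have "B lacunary lacunary = B u u" using z1[of lacunary] z2[of u] by (simp add: B1 B2)
  also have "B u u = (\<Sum>m'\<in>M. \<Sum>m\<in>M. B (X ^ m') (X ^ m))"
    unfolding B_def u_def by (simp add: sum_distrib_left sum_distrib_right Yn_sum intX_sum surf_coeff_sum) (rule sum.swap)
  also have "\<dots> = (\<Sum>m'\<in>M. \<Sum>m\<in>M. if m = l \<and> m' = l then of_real (int01 (px ^ l * (poly_field ^^ (2 * l)) (f0 l))) else 0)"
  proof (intro sum.cong refl)
    fix m m' assume "m' \<in> M" "m \<in> M"
    then obtain x y where xy: "m = 3 ^ x" "m' = 3 ^ y" by (auto simp: M_def)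
    then have "m + m' = 2 * l \<longleftrightarrow> m = l \<and> m' = l"
      using three_powers_sum[of x y a] by (auto simp: l_def)
    then show "B (X ^ m') (X ^ m) = (if m = l \<and> m' = l then of_real (int01 (px ^ l * (poly_field ^^ (2 * l)) (f0 l))) else 0)"
      using surf_coeff_monomials[of l m' m] unfolding B_def q_def l_def[symmetric] by auto
  qed
  also have "\<dots> = (\<Sum>m'\<in>M. if m' = l then \<Sum>m\<in>M. if m = l then of_real (int01 (px ^ l * (poly_field ^^ (2 * l)) (f0 l))) else 0 else 0)"
    by (intro sum.cong refl) auto
  also have "\<dots> = of_real (int01 (px ^ l * (poly_field ^^ (2 * l)) (f0 l)))"
  proof -
    have "1 * l \<le> c * (2 * l + 1)" using c_pos by (intro mult_mono) auto
    then have "l \<in> M" by (auto simp: M_def q_def l_def)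
    then show ?thesis using finM by simp
  qed
  finally show ?thesis by (simp add: B_def)
qed

subsection \<open>Bernoulli numbers\<close>

text \<open>Differentiating \<open>todd * (exp z - 1) = z * exp z\<close> and cancelling
  \<open>exp z - 1\<close> gives a quadratic recursion for the coefficients.\<close>

lemma todd_riccati: "fps_X * fps_deriv todd = todd - todd\<^sup>2 + fps_X * todd"
proof -
  define D :: "complex fps" where "D = fps_exp 1 - 1"
  have D0: "D \<noteq> 0"
  proof
    assume "D = 0"
    then have "fps_nth D 1 = 0" by simp
    then show False by (simp add: D_def)
  qed
  have GD: "todd * D = fps_X * fps_exp 1"
  proof -
    define Q :: "complex fps" where "Q = fps_shift 1 (fps_exp 1 - 1)"
    have D: "D = fps_X * Q" and QB: "Q * bernoulli_fps = 1" unfolding Q_def D_def by (simp_all only: bernoulli_fps_eq)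
    have "todd * D = fps_X * fps_exp 1 * (Q * bernoulli_fps)" unfolding D by (simp only: todd_def ac_simps)
    then show ?thesis unfolding QB by simp
  qed
  have "fps_deriv (todd * D) = fps_deriv (fps_X * fps_exp 1)" by (simp only: GD)
  then have GD': "fps_deriv todd * D + todd * fps_exp 1 = fps_exp 1 + fps_X * fps_exp 1"
    by (simp add: D_def algebra_simps)
  have "(fps_X * fps_deriv todd) * D = fps_X * (fps_deriv todd * D)" by (simp add: ac_simps)
  also have "fps_deriv todd * D = fps_exp 1 + fps_X * fps_exp 1 - todd * fps_exp 1"
    using GD' by (simp add: algebra_simps)
  also have "fps_X * \<dots> = (fps_X * fps_exp 1) * (1 + fps_X - todd)" by (simp add: algebra_simps)
  also have "\<dots> = (todd - todd\<^sup>2 + fps_X * todd) * D"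
    unfolding GD[symmetric] by (simp add: algebra_simps power2_eq_square)
  finally show ?thesis using D0 by simp
qed

text \<open>Without its linear term the series is \<open>(z/2) * coth (z/2)\<close>, which is even.
  In its recursion the products entering the coefficient of index \<open>2 * l\<close> all have the
  same sign, so nothing cancels and a lower bound propagates.\<close>

lemma todd_coeff_ge:
  assumes "1 \<le> l" shows "5 / 60 ^ l \<le> norm (fps_nth todd (2 * l))"
proof -
  define H where "H = todd - fps_const (1/2) * fps_X"
  have H: "fps_X * fps_deriv H = H - H\<^sup>2 + fps_const (1/4) * fps_X\<^sup>2"
  proof -
    have h: "fps_const (1/2) + fps_const (1/2) = (1 :: complex fps)" "fps_const (1/2) * fps_const (1/2) = (fps_const (1/4) :: complex fps)"
      by simp_all
    have G: "todd = H + fps_const (1/2) * fps_X" by (simp add: H_def)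
    have "fps_X * fps_deriv H = fps_X * fps_deriv todd - fps_const (1/2) * fps_X"
      unfolding H_def by (simp add: algebra_simps)
    also have "\<dots> = todd - todd\<^sup>2 + fps_X * todd - fps_const (1/2) * fps_X" by (simp add: todd_riccati)
    also have "\<dots> = H - H\<^sup>2 + (1 - (fps_const (1/2) + fps_const (1/2))) * (fps_X * H) + 
       (fps_const (1/2) - fps_const (1/2) * fps_const (1/2)) * fps_X\<^sup>2"
      unfolding G by (simp add: power2_eq_square algebra_simps del: fps_const_add fps_const_mult fps_const_sub)
    finally show ?thesis by simp
  qed
  have H0: "fps_nth H 0 = 1" by (simp add: H_def todd_def bernoulli_fps_def)
  have rec: "of_nat n * fps_nth H n = fps_nth H n - (\<Sum>i=0..n. fps_nth H i * fps_nth H (n - i)) + (if n = 2 then 1/4 else 0)" for n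
  proof -
    have "fps_nth (fps_X * fps_deriv H) n = of_nat n * fps_nth H n" by (cases n) auto
    moreover have "fps_nth (H\<^sup>2) n = (\<Sum>i=0..n. fps_nth H i * fps_nth H (n - i))"
      by (simp add: power2_eq_square fps_mult_nth)
    moreover have "fps_nth (fps_const (1/4) * fps_X\<^sup>2) n = (if n = 2 then 1/4 else (0::complex))"
      by (simp add: fps_X_power_nth)
    ultimately show ?thesis unfolding H by simp
  qed
  have H1: "fps_nth H 1 = 0" using rec[of 1] H0 by simp
  have rec': "of_nat (Suc n) * fps_nth H n = - (\<Sum>i\<in>{1..<n}. fps_nth H i * fps_nth H (n - i)) + (if n = 2 then 1/4 else 0)" 
    if "2 \<le> n" for n
  proof -
    have "{0..n} = insert 0 (insert n {1..<n})" using that by auto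
    then show ?thesis using rec[of n] that H0 by (simp add: algebra_simps)
  qed
  have odd: "odd n \<Longrightarrow> fps_nth H n = 0" for n
  proof (induction n rule: less_induct)
    case (less n)
    show ?case
    proof (cases "n = 1")
      case True then show ?thesis using H1 by simp
    next
      case False
      then have "2 \<le> n" "n \<noteq> 2" using less.prems by (auto elim: oddE)
      moreover have "(\<Sum>i\<in>{1..<n}. fps_nth H i * fps_nth H (n - i)) = 0"
      proof (intro sum.neutral ballI)
        fix i assume "i \<in> {1..<n}"
        then show "fps_nth H i * fps_nth H (n - i) = 0"
          using less.IH[of i] less.IH[of "n - i"] less.prems by (cases "odd i") auto
      qed
      ultimately have "of_nat (Suc n) * fps_nth H n = 0" using rec'[of n] by simp
      then show ?thesis by (simp del: of_nat_Suc)
    qed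
  qed
  have even: "1 \<le> l \<Longrightarrow> \<exists>a. 5 / 60 ^ l \<le> a \<and> fps_nth H (2 * l) = (-1) ^ Suc l * of_real a" for l
  proof (induction l rule: less_induct)
    case (less l)
    show ?case
    proof (cases "l = 1")
      case True
      have "3 * fps_nth H 2 = 1/4" using rec'[of 2] H1 by (simp add: atLeastLessThan_nat_numeral numeral_2_eq_2)
      then have "fps_nth H 2 = 1/12" by (simp add: eq_divide_eq mult.commute)
      then show ?thesis using True by (intro exI[of _ "1/12"]) (simp add: numeral_2_eq_2)
    next
      case False
      then have l: "2 \<le> l" using less.prems by simp
      have "\<forall>i\<in>{1..<l}. \<exists>a. 5 / 60 ^ i \<le> a \<and> fps_nth H (2 * i) = (-1) ^ Suc i * of_real a"
        using less.IH by simp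
      from bchoice[OF this] obtain a where a: "\<And>i. i \<in> {1..<l} \<Longrightarrow> 5 / 60 ^ i \<le> a i"
        "\<And>i. i \<in> {1..<l} \<Longrightarrow> fps_nth H (2 * i) = (-1) ^ Suc i * of_real (a i)" by blast
      have "(\<Sum>i\<in>{1..<2 * l}. fps_nth H i * fps_nth H (2 * l - i)) = 
          (\<Sum>i\<in>(\<lambda>i. 2 * i) ` {1..<l}. fps_nth H i * fps_nth H (2 * l - i))"
        by (rule sum.mono_neutral_right) (auto simp: image_iff intro!: odd elim!: evenE)
      also have "\<dots> = (\<Sum>i\<in>{1..<l}. fps_nth H (2 * i) * fps_nth H (2 * (l - i)))"
        by (subst sum.reindex) (auto simp: inj_on_def diff_mult_distrib2)
      also have "\<dots> = (\<Sum>i\<in>{1..<l}. (-1) ^ l * of_real (a i * a (l - i)))"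
      proof (rule sum.cong[OF refl])
        fix i assume i: "i \<in> {1..<l}"
        then have "l - i \<in> {1..<l}" by auto
        moreover have "(-1::complex) ^ Suc i * (-1) ^ Suc (l - i) = (-1) ^ l"
          using i by (simp flip: power_add)
        ultimately show "fps_nth H (2 * i) * fps_nth H (2 * (l - i)) = (-1) ^ l * of_real (a i * a (l - i))"
          using a(2)[OF i] a(2)[of "l - i"] by (simp add: algebra_simps)
      qed
      finally have "of_nat (Suc (2 * l)) * fps_nth H (2 * l) = (-1) ^ Suc l * of_real (\<Sum>i\<in>{1..<l}. a i * a (l - i))"
        using rec'[of "2 * l"] l by (simp add: sum_distrib_left sum_negf del: of_nat_Suc)
      moreover have nz: "(of_nat (Suc (2 * l)) :: complex) \<noteq> 0" by (simp only: of_nat_eq_0_iff)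
      ultimately have e: "fps_nth H (2 * l) = (-1) ^ Suc l * of_real ((\<Sum>i\<in>{1..<l}. a i * a (l - i)) / real (Suc (2 * l)))"
        by (simp add: field_simps del: of_nat_Suc)
      have "real (l - 1) * (25 / 60 ^ l) \<le> (\<Sum>i\<in>{1..<l}. a i * a (l - i))"
      proof -
        have "25 / 60 ^ l \<le> a i * a (l - i)" if i: "i \<in> {1..<l}" for i
        proof -
          have "l - i \<in> {1..<l}" using i by auto
          then have "5 / 60 ^ i * (5 / 60 ^ (l - i)) \<le> a i * a (l - i)"
            using a(1)[OF i] a(1)[of "l - i"] by (intro mult_mono) (auto intro: order_trans[rotated])
          moreover have "(60::real) ^ i * 60 ^ (l - i) = 60 ^ l" using i by (simp flip: power_add)
          ultimately show ?thesis by (simp add: field_simps)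
        qed
        then have "(\<Sum>i\<in>{1..<l}. 25 / 60 ^ l) \<le> (\<Sum>i\<in>{1..<l}. a i * a (l - i))" by (rule sum_mono)
        then show ?thesis by simp
      qed
      \<comment> \<open>The constants fit exactly: \<open>5 / 60\<close> is the value 1/12 at
        \<open>l = 1\<close>, and \<open>5 * (2 * l + 1) \<le> 25 * (l - 1)\<close> holds from
        \<open>l = 2\<close> on, with equality there.\<close>
      moreover have "5 / 60 ^ l * real (Suc (2 * l)) \<le> real (l - 1) * (25 / 60 ^ l)"
        using l by (simp add: field_simps of_nat_diff)
      ultimately have "5 / 60 ^ l \<le> (\<Sum>i\<in>{1..<l}. a i * a (l - i)) / real (Suc (2 * l))"
        by (subst pos_le_divide_eq) (simp, linarith)
      then show ?thesis using e by blast
    qed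
  qed
  obtain a where a: "5 / 60 ^ l \<le> a" "fps_nth H (2 * l) = (-1) ^ Suc l * of_real a" using even[OF assms] by blast
  have "fps_nth todd (2 * l) = fps_nth H (2 * l)"
    using assms by (auto simp: H_def)
  then have "norm (fps_nth todd (2 * l)) = \<bar>a\<bar>" by (simp add: a(2) norm_mult norm_power)
  then show ?thesis using a(1) by linarith
qed

end


subsection \<open>Polynomial families\<close>

lemma coeff_higher_pderiv:
  fixes p :: "complex poly"
  shows "coeff ((pderiv ^^ n) p) m = fact (m + n) / fact m * coeff p (m + n)"
proof (induction n arbitrary: m)
  case (Suc n)
  have "(of_nat (Suc m) :: complex) \<noteq> 0" by (simp only: of_nat_eq_0_iff)
  then show ?case using Suc[of "Suc m"] by (simp add: coeff_pderiv fact_Suc del: of_nat_Suc)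
qed simp

lemma poly_coeff_bound:
  fixes p :: "complex poly"
  assumes r: "0 < r" and B: "\<And>z. norm z \<le> r \<Longrightarrow> norm (poly p z) \<le> B"
  shows "norm (coeff p n) \<le> B / r ^ n"
proof -
  have d: "(deriv ^^ n) (poly p) = poly ((pderiv ^^ n) p)" for n
    by (induction n) (auto intro!: ext DERIV_imp_deriv poly_DERIV)
  have "norm ((deriv ^^ n) (poly p) 0) \<le> fact n * B / r ^ n"
    by (rule Cauchy_inequality[OF _ _ r]) (auto intro!: holomorphic_intros continuous_intros B)
  then have "fact n * norm (coeff p n) \<le> fact n * B / r ^ n"
    unfolding d by (simp add: poly_0_coeff_0 coeff_higher_pderiv norm_mult)
  then show ?thesis using r by (simp add: field_simps)
qed

lemma poly_norm_le:
  fixes p :: "complex poly"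
  assumes "degree p \<le> d" "\<And>n. norm (coeff p n) \<le> B * K ^ n" "norm z \<le> s" "1 \<le> K * s" "0 \<le> B" "0 \<le> K"
  shows "norm (poly p z) \<le> B * real (Suc d) * (K * s) ^ d"
proof -
  have e: "poly p z = (\<Sum>n\<le>d. coeff p n * z ^ n)"
    using arg_cong[OF poly_as_sum_of_monoms'[OF assms(1)], of "\<lambda>p. poly p z"]
    by (simp add: poly_sum poly_monom)
  have "norm (poly p z) \<le> (\<Sum>n\<le>d. B * (K * s) ^ d)"
    unfolding e
  proof (rule sum_norm_le)
    fix n assume n: "n \<in> {..d}"
    have "norm (coeff p n * z ^ n) \<le> (B * K ^ n) * s ^ n"
      unfolding norm_mult norm_power using assms by (intro mult_mono power_mono) auto
    also have "\<dots> = B * (K * s) ^ n" by (simp add: power_mult_distrib)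
    also have "\<dots> \<le> B * (K * s) ^ d" using assms n by (intro mult_left_mono power_increasing) auto
    finally show "norm (coeff p n * z ^ n) \<le> B * (K * s) ^ d" .
  qed
  then show ?thesis by (simp add: ac_simps)
qed

text \<open>By Baire a single \<open>R\<close> works on some ball. Cauchy's estimates there bound
  the coefficients around its centre. As the degree is at most \<open>q + 1\<close>, passing from
  that ball to the unit disc costs only a factor geometric in \<open>q\<close>, and Cauchy's
  estimate at 0 finishes.\<close>

lemma polynomial_family_bound:
  fixes P :: "nat \<Rightarrow> complex poly"
  assumes deg: "\<And>q. degree (P q) \<le> Suc q"
    and bd: "\<And>t. \<exists>R\<ge>1. \<forall>q. norm (poly (P q) t) \<le> R ^ (2 * q + 1)"
  shows "\<exists>M\<ge>1. \<forall>q. norm (coeff (P q) n) \<le> M ^ Suc q"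
proof -
  define T where "T N = {t. \<forall>q. norm (poly (P q) t) \<le> real (Suc N) ^ (2 * q + 1)}" for N
  have cl: "closed (T N)" for N
  proof -
    have "T N = (\<Inter>q. {t. norm (poly (P q) t) \<le> real (Suc N) ^ (2 * q + 1)})" by (auto simp: T_def)
    then show ?thesis by (auto intro!: closed_INT closed_Collect_le continuous_intros)
  qed
  have cover: "(\<Union>N. T N) = UNIV"
  proof -
    have "\<exists>N. t \<in> T N" for t
    proof -
      obtain R where R: "1 \<le> R" "\<And>q. norm (poly (P q) t) \<le> R ^ (2 * q + 1)" using bd by blast
      obtain N where "R \<le> real N" using real_arch_simple by blast
      then have "R ^ (2 * q + 1) \<le> real (Suc N) ^ (2 * q + 1)" for q using R by (intro power_mono) auto
      then show ?thesis using R(2) order_trans unfolding T_def by blast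
    qed
    then show ?thesis by blast
  qed
  have "\<exists>N. interior (T N) \<noteq> {}"
  proof (rule ccontr)
    assume "\<nexists>N. interior (T N) \<noteq> {}"
    then have i: "interior (T N) = {}" for N by blast
    have "UNIV \<subseteq> closure (\<Inter>(range (\<lambda>N. - T N)))"
    proof (rule Baire)
      fix A assume "A \<in> range (\<lambda>N. - T N)"
      then obtain N where "A = - T N" by blast
      then show "openin (top_of_set UNIV) A \<and> UNIV \<subseteq> closure A"
        using cl[of N] i[of N] by (simp add: open_Compl closure_complement)
    qed auto
    moreover have "\<Inter>(range (\<lambda>N. - T N)) = {}" using cover by blast
    ultimately show False by simp
  qed
  then obtain N t0 \<rho> where rho: "0 < \<rho>" "cball t0 \<rho> \<subseteq> T N"
    by (meson all_not_in_conv mem_interior_cball)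
  define R where "R = real (Suc N)"
  have R: "1 \<le> R" by (simp add: R_def)
  \<comment> \<open>The ratio of the radius of a disc around \<open>t0\<close> containing the unit
    disc to the radius of the small ball, raised to at least 1 so that the top power
    dominates.\<close>
  define K where "K = max 1 ((1 + norm t0) / \<rho>)"
  have K: "1 \<le> K" "(1 + norm t0) / \<rho> \<le> K" by (auto simp: K_def)
  have "norm (coeff (P q) n) \<le> (R\<^sup>2 * 2 * K) ^ Suc q" for q
  proof -
    define p2 where "p2 = pcompose (P q) [:t0, 1:]"
    have p2: "poly p2 u = poly (P q) (t0 + u)" for u by (simp add: p2_def poly_pcompose)
    have dp2: "degree p2 \<le> Suc q" using deg[of q] by (simp add: p2_def degree_pcompose)
    have "norm (coeff p2 m) \<le> R ^ (2 * q + 1) / \<rho> ^ m" for m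
    proof (rule poly_coeff_bound[OF rho(1)])
      fix z :: complex assume "norm z \<le> \<rho>"
      then have "t0 + z \<in> T N" using rho(2) by (auto simp: dist_norm)
      then show "norm (poly p2 z) \<le> R ^ (2 * q + 1)" by (simp add: p2 T_def R_def)
    qed
    then have c2: "norm (coeff p2 m) \<le> R ^ (2 * q + 1) * (K / (1 + norm t0)) ^ m" for m
    proof -
      have n0: "0 < 1 + norm t0" by (rule add_pos_nonneg) auto
      have "1 / \<rho> \<le> K / (1 + norm t0)" using K(2) n0 rho(1) by (simp add: field_simps)
      then have "(1 / \<rho>) ^ m \<le> (K / (1 + norm t0)) ^ m" using rho(1) by (intro power_mono) auto
      then have "R ^ (2 * q + 1) * (1 / \<rho>) ^ m \<le> R ^ (2 * q + 1) * (K / (1 + norm t0)) ^ m"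
        using R by (intro mult_left_mono) auto
      then show ?thesis using \<open>norm (coeff p2 m) \<le> _\<close> by (simp add: power_one_over field_simps)
    qed
    have "norm (coeff (P q) n) \<le> (R ^ (2 * q + 1) * real (Suc (Suc q)) * K ^ Suc q) / 1 ^ n"
    proof (rule poly_coeff_bound)
      fix z :: complex assume z: "norm z \<le> 1"
      have n0: "0 < 1 + norm t0" by (rule add_pos_nonneg) auto
      have e: "K / (1 + norm t0) * (1 + norm t0) = K" using n0 by simp
      have "norm (poly p2 (z - t0)) \<le> R ^ (2 * q + 1) * real (Suc (Suc q)) * (K / (1 + norm t0) * (1 + norm t0)) ^ Suc q"
      proof (rule poly_norm_le[OF dp2 c2])
        show "norm (z - t0) \<le> 1 + norm t0" using norm_triangle_ineq4[of z t0] z by linarith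
        show "1 \<le> K / (1 + norm t0) * (1 + norm t0)" unfolding e by (rule K)
      qed (use R K n0 in auto)
      then show "norm (poly (P q) z) \<le> R ^ (2 * q + 1) * real (Suc (Suc q)) * K ^ Suc q"
        unfolding e p2 by simp
    qed simp
    also have "\<dots> \<le> R ^ (2 * Suc q) * 2 ^ Suc q * K ^ Suc q"
    proof -
      have "R ^ (2 * q + 1) \<le> R ^ (2 * Suc q)" using R by (intro power_increasing) auto
      then have "R ^ (2 * q + 1) * real (Suc (Suc q)) * K ^ Suc q \<le> R ^ (2 * Suc q) * 2 ^ Suc q * K ^ Suc q"
        using R K by (intro mult_right_mono mult_mono Suc_le_two_power) auto
      then show ?thesis by simp
    qed
    also have "\<dots> = (R\<^sup>2 * 2 * K) ^ Suc q" by (simp only: power_mult_distrib power_mult)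
    finally show ?thesis .
  qed
  moreover have "1 \<le> R\<^sup>2 * 2 * K"
  proof -
    have "1 * 1 \<le> R\<^sup>2 * (2 * K)" using R K by (intro mult_mono) (auto simp: one_le_power)
    then show ?thesis by (simp add: mult.assoc)
  qed
  ultimately show ?thesis by blast
qed

context flow_setup
begin

subsection \<open>The diffeomorphisms\<close>

text \<open>The scalar in \<open>(Y ^^ Suc k) X\<close>: each further \<open>Y\<close> brings down
  minus the exponent of \<open>gg\<close>, together with a factor \<open>X1\<close>, and raises that
  exponent by \<open>c - 1\<close>.\<close>

definition flow_num :: "nat \<Rightarrow> complex" where
  "flow_num k = (-1) ^ k * of_nat (\<Prod>i<k. c + i * (c - 1))"

definition flow_coeff :: "nat \<Rightarrow> complex" where "flow_coeff k = flow_num k / fact (Suc k)"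

text \<open>The quotient of \<open>Phi r X - X\<close> by \<open>gg ^ c\<close>. For
  \<open>c = 1\<close> it is \<open>(1 - exp (- r * x1)) / x1\<close>.\<close>

definition flow_quot :: "ser \<Rightarrow> ser" where
  "flow_quot r = r * qsum (\<lambda>k. cst (flow_coeff k) * (r * X1 * gg ^ (c - 1)) ^ k)"

lemma X1_Fil: "X1 \<in> Fil (Suc 0)"
  by (rule homog_ordge[OF X1_homog])

lemma Y_gg_power: "Y (gg ^ Suc m) = cst (- of_nat (Suc m)) * X1 * gg ^ (Suc m + (c - 1))"
proof -
  have "gg ^ c * gg ^ m = gg ^ (Suc m + (c - 1))" using c_pos by (simp add: add.commute flip: power_add)
  moreover have "Y (gg ^ Suc m) = cst (- of_nat (Suc m)) * X1 * (gg ^ c * gg ^ m)"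
    unfolding Y_def fps_deriv_power' deriv_gg cst_minus cst_of_nat by (simp add: ac_simps del: of_nat_Suc)
  ultimately show ?thesis by simp
qed

lemma Yn_X: "(Y ^^ Suc k) X = cst (flow_num k) * X1 ^ k * gg ^ (c + k * (c - 1))"
proof (induction k)
  case 0
  show ?case by (simp add: Y_def flow_num_def X_def)
next
  case (Suc k)
  obtain m where m: "c + k * (c - 1) = Suc m" using c_pos by (cases "c + k * (c - 1)") auto
  have "X1 ^ k = fps_const (fps_X ^ k)" by (simp add: X1_def fps_const_power)
  then have step: "Y (cst (flow_num k) * X1 ^ k * gg ^ Suc m) = cst (flow_num k) * X1 ^ k * Y (gg ^ Suc m)"
    by (simp only: mult.assoc Y_cst_mult Y_const_mult)
  have "flow_num (Suc k) = - of_nat (Suc m) * flow_num k"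
  proof -
    have "(-1) ^ Suc k * (P * Q) = - Q * ((-1) ^ k * P)" for P Q :: complex by simp
    then show ?thesis unfolding flow_num_def prod.lessThan_Suc of_nat_mult m[symmetric] by blast
  qed
  then have AS: "cst (flow_num (Suc k)) = cst (- of_nat (Suc m)) * cst (flow_num k)" by (simp only: cst_mult)
  have "c + Suc k * (c - 1) = Suc m + (c - 1)" using m by simp
  then have fin: "cst (flow_num (Suc k)) * X1 ^ Suc k * gg ^ (c + Suc k * (c - 1)) = cst (flow_num k) * X1 ^ k * Y (gg ^ Suc m)"
    unfolding Y_gg_power AS by (simp only: power_Suc ac_simps)
  have "(Y ^^ Suc (Suc k)) X = Y ((Y ^^ Suc k) X)" by simp
  also have "\<dots> = Y (cst (flow_num k) * X1 ^ k * gg ^ Suc m)" by (simp only: Suc m)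
  finally show ?case by (simp only: step fin)
qed

lemma flow_quot_term_Fil: "cst (flow_coeff k) * (r * X1 * gg ^ e) ^ k \<in> Fil k"
  using ordge_power[OF ordge_mult_right[OF ordge_mult_left[OF X1_Fil]], of r "gg ^ e" k]
  by (intro ordge_mult_left) simp

lemma Phi_X: "Phi r X = X + gg ^ c * flow_quot r"
proof -
  have "Phi r X = X + qsum (\<lambda>k. cst (1 / fact (Suc k)) * r ^ Suc k * (Y ^^ Suc k) X)"
    unfolding Phi_def by (subst qsum_Suc, rule Phi_term_Fil) simp
  also have "qsum (\<lambda>k. cst (1 / fact (Suc k)) * r ^ Suc k * (Y ^^ Suc k) X) = 
      qsum (\<lambda>k. (gg ^ c * r) * (cst (flow_coeff k) * (r * X1 * gg ^ (c - 1)) ^ k))"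
  proof (rule qsum_cong)
    fix k
    have "cst (flow_coeff k) = cst (1 / fact (Suc k)) * cst (flow_num k)"
      by (simp add: flow_coeff_def flip: cst_mult)
    moreover have e: "gg ^ (c + k * (c - 1)) = gg ^ c * (gg ^ (c - 1)) ^ k"
      by (simp only: power_add mult.commute[of k] power_mult)
    ultimately show "cst (1 / fact (Suc k)) * r ^ Suc k * (Y ^^ Suc k) X =
      (gg ^ c * r) * (cst (flow_coeff k) * (r * X1 * gg ^ (c - 1)) ^ k)"
      unfolding Yn_X e by (simp only: power_mult_distrib power_Suc ac_simps)
  qed
  also have "\<dots> = gg ^ c * flow_quot r"
    unfolding flow_quot_def by (subst qsum_mult_left[symmetric], rule flow_quot_term_Fil) (simp add: mult.assoc)
  finally show ?thesis .
qed

text \<open>The \<open>i\<close>-th factor of the product is at most \<open>c * (i + 1)\<close>, so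
  the factorial in the denominator absorbs the growth.\<close>

lemma norm_flow_coeff_le: "norm (flow_coeff k) \<le> real c ^ k"
proof -
  have "c + i * (c - 1) \<le> c * Suc i" for i
    using mult_le_mono2[of "c - 1" c i] by (simp add: mult.commute)
  then have "(\<Prod>i<k. c + i * (c - 1)) \<le> (\<Prod>i<k. c * Suc i)"
    by (intro prod_mono) simp
  also have "\<dots> = c ^ k * fact k" by (simp add: prod.distrib fact_prod_Suc atLeast0LessThan del: mult_Suc_right)
  finally have "real (\<Prod>i<k. c + i * (c - 1)) \<le> real (c ^ k * fact k)" by (simp only: of_nat_le_iff)
  moreover have "norm (flow_num k) = real (\<Prod>i<k. c + i * (c - 1))"
    by (simp only: flow_num_def norm_mult norm_power norm_of_nat norm_minus_cancel norm_one power_one mult_1)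
  ultimately have "norm (flow_num k) \<le> real c ^ k * fact k" by simp
  also have "\<dots> \<le> real c ^ k * fact (Suc k)" by (intro mult_left_mono fact_mono) auto
  finally show ?thesis unfolding flow_coeff_def norm_divide norm_fact by (simp only: pos_divide_le_eq fact_gt_zero)
qed

lemma flow_quot_conv_unit:
  assumes r: "r \<in> conv" "r - 1 \<in> Fil 1"
  shows "flow_quot r \<in> conv_units"
proof (rule conv_unitI)
  define h where "h = r * X1 * gg ^ (c - 1)"
  define Q where "Q = qsum (\<lambda>k. cst (flow_coeff k) * h ^ k)"
  have h: "h \<in> conv" "h \<in> Fil 1"
    using X1_Fil by (auto simp: h_def intro!: conv_mult conv_power conv_X1 conv_gg r ordge_mult_right[OF ordge_mult_left])
  have "Q \<in> conv" unfolding Q_def by (rule conv_qsum_power[OF h _ norm_flow_coeff_le]) simp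
  then show "flow_quot r \<in> conv" using r by (simp add: flow_quot_def Q_def h_def conv_mult)
  have "Q - (\<Sum>k<1. cst (flow_coeff k) * h ^ k) \<in> Fil 1"
    unfolding Q_def h_def by (rule qsum_approx[OF flow_quot_term_Fil])
  then have "Q - 1 \<in> Fil 1" by (simp add: flow_coeff_def flow_num_def)
  then have "r * (Q - 1) + (r - 1) \<in> Fil 1" by (intro ordge_add ordge_mult_left r)
  then show "flow_quot r - 1 \<in> Fil 1" by (simp add: flow_quot_def Q_def h_def algebra_simps)
qed

end

lemma formal_Diff_near_X:
  assumes "R \<in> Fil 1" shows "(X + R, X1, X2) \<in> formal_Diff"
proof -
  have "coeff3 R 0 0 0 = 0" "coeff3 R 1 0 0 = 0" by (auto intro: ordgeD[OF assms])
  moreover have "det (linear_part (X + R, X1, X2)) = 1"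
    using \<open>coeff3 R 1 0 0 = 0\<close>
    by (simp add: det_3 linear_part_def linear_form_def coeff3_X coeff3_X1 coeff3_X2)
  ultimately show ?thesis
    by (simp add: formal_Diff_def invertible_det_nz coeff3_X coeff3_X1 coeff3_X2)
qed

context flow_setup
begin

lemma gg_c_Fil: "gg ^ c * F \<in> Fil 1"
  by (intro ordge_mult_right ordge_mono[OF gg_power_Fil] c_pos)

lemma Phi_D_set:
  assumes "r \<in> conv" "r - 1 \<in> Fil 1"
  shows "(Phi r X, X1, X2) \<in> D_set (gg ^ c)"
proof -
  have u: "flow_quot r \<in> conv_units" by (rule flow_quot_conv_unit[OF assms])
  then have "flow_quot r \<in> conv" by (simp add: conv_units_def)
  then have "Phi r X \<in> conv"
    unfolding Phi_X by (intro conv_add conv_mult conv_power conv_X conv_gg)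
  moreover have "coeff3 (Phi r X) 1 0 0 = 1"
    using ordgeD[OF gg_c_Fil[of "flow_quot r"], of 1 0 0] by (simp add: Phi_X coeff3_X)
  moreover have "(Phi r X, X1, X2) \<in> formal_Diff"
    unfolding Phi_X by (rule formal_Diff_near_X[OF gg_c_Fil])
  ultimately have "(Phi r X, X1, X2) \<in> Diff_up"
    by (simp add: Diff_up_def Diff_def conv_X1 conv_X2)
  moreover have "Phi r X - X = flow_quot r * gg ^ c" by (simp add: Phi_X)
  ultimately show ?thesis using u by (auto simp: D_set_def)
qed

lemma conj_formal_of_time:
  assumes "Phi r s - s = 1 - r"
  shows "conj_formal (gg ^ c) (Phi r X, X1, X2) (Phi 1 X, X1, X2)"
proof -
  have "(Phi s X, X1, X2) \<in> formal_Diff_p"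
    unfolding formal_Diff_p_def Phi_X using formal_Diff_near_X[OF gg_c_Fil] by simp
  moreover have "normalized (gg ^ c) (Phi s X, X1, X2)"
    unfolding normalized_def
  proof (intro allI impI)
    fix \<gamma> assume "irreducible_component \<gamma> (zero_set {gg ^ c}) \<and> \<not> fibered \<gamma>"
    \<comment> \<open>Any component lies in the zero set of \<open>gg ^ c\<close>, so
      \<open>gg ^ c\<close> belongs to its ideal; and \<open>Phi s X - X\<close> is a multiple of
      \<open>gg ^ c\<close>.\<close>
    then have "germ_subset \<gamma> (zero_set {gg ^ c})" by (simp add: irreducible_component_def)
    then have "gg ^ c \<in> vanishing_ideal \<gamma>"
      by (auto simp: vanishing_ideal_def germ_subset_def zero_set_def conv_power conv_gg)
    then have "flow_quot s * gg ^ c \<in> formal_vanishing_ideal \<gamma>"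
      unfolding formal_vanishing_ideal_def ideal_gen_def
      by (intro module.span_scale[OF module_times] module.span_base[OF module_times])
    then show "fst (Phi s X, X1, X2) - X \<in> formal_vanishing_ideal \<gamma>"
      by (simp add: Phi_X mult.commute)
  qed
  moreover have "fcomp (Phi s X, X1, X2) (Phi r X, X1, X2) = fcomp (Phi 1 X, X1, X2) (Phi s X, X1, X2)"
    by (rule conjugacy_of_time[OF assms])
  ultimately show ?thesis unfolding conj_formal_def by blast
qed

subsection \<open>Transversally formal conjugacies\<close>

text \<open>For \<open>c > 1\<close> the positive powers of \<open>gg\<close> die on the surface and
  \<open>\<psi> = \<tau>\<close>. For \<open>c = 1\<close>,
  \<open>\<psi> = (1 - exp (- \<tau> * x1)) / x1\<close>, whose derivative is
  \<open>\<tau>' * (1 - x1 * \<psi>)\<close>. The linear equation for \<open>\<tau>'\<close> has the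
  shape required by \<open>conv_fixpoint\<close>.\<close>

lemma rho_flow_quot_deriv:
  fixes s :: ser
  defines "\<tau> \<equiv> rho s" and "\<psi> \<equiv> rho (flow_quot s)"
  shows "fps_deriv \<tau> = fps_deriv \<psi> + (if c = 1 then X1 * \<psi> else 0) * fps_deriv \<tau>"
proof -
  have psi: "\<psi> = \<tau> * qsum (\<lambda>k. cst (flow_coeff k) * (\<tau> * X1 * rho gg ^ (c - 1)) ^ k)"
    unfolding \<psi>_def \<tau>_def flow_quot_def rho_mult
    by (subst rho_qsum, rule flow_quot_term_Fil) (simp add: rho_mult rho_power rho_const rho_X1)
  show ?thesis
  proof (cases "c = 1")
    case False
    then have "c - 1 \<noteq> 0" using c_pos by simp
    then have "qsum (\<lambda>k. cst (flow_coeff k) * (\<tau> * X1 * rho gg ^ (c - 1)) ^ k) = 1"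
      by (subst qsum_Suc) (auto simp: qsum_0 flow_coeff_def flow_num_def power_0_left)
    then show ?thesis using False psi by simp
  next
    case True
    define z where "z = \<tau> * X1"
    have zF: "z ^ k \<in> Fil k" for k
      using ordge_power[OF ordge_mult_left[OF X1_Fil], of \<tau> k] by (simp add: z_def)
    have al: "flow_coeff k = (-1) ^ k / fact (Suc k)" for k
      unfolding flow_coeff_def flow_num_def using True by simp
    have psi': "\<psi> = \<tau> * qsum (\<lambda>k. cst (flow_coeff k) * z ^ k)" using psi by (simp add: True z_def)
    define E where "E = qsum (\<lambda>k. cst ((-1) ^ k / fact k) * z ^ k)"
    have aF: "cst (x k) * z ^ k \<in> Fil k" for x k by (intro ordge_mult_left zF)
    have "E = 1 + qsum (\<lambda>k. cst ((-1) ^ Suc k / fact (Suc k)) * z ^ Suc k)"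
      unfolding E_def by (subst qsum_Suc, rule aF) simp
    also have "qsum (\<lambda>k. cst ((-1) ^ Suc k / fact (Suc k)) * z ^ Suc k) = (- z) * qsum (\<lambda>k. cst (flow_coeff k) * z ^ k)"
      unfolding al by (subst qsum_mult_left, rule aF) 
        (auto simp: cst_minus ac_simps simp del: fact_Suc intro!: qsum_cong)
    also have "\<dots> = - (X1 * \<psi>)" by (simp add: psi' z_def ac_simps)
    finally have E1: "E = 1 - X1 * \<psi>" by simp
    have "\<psi> = qsum (\<lambda>k. \<tau> * (cst (flow_coeff k) * z ^ k))"
      unfolding psi' by (rule qsum_mult_left[OF aF])
    also have "fps_deriv \<dots> = qsum (\<lambda>k. fps_deriv (\<tau> * (cst (flow_coeff k) * z ^ k)))"
      by (rule qsum_map) (auto intro: ordge_mult_left zF deriv_Fil)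
    also have "\<dots> = qsum (\<lambda>k. fps_deriv \<tau> * (cst ((-1) ^ k / fact k) * z ^ k))"
    proof (rule qsum_cong)
      fix k
      have "fps_deriv (\<tau> * (cst (flow_coeff k) * z ^ k)) = cst (flow_coeff k) * X1 ^ k * fps_deriv (\<tau> ^ Suc k)"
      proof -
        have "\<tau> * (cst (flow_coeff k) * z ^ k) = fps_const (fps_const (fps_const (flow_coeff k)) * fps_X ^ k) * \<tau> ^ Suc k"
          unfolding fps_const_mult[symmetric] fps_const_power[symmetric]
          by (simp add: z_def cst_def X1_def power_mult_distrib ac_simps del: fps_const_mult fps_const_power)
        then have "fps_deriv (\<tau> * (cst (flow_coeff k) * z ^ k)) = 
            fps_const (fps_const (fps_const (flow_coeff k)) * fps_X ^ k) * fps_deriv (\<tau> ^ Suc k)"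
          by (simp only: fps_deriv_mult_const_left)
        then show ?thesis
          unfolding fps_const_mult[symmetric] fps_const_power[symmetric] cst_def X1_def .
      qed
      also have "\<dots> = (cst (flow_coeff k) * of_nat (Suc k)) * (fps_deriv \<tau> * (\<tau> ^ k * X1 ^ k))"
        unfolding fps_deriv_power' by (simp add: ac_simps del: of_nat_Suc)
      also have "cst (flow_coeff k) * of_nat (Suc k) = cst ((-1) ^ k / fact k)"
        unfolding cst_of_nat[symmetric] cst_mult[symmetric] al by (simp add: fact_Suc del: of_nat_Suc)
      finally show "fps_deriv (\<tau> * (cst (flow_coeff k) * z ^ k)) = fps_deriv \<tau> * (cst ((-1) ^ k / fact k) * z ^ k)"
        by (simp add: z_def power_mult_distrib ac_simps)
    qed
    also have "\<dots> = fps_deriv \<tau> * E"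
      unfolding E_def by (rule qsum_mult_left[OF aF, symmetric])
    finally show ?thesis using True by (simp add: E1 algebra_simps)
  qed
qed

lemma surf_coeff_const: "q < p \<Longrightarrow> surf_coeff p q (fps_const a) = 0"
  unfolding surf_coeff_def by (intro sum.neutral) (auto simp: coeff3_fps_const)

text \<open>The conjugacy is the flow for \<open>s + a\<close> with \<open>a\<close> free of
  \<open>x\<close>; its \<open>c\<close>-jet on the surface converges, hence so does the derivative
  of the restricted time. The term \<open>a\<close> does not touch the coefficients of
  \<open>x^(q+1) * x1^q\<close>.\<close>

lemma transversally_formal_bound:
  assumes r: "r - 1 \<in> Fil c" and s: "Phi r s - s = 1 - r"
    and tf: "conj_transversally_formal (gg ^ c) (Phi r X, X1, X2) (Phi 1 X, X1, X2)"
  shows "\<exists>R\<ge>1. \<forall>q. norm (surf_coeff (Suc q) q s) \<le> R ^ (2 * q + 1)"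
proof -
  obtain S where S: "(S, X1, X2) \<in> formal_Diff" "transversally_formal_ser (gg ^ c) S"
    "fcomp (S, X1, X2) (Phi r X, X1, X2) = fcomp (Phi 1 X, X1, X2) (S, X1, X2)"
    using tf by (auto simp: conj_transversally_formal_def formal_Diff_p_def transversally_formal_def)
  have "coeff3 S 0 0 0 = 0" using S(1) by (simp add: formal_Diff_def)
  moreover have "Phi r S = subst_x S (Phi 1 X)" using S(3) by (simp add: fcomp_def Phi_eq_subst_x[of r S])
  ultimately obtain a where a: "S = Phi (s + fps_const a) X" using conj_unique[OF r s] by blast
  define s' where "s' = s + fps_const a"
  have "rho (gg ^ c) = 0" using c_pos by (simp add: rho_power)
  \<comment> \<open>The order \<open>c\<close> kills \<open>X\<close> and leaves
    \<open>fact c\<close> times the restriction of \<open>flow_quot s'\<close>.\<close>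
  then have "rho ((d2 ^^ c) S) \<in> conv"
    by (intro transversally_formal_jet[OF vanishing_ideal_Kord S(2)] conv_power conv_gg)
  moreover have "(d2 ^^ c) X = 0" using c_pos d2_X[of "c - 1"] by simp
  ultimately have "cst (fact c) * rho (flow_quot s') \<in> conv"
    by (simp add: a s'_def[symmetric] Phi_X d2n_add rho_add rho_d2n_gg_power)
  then have "cst (1 / fact c) * (cst (fact c) * rho (flow_quot s')) \<in> conv" by (rule conv_mult[OF conv_cst])
  then have psi: "rho (flow_quot s') \<in> conv"
    unfolding mult.assoc[symmetric] cst_mult[symmetric] by simp
  have "fps_deriv (rho s') \<in> conv"
  proof (rule conv_fixpoint[OF _ _ _ rho_flow_quot_deriv])
    show "fps_deriv (rho (flow_quot s')) \<in> conv" by (rule conv_deriv[OF psi])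
    show "(if c = 1 then X1 * rho (flow_quot s') else 0) \<in> conv" using psi by (auto intro: conv_mult conv_X1 conv_0)
    show "coeff3 (if c = 1 then X1 * rho (flow_quot s') else 0) 0 0 0 = 0" by (simp add: coeff3_X1_mult)
  qed
  then obtain R where R: "geo R (fps_deriv (rho s'))" by (auto simp: conv_iff_geo)
  have "norm (surf_coeff (Suc q) q s) \<le> R ^ (2 * q + 1)" for q
  proof -
    have "surf_coeff (Suc q) q s = coeff3 (rho s') (Suc q) q 0"
      by (simp add: coeff3_rho s'_def surf_coeff_add surf_coeff_const)
    moreover have "norm (coeff3 (rho s') (Suc q) q 0) \<le> norm (coeff3 (fps_deriv (rho s')) q q 0)"
    proof -
      have "1 * norm (coeff3 (rho s') (Suc q) q 0) \<le> real (Suc q) * norm (coeff3 (rho s') (Suc q) q 0)"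
        by (intro mult_right_mono) auto
      then show ?thesis by (simp only: coeff3_deriv norm_mult norm_of_nat mult_1)
    qed
    moreover have "norm (coeff3 (fps_deriv (rho s')) q q 0) \<le> R ^ (q + q + 0 + 1)" 
      using R unfolding geo_def by blast
    ultimately show ?thesis by (simp add: mult_2)
  qed
  then show ?thesis using R unfolding geo_def by blast
qed

end

section \<open>The family indexed by \<open>t\<close> and the contradiction\<close>

locale lacunary_setup = pair_setup c lacunary for c
begin

lemma pert_time_Fil: "pert_time t - 1 \<in> Fil c"
  unfolding pert_time_def theta_def using ordge_mult_left[OF ordge_mult_right[OF gg_power_Fil[of c]]] by simp

lemma conv_pert_time: "pert_time t \<in> conv"
  unfolding pert_time_def theta_def by (intro conv_add conv_mult conv_cst conv_power conv_gg conv_1 conv_lacunary)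

text \<open>The coefficient of \<open>x ^ (q + 1) * x1 ^ q\<close> on the surface, as a polynomial in \<open>t\<close>.\<close>

definition time_poly :: "nat \<Rightarrow> complex poly" where
  "time_poly q = (\<Sum>n\<le>q. monom (surf_coeff (Suc q) q (time_coeff (Suc n))) (Suc n))"

lemma degree_time_poly: "degree (time_poly q) \<le> Suc q"
  unfolding time_poly_def by (intro degree_sum_le) (auto intro: order_trans[OF degree_monom_le])

lemma coeff_time_poly: "1 \<le> q \<Longrightarrow> coeff (time_poly q) 2 = surf_coeff (Suc q) q (time_coeff (Suc (Suc 0)))"
proof -
  assume "1 \<le> q"
  have "coeff (time_poly q) 2 = (\<Sum>n\<le>q. if n = 1 then surf_coeff (Suc q) q (time_coeff (Suc n)) else 0)"
    unfolding time_poly_def coeff_sum by (intro sum.cong) auto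
  then show ?thesis using \<open>1 \<le> q\<close> by simp
qed

text \<open>\<open>time_coeff (Suc n)\<close> lies in \<open>Fil n\<close>, so powers of
  \<open>t\<close> beyond \<open>q + 1\<close> do not reach the exponent \<open>q\<close> of
  \<open>x1\<close>, and the truncated sum is exact.\<close>

lemma poly_time_poly: "poly (time_poly q) t = surf_coeff (Suc q) q (conj_time t)"
proof -
  have F: "cst (t ^ Suc n) * time_coeff (Suc n) \<in> Fil n" for n by (intro ordge_mult_left time_coeff_Fil)
  have "surf_coeff (Suc q) q (conj_time t) = surf_coeff (Suc q) q (\<Sum>n<Suc q. cst (t ^ Suc n) * time_coeff (Suc n))"
    using surf_coeff_Fil[OF qsum_approx[OF F, of "Suc q"], of "Suc q"] by (simp only: surf_coeff_diff conj_time_def) simp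
  also have "\<dots> = (\<Sum>n\<le>q. t ^ Suc n * surf_coeff (Suc q) q (time_coeff (Suc n)))"
    by (simp only: surf_coeff_sum surf_coeff_cst_mult lessThan_Suc_atMost)
  finally show ?thesis by (simp add: time_poly_def poly_sum poly_monom mult.commute)
qed

lemma coeff_time_poly_ge:
  fixes a :: nat
  defines "l \<equiv> 3 ^ a"
  shows "5 / 60 ^ l * (fact l * (1/4) ^ (l + c + l * c))\<^sup>2 \<le> norm (coeff (time_poly (c * Suc (2 * l))) 2)"
proof -
  let ?q = "c * Suc (2 * l)"
  have l: "1 \<le> l" by (simp add: l_def)
  have q: "1 \<le> ?q" using c_pos by simp
  have "coeff (time_poly ?q) 2 = fps_nth todd (2 * l) * surf_coeff (Suc ?q) ?q (intX (lacunary * (Y ^^ (2 * l)) theta))"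
    unfolding coeff_time_poly[OF q] surf_coeff_sq2 by (rule surf_coeff_Op_theta[OF lacunary_homog])
  also have "surf_coeff (Suc ?q) ?q (intX (lacunary * (Y ^^ (2 * l)) theta)) = of_real (int01 (px ^ l * (poly_field ^^ (2 * l)) (f0 l)))"
    using surf_coeff_lacunary[of a] by (simp add: theta_def l_def)
  finally have "norm (coeff (time_poly ?q) 2) = norm (fps_nth todd (2 * l)) * \<bar>int01 (px ^ l * (poly_field ^^ (2 * l)) (f0 l))\<bar>"
    by (simp add: norm_mult)
  then show ?thesis using mult_mono[OF todd_coeff_ge[OF l] int01_lower_bound[OF l]] by simp
qed

theorem not_all_transversally_formal:
  "\<exists>t. \<not> conj_transversally_formal (gg ^ c) (Phi (pert_time t) X, X1, X2) (Phi 1 X, X1, X2)"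
proof (rule ccontr)
  assume "\<nexists>t. \<not> conj_transversally_formal (gg ^ c) (Phi (pert_time t) X, X1, X2) (Phi 1 X, X1, X2)"
  then have "\<exists>R\<ge>1. \<forall>q. norm (poly (time_poly q) t) \<le> R ^ (2 * q + 1)" for t
    unfolding poly_time_poly using transversally_formal_bound[OF pert_time_Fil Phi_conj_time] by blast
  from polynomial_family_bound[OF degree_time_poly this, of 2]
  obtain M where M: "1 \<le> M" "\<And>q. norm (coeff (time_poly q) 2) \<le> M ^ Suc q" by blast
  \<comment> \<open>\<open>C * D ^ l\<close> is the upper bound \<open>M ^ Suc q\<close> for
    \<open>q = c * (2 * l + 1)\<close>, multiplied by the geometric losses \<open>60 ^ l\<close>
    (Todd coefficient) and \<open>16 ^ (l + c + l * c)\<close> (squared beta bound).\<close>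
  define C where "C = 16 ^ c * M ^ Suc c"
  define D where "D = 60 * 16 ^ (1 + c) * M ^ (2 * c)"
  have "0 < C" using M by (simp add: C_def)
  have bound: "5 * fact l \<le> C * D ^ l" if "l = 3 ^ a" for a l :: nat
  proof -
    have "5 / 60 ^ l * (fact l * (1/4) ^ (l + c + l * c))\<^sup>2 \<le> M ^ Suc (c * Suc (2 * l))"
      using coeff_time_poly_ge[of a] M(2)[of "c * Suc (2 * l)"] that by simp
    moreover have "((1/4::real) ^ n)\<^sup>2 = 1 / 16 ^ n" for n
      by (simp add: power2_eq_square power_divide flip: power_mult_distrib)
    ultimately have "5 * (fact l)\<^sup>2 / (60 ^ l * 16 ^ (l + c + l * c)) \<le> M ^ Suc (c * Suc (2 * l))"
      by (simp add: power_mult_distrib)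
    then have "5 * (fact l)\<^sup>2 \<le> M ^ Suc (c * Suc (2 * l)) * (60 ^ l * 16 ^ (l + c + l * c))"
      by (simp add: pos_divide_le_eq)
    also have "\<dots> = C * D ^ l"
    proof -
      have "(16 ^ (1 + c)) ^ l = (16 :: real) ^ (l + l * c)" "(M ^ (2 * c)) ^ l = M ^ (2 * l * c)"
        by (simp_all add: algebra_simps flip: power_mult power_add)
      then have "D ^ l = 60 ^ l * 16 ^ (l + l * c) * M ^ (2 * l * c)"
        by (simp only: D_def power_mult_distrib)
      moreover have "M ^ Suc (c * Suc (2 * l)) = M ^ Suc c * M ^ (2 * l * c)"
        by (subst power_add[symmetric]) (simp add: algebra_simps)
      moreover have "(16 :: real) ^ (l + c + l * c) = 16 ^ c * 16 ^ (l + l * c)"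
        by (subst power_add[symmetric]) (simp add: algebra_simps)
      ultimately show ?thesis unfolding C_def by (simp only: ac_simps)
    qed
    finally have "5 * (fact l)\<^sup>2 \<le> C * D ^ l" .
    moreover have "(fact l :: real) * 1 \<le> fact l * fact l" by (intro mult_left_mono fact_ge_1) simp
    ultimately show ?thesis unfolding power2_eq_square mult_1_right by linarith
  qed
  \<comment> \<open>Factorials outgrow \<open>C * D ^ n\<close>; the index \<open>3 ^ N\<close>
    exceeds \<open>N\<close> and is among those for which the bound was shown.\<close>
  have "(\<lambda>n. D ^ n /\<^sub>R fact n) \<longlonglongrightarrow> 0"
    using summable_LIMSEQ_zero[OF summable_exp_generic[of D]] .
  then have "\<forall>\<^sub>F n in sequentially. D ^ n /\<^sub>R fact n < 1 / C"
    by (rule order_tendstoD) (use \<open>0 < C\<close> in simp)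
  then obtain N where N: "\<And>n. n \<ge> N \<Longrightarrow> D ^ n /\<^sub>R fact n < 1 / C"
    unfolding eventually_sequentially by blast
  have "N < 2 ^ N" by (rule less_exp)
  also have "(2::nat) ^ N \<le> 3 ^ N" by (rule power_mono) auto
  finally have "N \<le> 3 ^ N" by simp
  from N[OF this] have "C * D ^ (3 ^ N) < fact (3 ^ N)"
    using \<open>0 < C\<close> by (simp add: field_simps)
  moreover have "(0::real) < fact (3 ^ N)" by simp
  ultimately show False using bound[OF refl, of N] by linarith
qed

end

theorem theorem2p2:
  fixes c :: nat and f :: ser
  assumes "c \<ge> 1" and "f = (X2 - X * X1) ^ c"
  shows "\<exists>\<phi>1\<in>D_set f. \<exists>\<phi>2\<in>D_set f.
    conj_formal f \<phi>1 \<phi>2 \<and> \<not> conj_transversally_formal f \<phi>1 \<phi>2"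
proof -
  interpret lacunary_setup c by unfold_locales (rule assms(1))
  have f: "f = gg ^ c" by (simp add: assms(2) gg_def)
  obtain t where t: "\<not> conj_transversally_formal (gg ^ c) (Phi (pert_time t) X, X1, X2) (Phi 1 X, X1, X2)"
    using not_all_transversally_formal by blast
  have "(Phi (pert_time t) X, X1, X2) \<in> D_set f" 
    unfolding f by (intro Phi_D_set conv_pert_time ordge_mono[OF pert_time_Fil] c_pos)
  moreover have "(Phi 1 X, X1, X2) \<in> D_set f"
    unfolding f by (intro Phi_D_set conv_1) simp
  moreover have "conj_formal f (Phi (pert_time t) X, X1, X2) (Phi 1 X, X1, X2)"
    unfolding f by (rule conj_formal_of_time[OF Phi_conj_time])
  ultimately show ?thesis using t unfolding f by blast
qed

end
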